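(* Let $\mathcal{H}$ be a separable Hilbert space and $\mathcal{L}=\mathcal{L}(\mathcal{H})$ its space of bounded linear transformations. Let $\alpha>0$ and suppose that $\phi:\mathbb{D}\to\mathcal{L}$ is analytic. Then $D^\alpha\Gamma_\phi$ is $H^2(\mathcal{H})$-bounded, i.e. $$\left\|D^\alpha\Gamma_\phi\right\|_{H^2(\mathcal{H})\to H^2(\mathcal{H})}=\sup_{f\in\mathcal{O}_1(\mathcal{H})}\left\|D^\alpha\Gamma_\phi f\right\|_{H^2(\mathcal{H})}<\infty,$$ if and only if $D^\alpha\phi\in \mathrm{BMOA}_{\mathcal{C}}(\mathcal{L})$, i.e. $$\left\|D^\alpha\phi\right\|_{\mathrm{BMOA}_{\mathcal{C}}}^2=\sup_{f\in\mathcal{O}_1(\mathcal{H})}\int_{\mathbb{D}} \left\| (D^{1+\alpha}\phi)(z)\, f(\overline{z})\right\|_{\mathcal{H}}^2(1-|z|^2)\,dA(z)<\infty.$$ Moreover, $\left\|D^\alpha\Gamma_\phi\right\|_{H^2(\mathcal{H})\to H^2(\mathcal{H})}\approx \left\|D^\alpha\phi\right\|_{\mathrm{BMOA}_{\mathcal{C}}}$, i.e. each of these two quantities is bounded by a constant times the other, with constants independent of $\phi$.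
   Context: $\mathbb{D}$ is the open unit disc in $\mathbb{C}$ and $dA$ is area measure. For a Banach space $\mathcal{Y}$, $\mathrm{Hol}(\mathcal{Y})$ is the space of $\mathcal{Y}$-valued analytic functions on $\mathbb{D}$, $\hat f(n)$ is the $n$th Taylor coefficient of $f$ at the origin, and $\mathcal{O}(\mathcal{Y})$ is the set of $f\in\mathrm{Hol}(\mathcal{Y})$ that extend analytically to a larger disc centered at the origin. $H^2(\mathcal{H})$ is the Hardy space of $f\in\mathrm{Hol}(\mathcal{H})$ with $\|f\|_{H^2(\mathcal{H})}^2=\sum_{n\ge0}\|\hat f(n)\|_{\mathcal{H}}^2<\infty$ (the norm is $\infty$ otherwise), and $\mathcal{O}_1(\mathcal{H})=\{f\in\mathcal{O}(\mathcal{H}):\|f\|_{H^2(\mathcal{H})}=1\}$. For $\alpha\in\mathbb{R}$ and $f\in \mathrm{Hol}(\mathcal{Y})$, $D^\alpha f(z)=\sum_{n\ge 0}(1+n)^\alpha\hat f(n)z^n$, with $D=D^1$. For $\phi\in\mathrm{Hol}(\mathcal{L})$ and $f\in\mathcal{O}(\mathcal{H})$, the Hankel operator is $\Gamma_\phi f(z)=\sum_{n\ge0}\left(\sum_{m\ge0}\hat\phi(m+n)\hat f(m)\right)z^n$, $z\in\mathbb{D}$. For $\psi\in\mathrm{Hol}(\mathcal{L})$, $\|\psi\|_{\mathrm{BMOA}_{\mathcal{C}}}^2=\sup_{f\in\mathcal{O}_1(\mathcal{H})}\int_{\mathbb{D}}\|(D\psi)(z)f(\overline z)\|_{\mathcal{H}}^2(1-|z|^2)\,dA(z)$,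 and $\psi\in\mathrm{BMOA}_{\mathcal{C}}(\mathcal{L})$ iff this is finite. *)

theory Defs
  imports "HOL-Analysis.Analysis"
begin

section \<open>Complex normed spaces and complex Hilbert spaces\<close>

class complex_normed_vector = real_normed_vector +
  fixes scaleC :: "complex \<Rightarrow> 'a \<Rightarrow> 'a"  (infixr "*\<^sub>C" 75)
  assumes scaleC_add_right: "c *\<^sub>C (x + y) = c *\<^sub>C x + c *\<^sub>C y"
    and scaleC_add_left: "(c + d) *\<^sub>C x = c *\<^sub>C x + d *\<^sub>C x"
    and scaleC_scaleC: "c *\<^sub>C d *\<^sub>C x = (c * d) *\<^sub>C x"
    and scaleC_of_real: "complex_of_real r *\<^sub>C x = r *\<^sub>R x"
    and norm_scaleC: "norm (c *\<^sub>C x) = cmod c * norm x"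

lemma scaleC_zero_right [simp]: "c *\<^sub>C (0::'a::complex_normed_vector) = 0"
  by (metis norm_eq_zero norm_scaleC mult_zero_right)

lemma scaleC_minus_right: "c *\<^sub>C (- x) = - (c *\<^sub>C (x::'a::complex_normed_vector))"
  by (metis add.right_inverse add_eq_0_iff scaleC_add_right scaleC_zero_right)

lemma scaleC_diff_right:
  "c *\<^sub>C (x - y) = c *\<^sub>C x - c *\<^sub>C (y::'a::complex_normed_vector)"
  by (metis scaleC_add_right scaleC_minus_right diff_conv_add_uminus)

lemma scaleC_scaleR: "c *\<^sub>C r *\<^sub>R x = r *\<^sub>R c *\<^sub>C (x::'a::complex_normed_vector)"
  by (metis scaleC_of_real scaleC_scaleC mult.commute)

lemma bounded_linear_scaleC_right:
  "bounded_linear (\<lambda>x::'a::complex_normed_vector. c *\<^sub>C x)"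
  by (rule bounded_linear_intro[where K = "cmod c"])
    (auto simp: scaleC_add_right scaleC_scaleR norm_scaleC)

text \<open>The inner product is linear in its first argument; its positive definiteness is contained
  in the last axiom. The zero space is allowed.\<close>

class complex_hilbert_space = complex_normed_vector + banach +
  fixes cinner :: "'a \<Rightarrow> 'a \<Rightarrow> complex"
  assumes cinner_commute: "cinner x y = cnj (cinner y x)"
    and cinner_add_left: "cinner (x + y) z = cinner x z + cinner y z"
    and cinner_scaleC_left: "cinner (c *\<^sub>C x) y = c * cinner x y"
    and cinner_self: "cinner x x = complex_of_real ((norm x)\<^sup>2)"

instantiation complex :: complex_hilbert_space
begin

definition scaleC_complex_def: "c *\<^sub>C (z::complex) = c * z"
definition cinner_complex_def: "cinner z w = z * cnj w"

instance
  by standard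
    (auto simp: scaleC_complex_def cinner_complex_def algebra_simps norm_mult scaleR_conv_of_real
      simp flip: complex_norm_square)

end


section \<open>Bounded complex-linear operators\<close>

text \<open>The space of bounded complex-linear maps, with the operator norm inherited from the space
  of bounded real-linear maps.\<close>

typedef (overloaded) ('a, 'b) cblinfun =
  "{A :: 'a::complex_normed_vector \<Rightarrow>\<^sub>L 'b::complex_normed_vector.
     \<forall>c x. blinfun_apply A (c *\<^sub>C x) = c *\<^sub>C blinfun_apply A x}"
  morphisms blinfun_of_cblinfun cblinfun_of_blinfun
  by (rule exI[of _ 0]) simp

setup_lifting type_definition_cblinfun

lift_definition cblinfun_apply ::
  "('a::complex_normed_vector, 'b::complex_normed_vector) cblinfun \<Rightarrow> 'a \<Rightarrow> 'b"
  is blinfun_apply .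

lemma blinfun_apply_scaleC [simp]:
  "blinfun_apply (Blinfun ((*\<^sub>C) c)) (x :: 'a::complex_normed_vector) = c *\<^sub>C x"
  by (simp add: bounded_linear_Blinfun_apply bounded_linear_scaleC_right)

lemma norm_scaleC_blinfun_compose:
  "norm (Blinfun ((*\<^sub>C) c) o\<^sub>L A) = cmod c * norm A"
  for A :: "'a::real_normed_vector \<Rightarrow>\<^sub>L 'b::complex_normed_vector"
proof -
  have "norm (Blinfun ((*\<^sub>C) c) o\<^sub>L A) = norm (cmod c *\<^sub>R A)"
    by (simp add: norm_blinfun.rep_eq onorm_def norm_scaleC blinfun.scaleR_left del: norm_scaleR)
       (simp add: blinfun.scaleR_left)
  then show ?thesis by simp
qed

instantiation cblinfun :: (complex_normed_vector, complex_normed_vector) complex_normed_vector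
begin

lift_definition zero_cblinfun :: "('a, 'b) cblinfun" is 0 by simp

lift_definition plus_cblinfun ::
  "('a, 'b) cblinfun \<Rightarrow> ('a, 'b) cblinfun \<Rightarrow> ('a, 'b) cblinfun" is plus
  by (simp add: blinfun.add_left scaleC_add_right)

lift_definition uminus_cblinfun :: "('a, 'b) cblinfun \<Rightarrow> ('a, 'b) cblinfun" is uminus
  by (simp add: blinfun.minus_left scaleC_minus_right)

lift_definition minus_cblinfun ::
  "('a, 'b) cblinfun \<Rightarrow> ('a, 'b) cblinfun \<Rightarrow> ('a, 'b) cblinfun" is minus
  by (simp add: blinfun.diff_left scaleC_diff_right)

lift_definition scaleR_cblinfun :: "real \<Rightarrow> ('a, 'b) cblinfun \<Rightarrow> ('a, 'b) cblinfun" is scaleR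
  by (simp add: blinfun.scaleR_left scaleC_scaleR)

lift_definition scaleC_cblinfun :: "complex \<Rightarrow> ('a, 'b) cblinfun \<Rightarrow> ('a, 'b) cblinfun"
  is "\<lambda>c A. Blinfun ((*\<^sub>C) c) o\<^sub>L A"
  by (simp add: scaleC_scaleC mult.commute)

lift_definition norm_cblinfun :: "('a, 'b) cblinfun \<Rightarrow> real" is norm .

lift_definition dist_cblinfun :: "('a, 'b) cblinfun \<Rightarrow> ('a, 'b) cblinfun \<Rightarrow> real" is dist .

definition sgn_cblinfun :: "('a, 'b) cblinfun \<Rightarrow> ('a, 'b) cblinfun"
  where "sgn_cblinfun A = scaleR (inverse (norm A)) A"

definition uniformity_cblinfun :: "(('a, 'b) cblinfun \<times> ('a, 'b) cblinfun) filter"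
  where "uniformity_cblinfun = (INF e\<in>{0<..}. principal {(A, B). dist A B < e})"

definition open_cblinfun :: "('a, 'b) cblinfun set \<Rightarrow> bool"
  where "open_cblinfun S = (\<forall>A\<in>S. \<forall>\<^sub>F (A', B) in uniformity. A' = A \<longrightarrow> B \<in> S)"

instance
proof
  fix A B C :: "('a, 'b) cblinfun" and r s :: real and c d :: complex
  show "dist A B = norm (A - B)" by transfer (rule dist_norm)
  show "sgn A = inverse (norm A) *\<^sub>R A" by (rule sgn_cblinfun_def)
  show "uniformity = (INF e\<in>{0<..}. principal {(x, y :: ('a, 'b) cblinfun). dist x y < e})"
    by (rule uniformity_cblinfun_def)
  show "open U = (\<forall>x\<in>U. \<forall>\<^sub>F (x', y) in uniformity. x' = x \<longrightarrow> y \<in> U)"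
    for U :: "('a, 'b) cblinfun set"
    by (rule open_cblinfun_def)
  show "A + B + C = A + (B + C)" by transfer (rule add.assoc)
  show "A + B = B + A" by transfer (rule add.commute)
  show "0 + A = A" by transfer simp
  show "- A + A = 0" by transfer simp
  show "A - B = A + - B" by transfer simp
  show "r *\<^sub>R (A + B) = r *\<^sub>R A + r *\<^sub>R B" by transfer (rule scaleR_add_right)
  show "(r + s) *\<^sub>R A = r *\<^sub>R A + s *\<^sub>R A" by transfer (rule scaleR_add_left)
  show "r *\<^sub>R s *\<^sub>R A = (r * s) *\<^sub>R A" by transfer simp
  show "1 *\<^sub>R A = A" by transfer simp
  show "(norm A = 0) = (A = 0)" by transfer simp
  show "norm (A + B) \<le> norm A + norm B" by transfer (rule norm_triangle_ineq)
  show "norm (r *\<^sub>R A) = \<bar>r\<bar> * norm A" by transfer simp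
  show "c *\<^sub>C (A + B) = c *\<^sub>C A + c *\<^sub>C B"
    by transfer (auto intro!: blinfun_eqI
        simp: blinfun.add_left scaleC_add_right)
  show "(c + d) *\<^sub>C A = c *\<^sub>C A + d *\<^sub>C A"
    by transfer (auto intro!: blinfun_eqI
        simp: blinfun.add_left scaleC_add_left)
  show "c *\<^sub>C d *\<^sub>C A = (c * d) *\<^sub>C A"
    by transfer (auto intro!: blinfun_eqI simp: scaleC_scaleC)
  show "complex_of_real r *\<^sub>C A = r *\<^sub>R A"
    by transfer (auto intro!: blinfun_eqI
        simp: blinfun.scaleR_left scaleC_of_real)
  show "norm (c *\<^sub>C A) = cmod c * norm A"
    by transfer (rule norm_scaleC_blinfun_compose)
qed

end

instance cblinfun :: (complex_normed_vector, "{complex_normed_vector, banach}") banach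
proof
  fix X :: "nat \<Rightarrow> ('a, 'b) cblinfun"
  assume X: "Cauchy X"
  have dist_eq: "dist (blinfun_of_cblinfun A) (blinfun_of_cblinfun B) = dist A B"
    for A B :: "('a, 'b) cblinfun"
    by (simp add: dist_cblinfun.rep_eq)
  have "Cauchy (\<lambda>n. blinfun_of_cblinfun (X n))"
    using X by (simp add: Cauchy_def dist_eq)
  then obtain L where L: "(\<lambda>n. blinfun_of_cblinfun (X n)) \<longlonglongrightarrow> L"
    using Cauchy_convergent convergentD by blast
  have "blinfun_apply L (c *\<^sub>C x) = c *\<^sub>C blinfun_apply L x" for c x
  proof (rule LIMSEQ_unique)
    show "(\<lambda>n. blinfun_apply (blinfun_of_cblinfun (X n)) (c *\<^sub>C x)) \<longlonglongrightarrow> blinfun_apply L (c *\<^sub>C x)"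
      by (intro tendsto_intros L)
    have "blinfun_apply (blinfun_of_cblinfun (X n)) (c *\<^sub>C x) =
        c *\<^sub>C blinfun_apply (blinfun_of_cblinfun (X n)) x" for n
      using blinfun_of_cblinfun[of "X n"] by blast
    then show "(\<lambda>n. blinfun_apply (blinfun_of_cblinfun (X n)) (c *\<^sub>C x))
        \<longlonglongrightarrow> c *\<^sub>C blinfun_apply L x"
      by (simp, intro bounded_linear.tendsto[OF bounded_linear_scaleC_right] tendsto_intros L)
  qed
  then have "blinfun_of_cblinfun (cblinfun_of_blinfun L) = L"
    by (simp add: cblinfun_of_blinfun_inverse)
  then have "X \<longlonglongrightarrow> cblinfun_of_blinfun L"
    using L by (simp add: tendsto_iff flip: dist_eq)
  then show "convergent X" by (rule convergentI)
qed


section \<open>Vector-valued analytic functions on the disc\<close>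

text \<open>The library's complex derivative, holomorphy and \<open>deriv\<close> only cover functions with values in
  a field; these are the same notions for functions with values in a complex normed space.
  Functions on a subset of the plane are total functions whose values elsewhere are irrelevant.\<close>

definition has_complex_derivative ::
    "(complex \<Rightarrow> 'a::complex_normed_vector) \<Rightarrow> 'a \<Rightarrow> complex filter \<Rightarrow> bool"
    (infix "has'_complex'_derivative" 50)
  where "(f has_complex_derivative D) F \<longleftrightarrow> (f has_derivative (\<lambda>h. h *\<^sub>C D)) F"

definition analytic_in :: "(complex \<Rightarrow> 'a::complex_normed_vector) \<Rightarrow> complex set \<Rightarrow> bool"
  where "analytic_in f U \<longleftrightarrow> open U \<and> (\<forall>z\<in>U. \<exists>D. (f has_complex_derivative D) (at z))"

definition complex_deriv :: "(complex \<Rightarrow> 'a::complex_normed_vector) \<Rightarrow> complex \<Rightarrow> 'a"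
  where "complex_deriv f z = (SOME D. (f has_complex_derivative D) (at z))"

definition taylor_coeff :: "(complex \<Rightarrow> 'a::complex_normed_vector) \<Rightarrow> nat \<Rightarrow> 'a"
  where "taylor_coeff f n = (1 / fact n) *\<^sub>R (complex_deriv ^^ n) f 0"

definition Hol :: "(complex \<Rightarrow> 'a::{complex_normed_vector, banach}) set"
  where "Hol = {f. analytic_in f (ball 0 1)}"

text \<open>Analytic functions on the unit disc that extend analytically to a larger disc.\<close>

definition Hol_ext :: "(complex \<Rightarrow> 'a::{complex_normed_vector, banach}) set"
  where "Hol_ext = {f \<in> Hol. \<exists>r>1. \<exists>g. analytic_in g (ball 0 r) \<and> (\<forall>z\<in>ball 0 1. g z = f z)}"

definition ennreal_sqrt :: "ennreal \<Rightarrow> ennreal"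
  where "ennreal_sqrt x = (if x = \<infinity> then \<infinity> else ennreal (sqrt (enn2real x)))"

definition H2_norm :: "(complex \<Rightarrow> 'h::complex_hilbert_space) \<Rightarrow> ennreal"
  where "H2_norm f = ennreal_sqrt (\<Sum>n. ennreal ((norm (taylor_coeff f n))\<^sup>2))"

definition Hol_ext1 :: "(complex \<Rightarrow> 'h::complex_hilbert_space) set"
  where "Hol_ext1 = {f \<in> Hol_ext. H2_norm f = 1}"

definition H2_operator_norm ::
    "((complex \<Rightarrow> 'h::complex_hilbert_space) \<Rightarrow> complex \<Rightarrow> 'h) \<Rightarrow> ennreal"
  where "H2_operator_norm T = (SUP f\<in>Hol_ext1. H2_norm (T f))"


section \<open>Fractional derivatives, Hankel operators and BMOA\<close>

definition frac_deriv ::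
    "real \<Rightarrow> (complex \<Rightarrow> 'a::{complex_normed_vector, banach}) \<Rightarrow> complex \<Rightarrow> 'a"
  where "frac_deriv \<alpha> f z = (\<Sum>n. (1 + real n) powr \<alpha> *\<^sub>R z ^ n *\<^sub>C taylor_coeff f n)"

definition hankel ::
    "(complex \<Rightarrow> ('h, 'h) cblinfun) \<Rightarrow> (complex \<Rightarrow> 'h) \<Rightarrow> complex \<Rightarrow> 'h::complex_hilbert_space"
  where "hankel \<phi> f z =
    (\<Sum>n. z ^ n *\<^sub>C (\<Sum>m. cblinfun_apply (taylor_coeff \<phi> (m + n)) (taylor_coeff f m)))"

definition BMOA_C_norm :: "(complex \<Rightarrow> ('h::complex_hilbert_space, 'h) cblinfun) \<Rightarrow> ennreal"
  where "BMOA_C_norm \<psi> = ennreal_sqrt (SUP f\<in>Hol_ext1. \<integral>\<^sup>+z\<in>ball 0 1.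
    ennreal ((norm (cblinfun_apply (frac_deriv 1 \<psi> z) (f (cnj z))))\<^sup>2 * (1 - (cmod z)\<^sup>2)) \<partial>lborel)"

definition BMOA_C :: "(complex \<Rightarrow> ('h::complex_hilbert_space, 'h) cblinfun) set"
  where "BMOA_C = {\<psi> \<in> Hol. BMOA_C_norm \<psi> < \<infinity>}"

end

theory Submission
  imports Defs "HOL-Complex_Analysis.Complex_Analysis" "HOL-Real_Asymp.Real_Asymp"
begin

text \<open>
  Write \<open>P k\<close> for the Taylor coefficients of \<open>\<phi>\<close>, \<open>\<Gamma> f n = (\<Sum>m. P (m + n) (f m))\<close> and \<open>u = |z|^2\<close>.

  The Carleson condition bounds the Hankel operator: for a polynomial \<open>f\<close> and \<open>n \<ge> 0\<close>, the \<open>n\<close>-th Fourier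
  coefficient of \<open>(D^(1+\<alpha>) \<phi>)(z) f(cnj z)\<close> on the circle \<open>|z|^2 = u\<close> is \<open>|z|^n g n u\<close> with
  \<open>g n u = (\<Sum>m. (1 + m + n)^(1+\<alpha>) u^m P (m + n) (f m))\<close>. Since
  \<open>\<Gamma>(1+\<alpha>) (m+n+1)^(-1-\<alpha>)\<close> is the integral of \<open>t^\<alpha> e^(-(m+n+1) t)\<close>, the vector \<open>\<Gamma> f n\<close> is an integral of
  \<open>g n (e^(-t))\<close> against a fixed weight; Cauchy-Schwarz and Parseval finish the argument.

  Conversely, \<open>(D^(1+\<alpha>) \<phi>)(z) x = D^(1+\<alpha>) \<Gamma> x (z)\<close> for a constant \<open>x\<close>, so with \<open>x = f(cnj z)\<close> the Carleson
  integrand is \<open>D^(1+\<alpha>) \<Gamma> f (z)\<close>, which Parseval controls, minus \<open>D^(1+\<alpha>) \<Gamma> (f - f(cnj z)) (z)\<close>.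
  Because \<open>\<Gamma>\<close> intertwines the shift and its adjoint,
  \<open>D^(1+\<alpha>) \<Gamma> h (z) = (\<Sum>n. c n z^n \<Gamma> (h / (1 - z w)) n)\<close> with \<open>c n = (1+n)^(1+\<alpha>) - n^(1+\<alpha>)\<close>. This bounds
  the error by the circle mean \<open>(\<Sum>m. |f m|^2 (1 - u^m) / (1 - u))\<close> of \<open>|(f - f(cnj z)) / (1 - z w)|^2\<close>, which suffices
  for the frequencies with \<open>m (1 - u) \<le> 1\<close>. The remaining ones are estimated through
  \<open>(\<Sum>j. (1+j)^(2\<alpha>-\<delta>) |\<Gamma> f j|^2) \<le> C (\<Sum>m. (1+m)^(-\<delta>) |f m|^2)\<close>, and this is where \<open>\<alpha> > 0\<close> enters.
\<close>

section \<open>Power series with vector coefficients\<close>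

text \<open>The bound obtained from the shift relation alone fails by a logarithm. On the circle
  |z|^2 = u it gives |f m|^2 the weight (1 - u^m) / (1 - u)^2, whose integral against 1 - u over
  [0, 1] is the harmonic number 1 + 1/2 + ... + 1/m. The part where m (1 - u) \<le> 1 contributes at
  most 1, so the loss comes only from frequencies that are high relative to the circle. Hence the
  cut-off moves with u, and f is split anew on every circle. In the high part, f and f(cnj z) are
  estimated separately: the cancellation between them is given up in exchange for the weighted
  estimate, which produces the weight m^(-\<delta>) (1 - u)^(-2-\<delta>). Against 1 - u this
  integrates over [0, 1 - 1/m] to at most 1/\<delta>, uniformly in m. Any 0 < \<delta> \<le> min
  \<alpha> 1 serves; the upper limit \<alpha> comes from the weighted estimate. In the opposite
  direction positivity of \<alpha> matters as well: Cauchy-Schwarz leaves the integral of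
  t^(2\<alpha>-1) near 0, the source of Gamma(2\<alpha>) in the constant.\<close>

lemma bounded_bilinear_scaleC: "bounded_bilinear ((*\<^sub>C) :: complex \<Rightarrow> 'a::complex_normed_vector \<Rightarrow> 'a)"
proof
  show "\<exists>K. \<forall>a (b::'a). norm (a *\<^sub>C b) \<le> norm a * norm b * K"
    by (rule exI[of _ 1]) (simp add: norm_scaleC)
  show "(r *\<^sub>R a) *\<^sub>C b = r *\<^sub>R (a *\<^sub>C b)" for r a and b :: 'a
    by (metis scaleC_of_real scaleC_scaleC scaleR_conv_of_real)
qed (simp_all add: scaleC_add_left scaleC_add_right scaleC_scaleR)

interpretation scaleC: bounded_bilinear "(*\<^sub>C) :: complex \<Rightarrow> 'a::complex_normed_vector \<Rightarrow> 'a"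
  by (rule bounded_bilinear_scaleC)

lemmas has_derivative_scaleC[derivative_intros] = scaleC.FDERIV
  and continuous_on_scaleC[continuous_intros] = scaleC.continuous_on

lemma scaleC_one [simp]: "1 *\<^sub>C x = (x::'a::complex_normed_vector)"
  using scaleC_of_real[of 1 x] by simp

lemma scaleC_zero_left [simp]: "0 *\<^sub>C x = (0::'a::complex_normed_vector)"
  by (rule scaleC.zero_left)

lemma bounded_linear_cblinfun_apply: "bounded_linear (cblinfun_apply T)"
  by transfer (rule blinfun.bounded_linear_right)

lemma bounded_linear_cblinfun_apply_left: "bounded_linear (\<lambda>T. cblinfun_apply T x)"
proof (rule bounded_linear_intro[where K = "norm x"])
  show "cblinfun_apply (S + T) x = cblinfun_apply S x + cblinfun_apply T x" for S T
    by transfer (simp add: blinfun.add_left)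
  show "cblinfun_apply (r *\<^sub>R T) x = r *\<^sub>R cblinfun_apply T x" for r T
    by transfer (simp add: blinfun.scaleR_left)
  show "norm (cblinfun_apply T x) \<le> norm T * norm x" for T
    by transfer (rule norm_blinfun)
qed

lemma norm_cblinfun_apply: "norm (cblinfun_apply T x) \<le> norm T * norm x"
  by transfer (rule norm_blinfun)

lemma cblinfun_apply_scaleC: "cblinfun_apply T (c *\<^sub>C x) = c *\<^sub>C cblinfun_apply T x"
  by transfer simp

lemma cblinfun_apply_scaleC_left: "cblinfun_apply (c *\<^sub>C T) x = c *\<^sub>C cblinfun_apply T x"
  by transfer (simp add: blinfun_apply_blinfun_compose)

lemmas cblinfun_apply_simps =
  linear_simps[OF bounded_linear_cblinfun_apply]
  linear_simps[OF bounded_linear_cblinfun_apply_left]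
  cblinfun_apply_scaleC cblinfun_apply_scaleC_left

lemma continuous_on_cblinfun_apply[continuous_intros]:
  fixes f :: "'c::topological_space \<Rightarrow> ('a::complex_normed_vector, 'b::complex_normed_vector) cblinfun"
  assumes "continuous_on S f" "continuous_on S g"
  shows "continuous_on S (\<lambda>x. cblinfun_apply (f x) (g x))"
proof -
  have "bounded_bilinear (cblinfun_apply :: ('a,'b) cblinfun \<Rightarrow> _)"
    by standard (auto simp: cblinfun_apply_simps intro!: exI[of _ 1] norm_cblinfun_apply)
  from bounded_bilinear.continuous_on[OF this assms] show ?thesis .
qed

section \<open>Inner product identities and the Cauchy-Schwarz inequality\<close>

lemma cinner_add_right: "cinner x (y + z) = cinner x y + cinner x (z::'a::complex_hilbert_space)"
  by (metis cinner_commute cinner_add_left complex_cnj_add)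

lemma cinner_scaleC_right: "cinner x (c *\<^sub>C y) = cnj c * cinner x (y::'a::complex_hilbert_space)"
  by (metis cinner_commute cinner_scaleC_left complex_cnj_mult)

lemma cinner_minus_right: "cinner x (- y) = - cinner x (y::'a::complex_hilbert_space)"
  using cinner_scaleC_right[of x "-1" y] scaleC_of_real[of "-1" y] by simp

lemma norm_add_sq:
  "(norm (x + y))\<^sup>2 = (norm x)\<^sup>2 + (norm y)\<^sup>2 + 2 * Re (cinner x (y::'a::complex_hilbert_space))"
proof -
  have "complex_of_real ((norm (x + y))\<^sup>2) = cinner x x + cinner y y + (cinner x y + cnj (cinner x y))"
    unfolding cinner_self[symmetric] by (simp add: cinner_add_left cinner_add_right cinner_commute[of y x])
  also have "\<dots> = complex_of_real ((norm x)\<^sup>2 + (norm y)\<^sup>2 + 2 * Re (cinner x y))"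
    by (simp add: cinner_self complex_add_cnj)
  finally show ?thesis using of_real_eq_iff by blast
qed

lemma norm_add_le_2: "(norm (x + y))\<^sup>2 \<le> 2 * (norm x)\<^sup>2 + 2 * (norm (y::'a::real_normed_vector))\<^sup>2"
proof -
  have "(norm (x + y))\<^sup>2 \<le> (norm x + norm y)\<^sup>2" by (simp add: norm_triangle_ineq power_mono)
  also have "\<dots> \<le> 2 * (norm x)\<^sup>2 + 2 * (norm y)\<^sup>2" using sum_squares_bound[of "norm x" "norm y"]
    by (simp add: power2_sum)
  finally show ?thesis .
qed

lemma Re_cinner_le: "2 * Re (cinner x y) \<le> (norm x)\<^sup>2 + (norm (y::'a::complex_hilbert_space))\<^sup>2"
proof -
  have "0 \<le> (norm (x + (- y)))\<^sup>2" by simp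
  then show ?thesis unfolding norm_add_sq by (simp add: cinner_minus_right)
qed

lemma norm_cinner_le: "norm (cinner x y) \<le> norm x * norm (y::'a::complex_hilbert_space)"
proof (cases "norm x = 0 \<or> norm y = 0")
  case True
  have "cinner (0::'a) z = 0" for z using cinner_add_left[of 0 0 z] by simp
  moreover from this have "cinner z (0::'a) = 0" for z using cinner_commute[of z 0] by simp
  ultimately show ?thesis using True by auto
next
  case False
  \<comment> \<open>The unimodular \<open>s\<close> rotates the inner product onto the nonnegative
    real axis; scaling by \<open>a\<close> and \<open>b\<close> gives both vectors the norm
    \<open>norm x * norm y\<close>, the case in which \<open>Re_cinner_le\<close> is already
    Cauchy-Schwarz.\<close>
  define s where "s = (if cinner x y = 0 then 1 else cnj (cinner x y) / norm (cinner x y))"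
  have s: "norm s = 1" by (auto simp: s_def norm_divide)
  have sc: "s * cinner x y = norm (cinner x y)"
    using complex_norm_square[of "cinner x y"] 
    by (auto simp: s_def power2_eq_square mult.commute field_simps)
  define a where "a = complex_of_real (norm y)"
  define b where "b = complex_of_real (norm x)"
  have "2 * Re (cinner ((a * s) *\<^sub>C x) (b *\<^sub>C y)) \<le> (norm y * norm x)\<^sup>2 + (norm x * norm y)\<^sup>2"
    using Re_cinner_le[of "(a * s) *\<^sub>C x" "b *\<^sub>C y"] s by (simp add: norm_scaleC a_def b_def norm_mult)
  moreover have "cinner ((a * s) *\<^sub>C x) (b *\<^sub>C y) = a * b * (s * cinner x y)"
    by (simp add: cinner_scaleC_left cinner_scaleC_right b_def)
  ultimately have "norm x * norm y * norm (cinner x y) \<le> norm x * norm y * (norm x * norm y)"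
    unfolding sc by (simp add: a_def b_def power2_eq_square algebra_simps)
  with False show ?thesis by (simp add: mult_le_cancel_left)
qed

lemma bounded_linear_cinner_left: "bounded_linear (\<lambda>x::'a::complex_hilbert_space. cinner x y)"
proof (rule bounded_linear_intro[where K = "norm y"])
  show "cinner (r *\<^sub>R x) y = r *\<^sub>R cinner x y" for r and x :: 'a
    by (metis cinner_scaleC_left scaleC_of_real scaleR_conv_of_real)
qed (simp_all add: cinner_add_left norm_cinner_le)

section \<open>Convergent vector power series, termwise differentiation, Taylor coefficients\<close>

text \<open>Radius of convergence at least \<open>R\<close>, expressed through absolute summability
  at every smaller real radius, so that it passes to other sequences by comparison of norms.\<close>

definition ps_conv :: "real \<Rightarrow> (nat \<Rightarrow> 'a::real_normed_vector) \<Rightarrow> bool"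
  where "ps_conv R a \<longleftrightarrow> (\<forall>r. 0 \<le> r \<and> r < R \<longrightarrow> summable (\<lambda>n. norm (a n) * r ^ n))"

definition psum :: "(nat \<Rightarrow> 'a::complex_normed_vector) \<Rightarrow> complex \<Rightarrow> 'a"
  where "psum a z = (\<Sum>n. z ^ n *\<^sub>C a n)"

lemma ps_convD: "ps_conv R a \<Longrightarrow> 0 \<le> r \<Longrightarrow> r < R \<Longrightarrow> summable (\<lambda>n. norm (a n) * r ^ n)"
  by (simp add: ps_conv_def)

lemma ps_conv_mono: "ps_conv R a \<Longrightarrow> R' \<le> R \<Longrightarrow> ps_conv R' a"
  by (auto simp: ps_conv_def)

lemma ps_conv_summable_norm:
  fixes a :: "nat \<Rightarrow> 'a::complex_normed_vector"
  assumes "ps_conv R a" "norm z < R" shows "summable (\<lambda>n. norm (z ^ n *\<^sub>C a n))"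
  using ps_convD[OF assms(1) _ assms(2)] by (simp add: norm_scaleC norm_power mult.commute)

lemma psum_sums:
  fixes a :: "nat \<Rightarrow> 'a::{complex_normed_vector,banach}"
  assumes "ps_conv R a" "norm z < R" shows "(\<lambda>n. z ^ n *\<^sub>C a n) sums psum a z"
  unfolding psum_def by (rule summable_sums[OF summable_norm_cancel[OF ps_conv_summable_norm[OF assms]]])

lemma ps_conv_le:
  assumes "ps_conv R a" "\<And>n. norm (b n) \<le> C * norm (a n)"
  shows "ps_conv R b"
  unfolding ps_conv_def
proof safe
  fix r assume r: "0 \<le> r" "r < R"
  show "summable (\<lambda>n. norm (b n) * r ^ n)"
  proof (rule summable_comparison_test')
    show "summable (\<lambda>n. C * (norm (a n) * r ^ n))" by (intro summable_mult ps_convD[OF assms(1)] r)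
    show "norm (norm (b n) * r ^ n) \<le> C * (norm (a n) * r ^ n)" for n
      using mult_right_mono[OF assms(2)[of n], of "r ^ n"] r(1) by (simp add: mult.assoc)
  qed
qed

text \<open>The weight is absorbed by a slightly larger radius: with r < r' < R the factor (1 +
  n)^\<beta> (r / r')^n is bounded. The case \<open>x = 0\<close> is separate because the
  asymptotics in \<open>n\<close> needs a positive base.\<close>

lemma ps_conv_weight:
  assumes "ps_conv R a" "\<And>n. \<bar>w n\<bar> \<le> (1 + real n) powr \<beta>"
  shows "ps_conv R (\<lambda>n. w n *\<^sub>R a n)"
  unfolding ps_conv_def
proof safe
  fix r assume r: "0 \<le> r" "r < R"
  obtain r' where r': "r < r'" "r' < R" using r(2) dense by blast
  define x where "x = r / r'"
  have x: "0 \<le> x" "x < 1" using r r' by (auto simp: x_def)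
  have "(\<lambda>n. (1 + real n) powr \<beta> * x ^ n) \<longlonglongrightarrow> 0"
  proof (cases "x = 0")
    case True
    show ?thesis by (rule tendsto_eventually, rule eventually_sequentiallyI[of 1]) (simp add: True)
  next
    case False
    with x have "x > 0" by simp
    then show ?thesis using x(2) by real_asymp
  qed
  then have "Bseq (\<lambda>n. (1 + real n) powr \<beta> * x ^ n)" by (intro convergent_imp_Bseq) (auto simp: convergent_def)
  then obtain C where C: "\<And>n. norm ((1 + real n) powr \<beta> * x ^ n) \<le> C" by (meson BseqE)
  show "summable (\<lambda>n. norm (w n *\<^sub>R a n) * r ^ n)"
  proof (rule summable_comparison_test')
    show "summable (\<lambda>n. C * (norm (a n) * r' ^ n))" using r r' by (intro summable_mult ps_convD[OF assms(1)]) auto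
    fix n
    have "r ^ n = x ^ n * r' ^ n" using r r' by (simp add: x_def power_divide)
    then have "norm (norm (w n *\<^sub>R a n) * r ^ n) = \<bar>w n\<bar> * x ^ n * (norm (a n) * r' ^ n)"
      using r r' x by (simp add: abs_mult)
    also have "\<dots> \<le> (1 + real n) powr \<beta> * x ^ n * (norm (a n) * r' ^ n)"
      using assms(2)[of n] r r' x by (intro mult_right_mono) auto
    also have "\<dots> \<le> C * (norm (a n) * r' ^ n)" using C[of n] r r' x by (intro mult_right_mono) auto
    finally show "norm (norm (w n *\<^sub>R a n) * r ^ n) \<le> C * (norm (a n) * r' ^ n)" .
  qed
qed

lemma ps_conv_shift:
  assumes "ps_conv R a" shows "ps_conv R (\<lambda>n. a (Suc n))"
  unfolding ps_conv_def
proof safe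
  fix r assume r: "0 \<le> r" "r < R"
  obtain r' where r': "r < r'" "r' < R" using r(2) dense by blast
  have "summable (\<lambda>n. norm (a (Suc n)) * r' ^ Suc n)"
    using ps_convD[OF assms, of r'] r r' by (subst summable_Suc_iff) auto
  then have "summable (\<lambda>n. inverse r' * (norm (a (Suc n)) * r' ^ Suc n))" by (rule summable_mult)
  then have "summable (\<lambda>n. norm (a (Suc n)) * r' ^ n)" using r r' by (simp add: field_simps)
  then show "summable (\<lambda>n. norm (a (Suc n)) * r ^ n)"
    by (rule summable_comparison_test') (use r r' in \<open>auto intro!: mult_left_mono power_mono\<close>)
qed

text \<open>The coefficients of the derivative of \<open>psum a\<close>.\<close>

definition pshift :: "(nat \<Rightarrow> 'a::real_normed_vector) \<Rightarrow> nat \<Rightarrow> 'a"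
  where "pshift a n = (1 + real n) *\<^sub>R a (Suc n)"

lemma ps_conv_pshift: "ps_conv R a \<Longrightarrow> ps_conv R (pshift a)"
  unfolding pshift_def by (rule ps_conv_weight[where \<beta> = 1]) (auto intro: ps_conv_shift)

text \<open>On a ball of radius \<open>r\<close> strictly between \<open>norm z\<close> and
  \<open>R\<close> the differentiated partial sums converge uniformly, with the tail of the
  numerical series at \<open>r\<close> as majorant.\<close>

lemma psum_has_complex_derivative:
  fixes a :: "nat \<Rightarrow> 'a::{complex_normed_vector,banach}"
  assumes a: "ps_conv R a" and z: "norm z < R"
  shows "(psum a has_complex_derivative psum (pshift a) z) (at z)"
proof -
  obtain r where r: "norm z < r" "r < R" using z dense by blast
  then have r0: "r > 0" using norm_ge_zero le_less_trans by blast
  let ?S = "ball 0 r :: complex set"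
  let ?f' = "\<lambda>n x h. (h * (of_nat n * x ^ (n - 1))) *\<^sub>C a n"
  have pa: "ps_conv R (pshift a)" using a by (rule ps_conv_pshift)
  have sm: "summable (\<lambda>n. norm (pshift a n) * r ^ n)" using ps_convD[OF pa] r r0 by simp
  \<comment> \<open>The constant term has derivative 0, so \<open>Suc n\<close> differentiated terms
    form a partial sum of length \<open>n\<close> of \<open>psum (pshift a)\<close>; hence the shift
    from \<open>N\<close> to \<open>Suc N\<close> below.\<close>
  have part: "(\<Sum>i<Suc n. ?f' i x h) = h *\<^sub>C (\<Sum>i<n. x ^ i *\<^sub>C pshift a i)" for n x h
  proof -
    have "(\<Sum>i<Suc n. ?f' i x h) = (\<Sum>i<n. ?f' (Suc i) x h)" by (subst sum.lessThan_Suc_shift) simp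
    also have "\<dots> = (\<Sum>i<n. h *\<^sub>C x ^ i *\<^sub>C pshift a i)"
    proof (rule sum.cong[OF refl])
      fix i
      have "h *\<^sub>C x ^ i *\<^sub>C pshift a i = (h * x ^ i * complex_of_real (1 + real i)) *\<^sub>C a (Suc i)"
        by (simp only: pshift_def scaleC_of_real[symmetric] scaleC_scaleC mult.assoc)
      then show "?f' (Suc i) x h = h *\<^sub>C x ^ i *\<^sub>C pshift a i" by (simp add: algebra_simps)
    qed
    finally show ?thesis by (simp add: scaleC.sum_right)
  qed
  have "\<exists>g. \<forall>x\<in>?S. (\<lambda>n. x ^ n *\<^sub>C a n) sums (g x) \<and> (g has_derivative (\<lambda>h. h *\<^sub>C psum (pshift a) x)) (at x within ?S)"
  proof (rule has_derivative_series[where f' = ?f' and x = 0])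
    fix n and x :: complex
    show "((\<lambda>x. x ^ n *\<^sub>C a n) has_derivative ?f' n x) (at x within ?S)"
      by (auto intro!: derivative_eq_intros simp: mult_ac)
  next
    fix e :: real assume e: "e > 0"
    from sm have "(\<lambda>n. \<Sum>i. norm (pshift a (i + n)) * r ^ (i + n)) \<longlonglongrightarrow> 0" by (rule suminf_exist_split2)
    from order_tendstoD(2)[OF this e]
    obtain N where N: "\<And>n. n \<ge> N \<Longrightarrow> (\<Sum>i. norm (pshift a (i + n)) * r ^ (i + n)) < e"
      by (auto simp: eventually_sequentially)
    have *: "norm ((\<Sum>i<Suc n. ?f' i x h) - h *\<^sub>C psum (pshift a) x) \<le> e * norm h"
      if n: "n \<ge> N" and x: "x \<in> ?S" for n x h
    proof -
      have xr: "norm x < r" using x by simp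
      have sx: "summable (\<lambda>n. norm (x ^ n *\<^sub>C pshift a n))"
        using ps_conv_summable_norm[OF pa, of x] xr r by simp
      have "psum (pshift a) x - (\<Sum>i<n. x ^ i *\<^sub>C pshift a i) = (\<Sum>i. x ^ (i + n) *\<^sub>C pshift a (i + n))"
        unfolding psum_def using suminf_split_initial_segment[OF summable_norm_cancel[OF sx], of n] by simp
      then have "norm (psum (pshift a) x - (\<Sum>i<n. x ^ i *\<^sub>C pshift a i)) \<le> (\<Sum>i. norm (x ^ (i + n) *\<^sub>C pshift a (i + n)))"
        using summable_norm[OF summable_ignore_initial_segment[OF sx]] by simp
      also have "\<dots> \<le> (\<Sum>i. norm (pshift a (i + n)) * r ^ (i + n))"
      proof (rule suminf_le)
        show "norm (x ^ (i + n) *\<^sub>C pshift a (i + n)) \<le> norm (pshift a (i + n)) * r ^ (i + n)" for i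
          using mult_right_mono[OF power_mono[OF less_imp_le[OF xr], of "i + n"], of "norm (pshift a (i + n))"]
          by (simp add: norm_scaleC norm_power mult.commute)
      qed (use summable_ignore_initial_segment[OF sx] summable_ignore_initial_segment[OF sm] in auto)
      also have "\<dots> \<le> e" using N[OF n] by simp
      finally have "norm (psum (pshift a) x - (\<Sum>i<n. x ^ i *\<^sub>C pshift a i)) \<le> e" .
      then show ?thesis unfolding part scaleC_diff_right[symmetric] norm_scaleC
        by (subst mult.commute, subst norm_minus_commute) (rule mult_right_mono, auto)
    qed
    show "\<forall>\<^sub>F n in sequentially. \<forall>x\<in>?S. \<forall>h. norm ((\<Sum>i<n. ?f' i x h) - h *\<^sub>C psum (pshift a) x) \<le> e * norm h"
    proof (intro eventually_sequentiallyI[of "Suc N"] ballI allI)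
      fix n x h assume "Suc N \<le> n" and x: "x \<in> ?S"
      then obtain k where "n = Suc k" "N \<le> k" by (cases n) auto
      then show "norm ((\<Sum>i<n. ?f' i x h) - h *\<^sub>C psum (pshift a) x) \<le> e * norm h"
        using *[OF _ x] by blast
    qed
  next
    show "(\<lambda>n. 0 ^ n *\<^sub>C a n) sums psum a 0" using r r0 by (intro psum_sums[OF a]) auto
  qed (use r0 in auto)
  then obtain g where g: "\<And>x. x \<in> ?S \<Longrightarrow> (\<lambda>n. x ^ n *\<^sub>C a n) sums (g x)"
    "\<And>x. x \<in> ?S \<Longrightarrow> (g has_derivative (\<lambda>h. h *\<^sub>C psum (pshift a) x)) (at x within ?S)" by blast
  have "(g has_derivative (\<lambda>h. h *\<^sub>C psum (pshift a) z)) (at z)"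
    using g(2)[of z] r by (simp add: at_within_open[where S = ?S])
  then show ?thesis unfolding has_complex_derivative_def
  proof (rule has_derivative_transform_within_open[where s = ?S])
    show "g x = psum a x" if "x \<in> ?S" for x using g(1)[OF that] by (simp add: psum_def sums_iff)
  qed (use r in auto)
qed

lemma has_complex_derivative_unique:
  assumes "(f has_complex_derivative D) (at z)" "(f has_complex_derivative D') (at z)"
  shows "D = D'"
proof -
  have "(\<lambda>h. h *\<^sub>C D) = (\<lambda>h. h *\<^sub>C D')"
    using assms unfolding has_complex_derivative_def by (rule has_derivative_unique)
  from fun_cong[OF this, of 1] show ?thesis by simp
qed

lemma complex_deriv_eq: "(f has_complex_derivative D) (at z) \<Longrightarrow> complex_deriv f z = D"
  unfolding complex_deriv_def by (rule some_equality) (auto intro: has_complex_derivative_unique)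

lemma higher_complex_deriv_psum:
  fixes a :: "nat \<Rightarrow> 'a::{complex_normed_vector,banach}"
  assumes "ps_conv R a" "\<And>z. norm z < R \<Longrightarrow> f z = psum a z" "norm z < R"
  shows "(complex_deriv ^^ k) f z = psum ((pshift ^^ k) a) z"
  using assms(3)
proof (induction k arbitrary: z)
  case 0 then show ?case by (simp add: assms(2))
next
  case (Suc k)
  have c: "ps_conv R ((pshift ^^ k) a)" by (induction k) (auto intro: assms(1) ps_conv_pshift)
  have "((complex_deriv ^^ k) f has_complex_derivative psum (pshift ((pshift ^^ k) a)) z) (at z)"
    using psum_has_complex_derivative[OF c Suc.prems] unfolding has_complex_derivative_def
    by (rule has_derivative_transform_within_open[where s = "ball 0 R"]) (use Suc.prems in \<open>auto simp: Suc.IH\<close>)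
  then show ?case by (simp add: complex_deriv_eq)
qed

text \<open>The \<open>k\<close>-fold \<open>pshift\<close> multiplies the coefficient of index n +
  k by (n + k)! / n!. At the origin only n = 0 survives, and the factorial cancels the one in
  \<open>taylor_coeff\<close>. This is also the uniqueness of power series expansions.\<close>

lemma taylor_coeff_psum:
  fixes a :: "nat \<Rightarrow> 'a::{complex_normed_vector,banach}"
  assumes "R > 0" "ps_conv R a" "\<And>z. norm z < R \<Longrightarrow> f z = psum a z"
  shows "taylor_coeff f n = a n"
proof -
  have "(pshift ^^ k) a n = (fact (n + k) / fact n) *\<^sub>R a (n + k)" for k n
  proof (induction k arbitrary: n)
    case (Suc k)
    have "fact (Suc n) = (1 + real n) * fact n" by simp
    then have "(1 + real n) * (fact (Suc n + k) / fact (Suc n)) = fact (n + Suc k) / fact n"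
      by (simp add: divide_simps del: fact_Suc)
    then show ?case by (simp add: pshift_def[of "(pshift ^^ k) a"] Suc.IH del: fact_Suc)
  qed simp
  moreover have "psum b 0 = b 0" for b :: "nat \<Rightarrow> 'a"
    unfolding psum_def by (subst suminf_finite[of "{0}"]) (auto simp: power_0_left)
  ultimately show ?thesis
    using higher_complex_deriv_psum[OF assms(2,3), of 0 n] assms(1) by (simp add: taylor_coeff_def)
qed

lemma analytic_in_psum:
  fixes a :: "nat \<Rightarrow> 'a::{complex_normed_vector,banach}"
  assumes "ps_conv R a" "\<And>z. norm z < R \<Longrightarrow> f z = psum a z"
  shows "analytic_in f (ball 0 R)"
  unfolding analytic_in_def
proof safe
  fix z :: complex assume z: "z \<in> ball 0 R"
  then have "norm z < R" by simp
  from psum_has_complex_derivative[OF assms(1) this]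
  have "(psum a has_derivative (\<lambda>h. h *\<^sub>C psum (pshift a) z)) (at z)"
    unfolding has_complex_derivative_def .
  then have "(f has_derivative (\<lambda>h. h *\<^sub>C psum (pshift a) z)) (at z)"
    by (rule has_derivative_transform_within_open[where s = "ball 0 R"]) (use z assms(2) in auto)
  then show "\<exists>D. (f has_complex_derivative D) (at z)"
    unfolding has_complex_derivative_def by blast
qed simp

lemma continuous_on_psum:
  fixes a :: "nat \<Rightarrow> 'a::{complex_normed_vector,banach}"
  assumes "ps_conv R a" shows "continuous_on (ball 0 R) (psum a)"
proof (rule continuous_at_imp_continuous_on, rule ballI)
  fix z :: complex assume "z \<in> ball 0 R"
  then have "norm z < R" by simp
  from psum_has_complex_derivative[OF assms this] show "isCont (psum a) z"
    unfolding has_complex_derivative_def by (rule has_derivative_continuous)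
qed

section \<open>Taylor expansion of vector-valued analytic functions\<close>

text \<open>Cauchy's formula for derivatives, pulled back to the unit interval, where it can be
  compared with a vector-valued integral along the same circle.\<close>

lemma circle_coefficient_has_integral:
  fixes \<rho> :: real
  assumes g: "g holomorphic_on ball 0 R" and \<rho>: "0 < \<rho>" "\<rho> < R"
  shows "((\<lambda>t. g (\<rho> * cis (2 * pi * t)) / (\<rho> * cis (2 * pi * t)) ^ n)
           has_integral (deriv ^^ n) g 0 / fact n) {0..1}"
proof -
  have "cball 0 \<rho> \<subseteq> ball 0 R" using \<rho> by auto
  then have "continuous_on (cball 0 \<rho>) g" "g holomorphic_on ball 0 \<rho>"
    using g \<rho> by (auto intro: holomorphic_on_imp_continuous_on holomorphic_on_subset ball_subset_ball_iff)
  then have "((\<lambda>u. g u / (u - 0) ^ Suc n) has_contour_integral (2 * pi * \<i>) / fact n * (deriv ^^ n) g 0) (circlepath 0 \<rho>)"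
    using \<rho> by (intro Cauchy_has_contour_integral_higher_derivative_circlepath) auto
  then have "((\<lambda>x. g (circlepath 0 \<rho> x) / circlepath 0 \<rho> x ^ Suc n * vector_derivative (circlepath 0 \<rho>) (at x within {0..1}))
      has_integral (2 * pi * \<i>) / fact n * (deriv ^^ n) g 0) {0..1}"
    by (simp add: has_contour_integral_def)
  then have "((\<lambda>x. g (circlepath 0 \<rho> x) / circlepath 0 \<rho> x ^ Suc n * vector_derivative (circlepath 0 \<rho>) (at x within {0..1}) * (1 / (2 * pi * \<i>)))
      has_integral (2 * pi * \<i>) / fact n * (deriv ^^ n) g 0 * (1 / (2 * pi * \<i>))) {0..1}"
    by (rule has_integral_mult_left)
  then have *: "((\<lambda>x. g (circlepath 0 \<rho> x) / circlepath 0 \<rho> x ^ Suc n * vector_derivative (circlepath 0 \<rho>) (at x within {0..1}) * (1 / (2 * pi * \<i>)))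
      has_integral (deriv ^^ n) g 0 / fact n) {0..1}" by (simp add: field_simps)
  show ?thesis
  proof (rule has_integral_eq[OF _ *])
    fix x :: real assume x: "x \<in> {0..1}"
    have c: "circlepath 0 \<rho> x = \<rho> * cis (2 * pi * x)" by (simp add: circlepath cis_conv_exp mult_ac)
    have v: "vector_derivative (circlepath 0 \<rho>) (at x within {0..1}) = 2 * pi * \<i> * (\<rho> * cis (2 * pi * x))"
      using x by (simp add: vector_derivative_circlepath01 cis_conv_exp mult_ac)
    show "g (circlepath 0 \<rho> x) / circlepath 0 \<rho> x ^ Suc n * vector_derivative (circlepath 0 \<rho>) (at x within {0..1}) * (1 / (2 * pi * \<i>))
       = g (\<rho> * cis (2 * pi * x)) / (\<rho> * cis (2 * pi * x)) ^ n"
      unfolding c v using \<rho> by (simp add: field_simps)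
  qed
qed

text \<open>Cauchy's theorem is transferred from scalar functions. Both codomains of interest have enough
  functionals coming from the inner product, so that the Hahn-Banach theorem is not needed.\<close>

definition separated_points :: "'a::complex_normed_vector itself \<Rightarrow> bool"
  where "separated_points _ \<longleftrightarrow> (\<forall>x::'a. x \<noteq> 0 \<longrightarrow>
    (\<exists>l. bounded_linear l \<and> (\<forall>c y. l (c *\<^sub>C y) = c * l y) \<and> l x \<noteq> (0::complex)))"

lemma separated_points_hilbert: "separated_points TYPE('h::complex_hilbert_space)"
  unfolding separated_points_def
proof (intro allI impI)
  fix x :: 'h assume "x \<noteq> 0"
  then show "\<exists>l. bounded_linear l \<and> (\<forall>c y::'h. l (c *\<^sub>C y) = c * l y) \<and> l x \<noteq> (0::complex)"
    by (intro exI[of _ "\<lambda>y. cinner y x"])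
      (simp add: bounded_linear_cinner_left cinner_scaleC_left cinner_self)
qed

lemma separated_points_cblinfun:
  "separated_points TYPE(('a::complex_normed_vector, 'h::complex_hilbert_space) cblinfun)"
  unfolding separated_points_def
proof (intro allI impI)
  fix T :: "('a, 'h) cblinfun" assume "T \<noteq> 0"
  then obtain x where x: "cblinfun_apply T x \<noteq> 0"
    by (transfer, metis blinfun_eqI zero_blinfun.rep_eq)
  let ?l = "\<lambda>S. cinner (cblinfun_apply S x) (cblinfun_apply T x)"
  have "bounded_linear ?l"
    by (rule bounded_linear_compose[OF bounded_linear_cinner_left bounded_linear_cblinfun_apply_left])
  with x show "\<exists>l. bounded_linear l \<and> (\<forall>c y::('a, 'h) cblinfun. l (c *\<^sub>C y) = c * l y) \<and> l T \<noteq> (0::complex)"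
    by (intro exI[of _ ?l]) (simp add: cinner_scaleC_left cinner_self cblinfun_apply_simps)
qed

lemma analytic_in_continuous_on: "analytic_in f U \<Longrightarrow> continuous_on U f"
  unfolding analytic_in_def has_complex_derivative_def
  by (auto intro!: continuous_at_imp_continuous_on dest: has_derivative_continuous)

text \<open>The coefficients are vector-valued Cauchy integrals over the circle of radius \<rho>,
  and a bound for the norm of \<open>f\<close> there yields their growth bound. If
  \<open>f z\<close> differed from the sum, some functional would see the difference; it maps the
  coefficients to those of a scalar holomorphic function, where the power series theorem
  holds.\<close>

lemma analytic_in_power_series_inner:
  fixes f :: "complex \<Rightarrow> 'a::{complex_normed_vector,banach}"
  assumes sep: "separated_points TYPE('a)" and f: "analytic_in f (ball 0 R)" and \<rho>: "0 < \<rho>" "\<rho> < R"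
  shows "\<exists>a. ps_conv \<rho> a \<and> (\<forall>z. norm z < \<rho> \<longrightarrow> f z = psum a z)"
proof -
  define u where "u t = \<rho> * cis (2 * pi * t)" for t
  have u_norm: "norm (u t) = \<rho>" for t using \<rho> by (simp add: u_def norm_mult)
  have u0: "u t \<noteq> 0" for t using u_norm[of t] \<rho> by auto
  have cu: "continuous_on S u" for S
    unfolding u_def cis_conv_exp by (intro continuous_intros)
  have cf: "continuous_on (ball 0 R) f" using f by (rule analytic_in_continuous_on)
  have cfu: "continuous_on {0..1} (\<lambda>t. f (u t))"
    by (rule continuous_on_compose2[OF cf cu]) (use u_norm \<rho> in auto)
  define q where "q n t = (1 / u t ^ n) *\<^sub>C f (u t)" for n t
  have cq: "continuous_on {0..1} (q n)" for n
    unfolding q_def by (intro continuous_intros cfu cu) (use u0 in auto)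
  have "bounded ((\<lambda>t. f (u t)) ` {0..1})"
    by (intro compact_imp_bounded compact_continuous_image cfu) auto
  then obtain M where M: "\<And>t. t \<in> {0..1} \<Longrightarrow> norm (f (u t)) \<le> M"
    by (meson bounded_iff imageI)
  define a where "a n = integral {0..1} (q n)" for n
  have a_norm: "norm (a n) \<le> M / \<rho> ^ n" for n
  proof -
    have "norm (a n) \<le> M / \<rho> ^ n * (1 - 0)"
      unfolding a_def
      by (rule integral_bound[OF _ cq])
        (use M \<rho> in \<open>auto simp: q_def norm_scaleC norm_divide norm_power u_norm divide_right_mono\<close>)
    then show ?thesis by simp
  qed
  have conv: "ps_conv \<rho> a"
    unfolding ps_conv_def
  proof safe
    fix r assume r: "0 \<le> r" "r < \<rho>"
    show "summable (\<lambda>n. norm (a n) * r ^ n)"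
    proof (rule summable_comparison_test')
      show "summable (\<lambda>n. M * (r / \<rho>) ^ n)" using r \<rho> by (intro summable_mult summable_geometric) auto
      show "norm (norm (a n) * r ^ n) \<le> M * (r / \<rho>) ^ n" for n
        using mult_right_mono[OF a_norm[of n], of "r ^ n"] r by (simp add: power_divide)
    qed
  qed
  have "f z = psum a z" if z: "norm z < \<rho>" for z
  proof (rule ccontr)
    assume "f z \<noteq> psum a z"
    then have "f z - psum a z \<noteq> 0" by simp
    then obtain l where bl: "bounded_linear l" and hom: "\<And>c y. l (c *\<^sub>C y) = c * l y"
      and nz: "l (f z - psum a z) \<noteq> (0::complex)"
      using sep unfolding separated_points_def by blast
    have hol: "(\<lambda>z. l (f z)) holomorphic_on ball 0 R"
    proof (rule holomorphic_onI)
      fix w :: complex assume w: "w \<in> ball 0 R"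
      with f obtain D where "(f has_derivative (\<lambda>h. h *\<^sub>C D)) (at w)"
        unfolding analytic_in_def has_complex_derivative_def by blast
      then have "((\<lambda>z. l (f z)) has_derivative (\<lambda>h. l (h *\<^sub>C D))) (at w)"
        by (rule bounded_linear.has_derivative[OF bl])
      moreover have "(\<lambda>h. l (h *\<^sub>C D)) = (*) (l D)" by (auto simp: hom)
      ultimately have "((\<lambda>z. l (f z)) has_field_derivative l D) (at w)"
        by (simp add: has_field_derivative_def)
      then show "(\<lambda>z. l (f z)) field_differentiable at w within ball 0 R"
        using field_differentiable_at_within field_differentiable_def by blast
    qed
    have la: "l (a n) = (deriv ^^ n) (\<lambda>z. l (f z)) 0 / fact n" for n
    proof -
      have "integral {0..1} (\<lambda>t. l (q n t)) = l (a n)"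
        unfolding a_def using integral_linear[OF integrable_continuous_real[OF cq] bl] by (simp add: o_def)
      moreover have "l (q n t) = l (f (u t)) / u t ^ n" for t by (simp add: q_def hom)
      moreover have "((\<lambda>t. l (f (u t)) / u t ^ n) has_integral (deriv ^^ n) (\<lambda>z. l (f z)) 0 / fact n) {0..1}"
        using circle_coefficient_has_integral[OF hol \<rho>] by (simp add: u_def)
      ultimately show ?thesis by (simp add: integral_unique)
    qed
    have "(\<lambda>n. l (a n) * z ^ n) sums l (f z)"
      using holomorphic_power_series[OF hol, of z] z \<rho> by (simp add: la)
    moreover have "(\<lambda>n. l (z ^ n *\<^sub>C a n)) sums l (psum a z)"
      using psum_sums[OF conv z] by (rule bounded_linear.sums[OF bl])
    then have "(\<lambda>n. l (a n) * z ^ n) sums l (psum a z)" by (simp add: hom mult.commute)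
    ultimately have "l (f z) = l (psum a z)" by (rule sums_unique2)
    with nz show False by (simp add: linear_simps[OF bl])
  qed
  with conv show ?thesis by blast
qed

text \<open>Each inner radius \<rho> gives an expansion, and uniqueness identifies its coefficients
  with \<open>taylor_coeff f\<close>; so the expansions agree and \<rho> may approach
  \<open>R\<close>.\<close>

lemma analytic_in_power_series:
  fixes f :: "complex \<Rightarrow> 'a::{complex_normed_vector,banach}"
  assumes sep: "separated_points TYPE('a)" and f: "analytic_in f (ball 0 R)"
  shows "ps_conv R (taylor_coeff f)" and "norm z < R \<Longrightarrow> f z = psum (taylor_coeff f) z"
proof -
  have *: "ps_conv \<rho> (taylor_coeff f) \<and> (\<forall>z. norm z < \<rho> \<longrightarrow> f z = psum (taylor_coeff f) z)"
    if \<rho>: "0 < \<rho>" "\<rho> < R" for \<rho>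
  proof -
    obtain a where a: "ps_conv \<rho> a" "\<And>z. norm z < \<rho> \<Longrightarrow> f z = psum a z"
      using analytic_in_power_series_inner[OF sep f \<rho>] by blast
    have "taylor_coeff f = a" using taylor_coeff_psum[OF \<rho>(1) a] by blast
    with a show ?thesis by blast
  qed
  show "ps_conv R (taylor_coeff f)"
    unfolding ps_conv_def
  proof safe
    fix r assume r: "0 \<le> r" "r < R"
    then obtain \<rho> where "r < \<rho>" "\<rho> < R" using dense by blast
    then show "summable (\<lambda>n. norm (taylor_coeff f n) * r ^ n)"
      using *[of \<rho>] r by (auto simp: ps_conv_def)
  qed
  show "f z = psum (taylor_coeff f) z" if z: "norm z < R"
  proof -
    obtain \<rho> where \<rho>: "norm z < \<rho>" "\<rho> < R" using z dense by blast
    then have "0 < \<rho>" using norm_ge_zero[of z] by linarith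
    then show ?thesis using * \<rho> by blast
  qed
qed

section \<open>Integration over circles and over the disc\<close>

lemma cis_has_integral_zero:
  fixes k :: int
  assumes "k \<noteq> 0"
  shows "((\<lambda>t. cis (2 * pi * of_int k * t)) has_integral 0) {0..1}"
proof -
  let ?c = "2 * pi * of_int k * \<i>"
  have c: "?c \<noteq> 0" using assms by simp
  have "((\<lambda>t. exp (?c * of_real t) / ?c) has_vector_derivative exp (?c * of_real x)) (at x within {0..1})" for x :: real
    by (rule has_vector_derivative_real_field)
      (use c in \<open>auto intro!: derivative_eq_intros\<close>)
  then have "((\<lambda>t. exp (?c * of_real t)) has_integral (exp (?c * of_real 1) / ?c - exp (?c * of_real 0) / ?c)) {0..1}"
    by (intro fundamental_theorem_of_calculus) auto
  moreover have "exp ?c = 1" using exp_integer_2pi[of "of_int k"] by (simp add: mult_ac)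
  ultimately have "((\<lambda>t. exp (?c * of_real t)) has_integral 0) {0..1}" by simp
  moreover have "exp (?c * of_real t) = cis (2 * pi * of_int k * t)" for t :: real
    by (simp add: cis_conv_exp mult_ac)
  ultimately show ?thesis by simp
qed

text \<open>The frequencies enter through an injection \<kappa> because expansions with frequencies
  such as k, -k and p - m all occur later. In the induction the cross term with the new summand
  contains nonzero frequencies only and integrates to 0.\<close>

lemma circle_parseval_finite:
  fixes v :: "nat \<Rightarrow> 'h::complex_hilbert_space" and \<kappa> :: "nat \<Rightarrow> int"
  assumes "inj \<kappa>"
  shows "((\<lambda>t. (norm (\<Sum>m<M. cis (2 * pi * of_int (\<kappa> m) * t) *\<^sub>C v m))\<^sup>2)
           has_integral (\<Sum>m<M. (norm (v m))\<^sup>2)) {0..1}"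
proof (induction M)
  case (Suc M)
  let ?g = "\<lambda>t. \<Sum>m<M. cis (2 * pi * of_int (\<kappa> m) * t) *\<^sub>C v m"
  let ?e = "\<lambda>t. cis (2 * pi * of_int (\<kappa> M) * t)"
  have inner: "cinner (?g t) (?e t *\<^sub>C v M)
      = (\<Sum>m<M. cis (2 * pi * of_int (\<kappa> m - \<kappa> M) * t) * cinner (v m) (v M))" for t
  proof -
    have "cinner (?g t) (?e t *\<^sub>C v M) = (\<Sum>m<M. cinner (cis (2 * pi * of_int (\<kappa> m) * t) *\<^sub>C v m) (?e t *\<^sub>C v M))"
      using linear_sum[OF bounded_linear.linear[OF bounded_linear_cinner_left]] by blast
    also have "\<dots> = (\<Sum>m<M. cis (2 * pi * of_int (\<kappa> m - \<kappa> M) * t) * cinner (v m) (v M))"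
      by (intro sum.cong refl)
        (simp add: cinner_scaleC_left cinner_scaleC_right cis_cnj cis_mult[symmetric] algebra_simps diff_conv_add_uminus del: add_uminus_conv_diff)
    finally show ?thesis .
  qed
  have "((\<lambda>t. cinner (?g t) (?e t *\<^sub>C v M)) has_integral (\<Sum>m<M. 0 * cinner (v m) (v M))) {0..1}"
    unfolding inner
  proof (intro has_integral_sum has_integral_mult_left cis_has_integral_zero)
    fix m assume "m \<in> {..<M}"
    then show "\<kappa> m - \<kappa> M \<noteq> 0" using injD[OF assms, of m M] by auto
  qed simp
  from has_integral_linear[OF this bounded_linear_Re]
  have "((\<lambda>t. Re (cinner (?g t) (?e t *\<^sub>C v M))) has_integral 0) {0..1}" by (simp add: o_def)
  then have "((\<lambda>t. (norm (?g t))\<^sup>2 + (norm (v M))\<^sup>2 + 2 * Re (cinner (?g t) (?e t *\<^sub>C v M)))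
      has_integral (\<Sum>m<M. (norm (v m))\<^sup>2) + (norm (v M))\<^sup>2 + 2 * 0) {0..1}"
    using has_integral_const_real[of "(norm (v M))\<^sup>2" 0 1]
    by (intro has_integral_add Suc.IH has_integral_mult_right) auto
  then show ?case by (simp add: norm_add_sq norm_scaleC)
qed simp

abbreviation nsq :: "'a::real_normed_vector \<Rightarrow> ennreal"
  where "nsq x \<equiv> ennreal ((norm x)\<^sup>2)"

abbreviation sq_sum :: "(nat \<Rightarrow> 'a::real_normed_vector) \<Rightarrow> ennreal"
  where "sq_sum a \<equiv> \<Sum>m. nsq (a m)"

text \<open>Absolute summability makes the partial sums converge uniformly in \<open>t\<close>. As
  all norms are bounded by \<open>S\<close>, the squared norms converge uniformly too, and the
  finite identity passes to the limit.\<close>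

lemma circle_parseval:
  fixes v :: "nat \<Rightarrow> 'h::complex_hilbert_space" and \<kappa> :: "nat \<Rightarrow> int"
  assumes inj: "inj \<kappa>" and v: "summable (\<lambda>m. norm (v m))"
  shows "(\<integral>\<^sup>+t\<in>{0..1}. nsq (\<Sum>m. cis (2 * pi * of_int (\<kappa> m) * t) *\<^sub>C v m) \<partial>lborel)
       = sq_sum v"
proof -
  let ?s = "\<lambda>t m. cis (2 * pi * of_int (\<kappa> m) * t) *\<^sub>C v m"
  let ?G = "\<lambda>M t. \<Sum>m<M. ?s t m"
  let ?g = "\<lambda>t. \<Sum>m. ?s t m"
  define S where "S = (\<Sum>m. norm (v m))"
  have ns: "norm (?s t m) = norm (v m)" for t m by (simp add: norm_scaleC)
  have sn: "summable (\<lambda>m. norm (?s t m))" for t using v by (simp add: ns)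
  have g_le: "norm (?g t) \<le> S" for t
    using summable_norm[OF sn[of t]] by (simp add: S_def ns)
  have G_le: "norm (?G M t) \<le> S" for M t
  proof -
    have "norm (?G M t) \<le> (\<Sum>m<M. norm (v m))" by (rule order_trans[OF norm_sum]) (simp add: ns)
    also have "\<dots> \<le> S" unfolding S_def by (intro sum_le_suminf v) auto
    finally show ?thesis .
  qed
  define \<delta> where "\<delta> M = (\<Sum>m. norm (v (m + M)))" for M
  have diff: "norm (?g t - ?G M t) \<le> \<delta> M" for M t
  proof -
    have "?g t - ?G M t = (\<Sum>m. ?s t (m + M))"
      using suminf_split_initial_segment[OF summable_norm_cancel[OF sn[of t]], of M] by simp
    then show ?thesis
      using summable_norm[OF summable_ignore_initial_segment[OF sn[of t], of M]] by (simp add: ns \<delta>_def)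
  qed
  have \<delta>: "\<delta> \<longlonglongrightarrow> 0" unfolding \<delta>_def using suminf_exist_split2[OF v] .
  have lim: "uniform_limit {0..1} (\<lambda>M t. (norm (?G M t))\<^sup>2) (\<lambda>t. (norm (?g t))\<^sup>2) sequentially"
  proof (rule uniform_limitI)
    fix e :: real assume e: "e > 0"
    have "(\<lambda>M. \<delta> M * (2 * S)) \<longlonglongrightarrow> 0" using tendsto_mult_left_zero[OF \<delta>] .
    from order_tendstoD(2)[OF this e]
    show "\<forall>\<^sub>F M in sequentially. \<forall>t\<in>{0..1}. dist ((norm (?G M t))\<^sup>2) ((norm (?g t))\<^sup>2) < e"
    proof (eventually_elim, safe)
      fix M t assume M: "\<delta> M * (2 * S) < e"
      have "dist ((norm (?G M t))\<^sup>2) ((norm (?g t))\<^sup>2) = \<bar>norm (?g t) - norm (?G M t)\<bar> * (norm (?g t) + norm (?G M t))"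
        by (simp add: dist_real_def power2_eq_square square_diff_square_factored abs_mult abs_minus_commute add.commute)
      also have "\<dots> \<le> \<delta> M * (2 * S)"
        using g_le[of t] G_le[of t M] diff[of t M] norm_triangle_ineq3[of "?g t" "?G M t"]
        by (intro mult_mono) auto
      finally show "dist ((norm (?G M t))\<^sup>2) ((norm (?g t))\<^sup>2) < e" using M by simp
    qed
  qed
  have cont: "continuous_on {0..1} (\<lambda>t. (norm (?G M t))\<^sup>2)" for M
    unfolding cis_conv_exp by (intro continuous_intros)
  obtain I J where IJ: "\<And>M. ((\<lambda>t. (norm (?G M t))\<^sup>2) has_integral I M) {0..1}"
    "((\<lambda>t. (norm (?g t))\<^sup>2) has_integral J) {0..1}" "I \<longlonglongrightarrow> J"
    by (rule uniform_limit_integral[OF lim cont]) auto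
  have "I = (\<lambda>M. \<Sum>m<M. (norm (v m))\<^sup>2)"
    by (rule ext) (rule has_integral_unique[OF IJ(1) circle_parseval_finite[OF inj]])
  then have J: "(\<lambda>m. (norm (v m))\<^sup>2) sums J" using IJ(3) by (simp add: sums_def)
  have "(\<integral>\<^sup>+t. ennreal (indicator {0..1} t * (norm (?g t))\<^sup>2) \<partial>lborel) = J"
    by (rule nn_integral_has_integral_lebesgue[OF _ IJ(2)]) simp
  also have "(\<lambda>t. ennreal (indicator {0..1} t * (norm (?g t))\<^sup>2)) = (\<lambda>t. nsq (?g t) * indicator {0..1} t)"
    by (auto simp: indicator_def)
  also have "ennreal J = sq_sum v"
    by (rule suminf_ennreal_eq[OF _ J, symmetric]) simp
  finally show ?thesis .
qed

section \<open>Area integrals: rotations, circle means and the variable u = |z|^2\<close>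

lemma nn_integral_lborel_translate:
  fixes f :: "'a::euclidean_space \<Rightarrow> ennreal"
  assumes [measurable]: "f \<in> borel_measurable borel"
  shows "(\<integral>\<^sup>+x. f (c + x) \<partial>lborel) = (\<integral>\<^sup>+x. f x \<partial>lborel)"
proof -
  have "(\<integral>\<^sup>+x. f (c + x) \<partial>lborel) = (\<integral>\<^sup>+x. f x \<partial>distr lborel borel ((+) c))"
    by (subst nn_integral_distr) auto
  then show ?thesis by (simp add: lborel_distr_plus)
qed

lemma emeasure_unit_disc: "emeasure lborel (ball (c::complex) 1) = ennreal pi"
  by (subst emeasure_ball) (simp_all add: unit_ball_vol_2)

text \<open>The rotated integral is again translation invariant; evaluating the double integral of
  \<open>f (w x + y)\<close> over \<open>y\<close> in the unit disc in both orders shows that it is the original one.\<close>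

lemma nn_integral_rotate:
  fixes f :: "complex \<Rightarrow> ennreal"
  assumes [measurable]: "f \<in> borel_measurable borel" and w: "norm w = 1"
  shows "(\<integral>\<^sup>+x. f (w * x) \<partial>lborel) = (\<integral>\<^sup>+x. f x \<partial>lborel)"
proof -
  have w0: "w \<noteq> 0" using w by auto
  define g :: "complex \<Rightarrow> ennreal" where "g = indicator (ball 0 1)"
  have [measurable]: "g \<in> borel_measurable borel" unfolding g_def by (rule borel_measurable_indicator) simp
  have [measurable]: "(\<lambda>x. w * x) \<in> borel_measurable borel"
    by (intro borel_measurable_continuous_onI continuous_intros)
  have g_int: "(\<integral>\<^sup>+y. g y \<partial>lborel) = ennreal pi"
    by (simp add: g_def emeasure_unit_disc)
  have shift: "(\<integral>\<^sup>+x. f (w * x + y) \<partial>lborel) = (\<integral>\<^sup>+x. f (w * x) \<partial>lborel)" for y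
  proof -
    have "(\<integral>\<^sup>+x. f (w * x + y) \<partial>lborel) = (\<integral>\<^sup>+x. (\<lambda>x. f (w * x)) (y / w + x) \<partial>lborel)"
      using w0 by (simp add: distrib_left add.commute)
    then show ?thesis by (simp only: nn_integral_lborel_translate[of "\<lambda>x. f (w * x)"] measurable)
        (subst nn_integral_lborel_translate, auto)
  qed
  have "(\<integral>\<^sup>+x. f (w * x) \<partial>lborel) * ennreal pi = (\<integral>\<^sup>+y. (\<integral>\<^sup>+x. f (w * x + y) \<partial>lborel) * g y \<partial>lborel)"
    unfolding shift g_int[symmetric] by (rule nn_integral_cmult[symmetric]) simp
  also have "\<dots> = (\<integral>\<^sup>+y. \<integral>\<^sup>+x. f (w * x + y) * g y \<partial>lborel \<partial>lborel)"
    by (intro nn_integral_cong nn_integral_multc[symmetric]) simp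
  also have "\<dots> = (\<integral>\<^sup>+x. \<integral>\<^sup>+y. f (w * x + y) * g y \<partial>lborel \<partial>lborel)"
    by (rule lborel_pair.Fubini') measurable
  also have "\<dots> = (\<integral>\<^sup>+x. \<integral>\<^sup>+y. f y * g (y - w * x) \<partial>lborel \<partial>lborel)"
  proof (rule nn_integral_cong)
    fix x
    have "(\<integral>\<^sup>+y. f (w * x + y) * g y \<partial>lborel) = (\<integral>\<^sup>+y. (\<lambda>y. f y * g (y - w * x)) (w * x + y) \<partial>lborel)"
      by simp
    also have "\<dots> = (\<integral>\<^sup>+y. f y * g (y - w * x) \<partial>lborel)"
      by (rule nn_integral_lborel_translate) measurable
    finally show "(\<integral>\<^sup>+y. f (w * x + y) * g y \<partial>lborel) = (\<integral>\<^sup>+y. f y * g (y - w * x) \<partial>lborel)" .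
  qed
  also have "\<dots> = (\<integral>\<^sup>+y. \<integral>\<^sup>+x. f y * g (y - w * x) \<partial>lborel \<partial>lborel)"
    by (rule lborel_pair.Fubini') measurable
  also have "\<dots> = (\<integral>\<^sup>+y. f y * ennreal pi \<partial>lborel)"
  proof (intro nn_integral_cong)
    fix y
    have "norm (w * x - y) = norm (y / w - x)" for x
    proof -
      have "w * x - y = w * (x - y / w)" using w0 by (simp add: right_diff_distrib)
      then show ?thesis by (metis mult_1 norm_minus_commute norm_mult w)
    qed
    then have "g (y - w * x) = indicator (ball (y / w) 1) x" for x
      by (simp add: g_def indicator_def dist_norm)
    then have "(\<integral>\<^sup>+x. f y * g (y - w * x) \<partial>lborel) = (\<integral>\<^sup>+x. f y * indicator (ball (y / w) 1) x \<partial>lborel)"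
      by simp
    also have "\<dots> = f y * ennreal pi" by (subst nn_integral_cmult_indicator) (simp_all add: emeasure_unit_disc)
    finally show "(\<integral>\<^sup>+x. f y * g (y - w * x) \<partial>lborel) = f y * ennreal pi" .
  qed
  also have "\<dots> = (\<integral>\<^sup>+y. f y \<partial>lborel) * ennreal pi" by (rule nn_integral_multc) simp
  finally show ?thesis
    using pi_gt_zero by (auto simp: mult_right_ennreal_cancel simp del: pi_gt_zero)
qed

text \<open>Rotation invariance averaged over all angles, combined with Tonelli's theorem. Together
  with the radial formula that follows it plays the part of polar coordinates: later the inner mean
  is estimated by a function of |z|^2.\<close>

lemma nn_integral_disc_circle_means:
  fixes q :: "complex \<Rightarrow> ennreal"
  assumes q[measurable]: "(\<lambda>z. q z * indicator (ball 0 1) z) \<in> borel_measurable borel"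
  shows "(\<integral>\<^sup>+z\<in>ball 0 1. q z \<partial>lborel)
       = (\<integral>\<^sup>+z\<in>ball 0 1. (\<integral>\<^sup>+t\<in>{0..1}. q (cis (2 * pi * t) * z) \<partial>lborel) \<partial>lborel)"
proof -
  let ?q = "\<lambda>z. q z * indicator (ball 0 1) z"
  have [measurable]: "(\<lambda>t::real. cis (2 * pi * t)) \<in> borel_measurable borel"
    unfolding cis_conv_exp by (intro borel_measurable_continuous_onI continuous_intros)
  have [measurable]: "(\<lambda>(z, t). ?q (cis (2 * pi * t) * z)) \<in> borel_measurable (lborel \<Otimes>\<^sub>M lborel)"
    by measurable
  have eq: "(\<integral>\<^sup>+t\<in>{0..1}. q (cis (2 * pi * t) * z) \<partial>lborel) * indicator (ball 0 1) z
      = (\<integral>\<^sup>+t. ?q (cis (2 * pi * t) * z) * indicator {0..1} t \<partial>lborel)" for z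
  proof (cases "z \<in> ball 0 1")
    case True
    then show ?thesis by (simp add: norm_mult)
  next
    case False
    then show ?thesis by (simp add: norm_mult)
  qed
  have "(\<integral>\<^sup>+z\<in>ball 0 1. (\<integral>\<^sup>+t\<in>{0..1}. q (cis (2 * pi * t) * z) \<partial>lborel) \<partial>lborel)
      = (\<integral>\<^sup>+z. \<integral>\<^sup>+t. ?q (cis (2 * pi * t) * z) * indicator {0..1} t \<partial>lborel \<partial>lborel)"
    unfolding eq ..
  also have "\<dots> = (\<integral>\<^sup>+t. \<integral>\<^sup>+z. ?q (cis (2 * pi * t) * z) * indicator {0..1} t \<partial>lborel \<partial>lborel)"
    by (rule lborel_pair.Fubini'[symmetric]) measurable
  also have "\<dots> = (\<integral>\<^sup>+t. (\<integral>\<^sup>+z. ?q z \<partial>lborel) * indicator {0..1::real} t \<partial>lborel)"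
  proof (intro nn_integral_cong)
    fix t :: real
    have "(\<integral>\<^sup>+z. ?q (cis (2 * pi * t) * z) * indicator {0..1} t \<partial>lborel)
        = (\<integral>\<^sup>+z. ?q (cis (2 * pi * t) * z) \<partial>lborel) * indicator {0..1} t"
      by (rule nn_integral_multc) measurable
    also have "(\<integral>\<^sup>+z. ?q (cis (2 * pi * t) * z) \<partial>lborel) = (\<integral>\<^sup>+z. ?q z \<partial>lborel)"
      by (rule nn_integral_rotate[OF q]) simp
    finally show "(\<integral>\<^sup>+z. ?q (cis (2 * pi * t) * z) * indicator {0..1} t \<partial>lborel)
        = (\<integral>\<^sup>+z. ?q z \<partial>lborel) * indicator {0..1} t" .
  qed
  also have "\<dots> = (\<integral>\<^sup>+z. ?q z \<partial>lborel)"
    by (subst nn_integral_cmult_indicator) auto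
  finally show ?thesis ..
qed

text \<open>The disc of radius sqrt x has area pi x, so the image of area measure on the unit disc
  under |z|^2 is pi times Lebesgue measure on [0, 1]. The two finite measures are compared on the
  half-lines \<open>{x<..}\<close>.\<close>

lemma nn_integral_disc_radial:
  fixes g :: "real \<Rightarrow> ennreal"
  assumes [measurable]: "g \<in> borel_measurable borel"
  shows "(\<integral>\<^sup>+z\<in>ball (0::complex) 1. g ((norm z)\<^sup>2) \<partial>lborel) = ennreal pi * (\<integral>\<^sup>+u\<in>{0..1}. g u \<partial>lborel)"
proof -
  define M where "M = distr (density lborel (indicator (ball (0::complex) 1))) borel (\<lambda>z. (norm z)\<^sup>2)"
  define N where "N = density lborel (\<lambda>u. ennreal pi * indicator {0..1::real} u)"
  have [simp]: "indicator (ball (0::complex) 1) \<in> borel_measurable borel"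
    by (rule borel_measurable_indicator) simp
  have [simp]: "(\<lambda>z::complex. (norm z)\<^sup>2) -` {x<..} \<in> sets borel" for x
    by (rule measurable_sets_borel[of _ borel]) auto
  have M: "emeasure M {x<..} = emeasure lborel (ball (0::complex) 1 \<inter> {z. x < (norm z)\<^sup>2})" for x
  proof -
    have "emeasure M {x<..} = (\<integral>\<^sup>+z. indicator (ball (0::complex) 1) z * indicator {z. x < (norm z)\<^sup>2} z \<partial>lborel)"
      unfolding M_def by (subst emeasure_distr, simp_all, subst emeasure_density)
        (auto simp: indicator_def intro!: nn_integral_cong)
    also have "\<dots> = (\<integral>\<^sup>+z. indicator (ball (0::complex) 1 \<inter> {z. x < (norm z)\<^sup>2}) z \<partial>lborel)"
      by (simp add: indicator_inter_arith)
    also have "\<dots> = emeasure lborel (ball (0::complex) 1 \<inter> {z. x < (norm z)\<^sup>2})"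
      by (rule nn_integral_indicator) measurable
    finally show ?thesis .
  qed
  have N: "emeasure N {x<..} = ennreal pi * emeasure lborel ({0..1} \<inter> {x<..})" for x
  proof -
    have "emeasure N {x<..} = (\<integral>\<^sup>+u. ennreal pi * indicator ({0..1} \<inter> {x<..}) u \<partial>lborel)"
      unfolding N_def by (subst emeasure_density) (auto simp: indicator_def intro!: nn_integral_cong)
    also have "\<dots> = ennreal pi * emeasure lborel ({0..1} \<inter> {x<..})"
      by (rule nn_integral_cmult_indicator) measurable
    finally show ?thesis .
  qed
  have "M = N"
  proof (rule measure_eqI_lessThan)
    fix x :: real
    show "emeasure M {x<..} < \<infinity>"
    proof -
      have "emeasure M {x<..} \<le> emeasure lborel (ball (0::complex) 1)"
        unfolding M by (rule emeasure_mono) auto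
      then show ?thesis unfolding emeasure_unit_disc by (simp add: le_less_trans)
    qed
    consider "x < 0" | "0 \<le> x" "x < 1" | "1 \<le> x" by linarith
    then show "emeasure M {x<..} = emeasure N {x<..}"
    proof cases
      case 1
      have "ball (0::complex) 1 \<inter> {z. x < (norm z)\<^sup>2} = ball 0 1"
        using 1 by (auto intro: less_le_trans)
      moreover have "{0..1} \<inter> {x<..} = {0..1}" using 1 by auto
      ultimately show ?thesis unfolding M N by (simp add: emeasure_unit_disc)
    next
      case 2
      have "ball (0::complex) 1 \<inter> {z. x < (norm z)\<^sup>2} = ball 0 1 - cball 0 (sqrt x)"
      proof -
        have "norm z \<le> sqrt x \<longleftrightarrow> (norm z)\<^sup>2 \<le> x" for z :: complex
          using real_sqrt_le_iff[of "(norm z)\<^sup>2" x] by simp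
        then have "x < (norm z)\<^sup>2 \<longleftrightarrow> \<not> norm z \<le> sqrt x" for z :: complex
          by (simp only: not_le)
        then show ?thesis by (simp add: set_eq_iff)
      qed
      moreover have "emeasure lborel (ball (0::complex) 1 - cball 0 (sqrt x)) = ennreal pi - ennreal (pi * x)"
      proof -
        have "sqrt x < 1" using 2 by simp
        then have "cball (0::complex) (sqrt x) \<subseteq> ball 0 1" by (simp add: cball_subset_ball_iff)
        moreover have "emeasure lborel (cball (0::complex) (sqrt x)) = ennreal (pi * x)"
          using 2 by (subst emeasure_cball) (simp_all add: unit_ball_vol_2)
        ultimately show ?thesis by (subst emeasure_Diff) (simp_all add: emeasure_unit_disc)
      qed
      moreover have "{0..1} \<inter> {x<..} = {x<..1}" using 2 by auto
      ultimately show ?thesis unfolding M N using 2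
        by (simp add: ennreal_minus ennreal_mult[symmetric] algebra_simps)
    next
      case 3
      have "ball (0::complex) 1 \<inter> {z. x < (norm z)\<^sup>2} = {}"
      proof -
        have "(norm z)\<^sup>2 < 1" if "norm z < 1" for z :: complex
          using that by (simp add: power_less_one_iff abs_square_less_1)
        then show ?thesis using 3 by force
      qed
      moreover have "{0..1} \<inter> {x<..} = {}" using 3 by auto
      ultimately show ?thesis unfolding M N by simp
    qed
  qed (simp_all add: M_def N_def)
  then have "(\<integral>\<^sup>+u. g u \<partial>M) = (\<integral>\<^sup>+u. g u \<partial>N)" by simp
  moreover have "(\<integral>\<^sup>+u. g u \<partial>M) = (\<integral>\<^sup>+z\<in>ball (0::complex) 1. g ((norm z)\<^sup>2) \<partial>lborel)"
    unfolding M_def by (subst nn_integral_distr, simp_all, subst nn_integral_density) (auto simp: mult.commute)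
  moreover have "(\<integral>\<^sup>+u. g u \<partial>N) = ennreal pi * (\<integral>\<^sup>+u\<in>{0..1}. g u \<partial>lborel)"
    unfolding N_def by (subst nn_integral_density)
      (auto simp: nn_integral_cmult[symmetric] mult_ac)
  ultimately show ?thesis by simp
qed

text \<open>The measure exp (-t) dt on the positive half-line has total mass 1, and its image under
  t -> exp (-t) is Lebesgue measure on [0, 1], again compared on half-lines. Working with the image
  measure admits every measurable \<open>g\<close>.\<close>

lemma nn_integral_exp_substitution:
  fixes g :: "real \<Rightarrow> ennreal"
  assumes [measurable]: "g \<in> borel_measurable borel"
  shows "(\<integral>\<^sup>+t\<in>{0..}. ennreal (exp (- t)) * g (exp (- t)) \<partial>lborel) = (\<integral>\<^sup>+u\<in>{0..1}. g u \<partial>lborel)"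
proof -
  define M where "M = distr (density lborel (\<lambda>t. ennreal (exp (- t)) * indicator {0..} t)) borel (\<lambda>t::real. exp (- t))"
  define N where "N = density lborel (\<lambda>u. indicator {0..1::real} u :: ennreal)"
  have [simp]: "(\<lambda>t::real. exp (- t)) -` {x<..} \<in> sets borel" for x
    by (rule measurable_sets_borel[of _ borel]) auto
  have M: "emeasure M {x<..} = (\<integral>\<^sup>+t. ennreal (exp (- t)) * indicator ({0..} \<inter> {t. x < exp (- t)}) t \<partial>lborel)" for x
    unfolding M_def by (subst emeasure_distr, simp_all, subst emeasure_density)
        (auto simp: indicator_def intro!: nn_integral_cong)
  have N: "emeasure N {x<..} = emeasure lborel ({0..1} \<inter> {x<..})" for x
  proof -
    have "emeasure N {x<..} = (\<integral>\<^sup>+u. indicator ({0..1} \<inter> {x<..}) u \<partial>lborel)"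
      unfolding N_def by (subst emeasure_density) (auto intro!: nn_integral_cong simp del: nn_integral_indicator split: split_indicator)
    also have "\<dots> = emeasure lborel ({0..1} \<inter> {x<..})"
      by (rule nn_integral_indicator) measurable
    finally show ?thesis .
  qed
  have total: "(\<integral>\<^sup>+t. ennreal (exp (- t)) * indicator {0..} t \<partial>lborel) = ennreal 1"
  proof -
    have "((\<lambda>t::real. - exp (- t)) \<longlongrightarrow> 0) at_top" by real_asymp
    then have "(\<integral>\<^sup>+t. ennreal (exp (- t)) * indicator {0..} t \<partial>lborel) = ennreal (0 - (- exp (- 0)))"
      by (intro nn_integral_FTC_atLeast) (auto intro!: derivative_eq_intros)
    then show ?thesis by simp
  qed
  have "M = N"
  proof (rule measure_eqI_lessThan)
    fix x :: real
    show "emeasure M {x<..} < \<infinity>"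
    proof -
      have "emeasure M {x<..} \<le> (\<integral>\<^sup>+t. ennreal (exp (- t)) * indicator {0..} t \<partial>lborel)"
        unfolding M by (intro nn_integral_mono) (auto simp: indicator_def)
      then show ?thesis unfolding total by (simp add: le_less_trans)
    qed
    consider "x \<le> 0" | "0 < x" "x < 1" | "1 \<le> x" by linarith
    then show "emeasure M {x<..} = emeasure N {x<..}"
    proof cases
      case 1
      then have "x < exp (- t)" for t using exp_gt_zero[of "- t"] by linarith
      then have "emeasure M {x<..} = 1" unfolding M using total by simp
      moreover have "emeasure lborel ({0..1} \<inter> {x<..}) = 1"
      proof (cases "x = 0")
        case True
        then have "{0..1} \<inter> {x<..} = {0<..1}" by auto
        then show ?thesis by simp
      next
        case False
        then have "{0..1} \<inter> {x<..} = {0..1}" using 1 by auto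
        then show ?thesis by simp
      qed
      ultimately show ?thesis unfolding N by simp
    next
      case 2
      have iff: "x < exp (- t) \<longleftrightarrow> t < - ln x" for t
    proof -
        have "x < exp (- t) \<longleftrightarrow> ln x < ln (exp (- t))" using 2 by (subst ln_less_cancel_iff) simp_all
        then show ?thesis by (simp only: ln_exp) linarith
      qed
      \<comment> \<open>The conditions t < - ln x and t \<le> - ln x differ in one point, a null
        set.\<close>
      have "emeasure M {x<..} = (\<integral>\<^sup>+t. ennreal (exp (- t)) * indicator {0..- ln x} t \<partial>lborel)"
        unfolding M by (intro nn_integral_cong_AE) (use AE_lborel_singleton[of "- ln x"] in \<open>auto simp: indicator_def iff\<close>)
      also have "\<dots> = ennreal (- exp (- (- ln x)) - (- exp (- 0)))"
        by (intro nn_integral_FTC_Icc) (use 2 in \<open>auto intro!: derivative_eq_intros\<close>)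
      also have "\<dots> = ennreal (1 - x)" using 2 by simp
      also have "{0..1} \<inter> {x<..} = {x<..1}" using 2 by auto
      then have "ennreal (1 - x) = emeasure lborel ({0..1} \<inter> {x<..})" using 2 by simp
      finally show ?thesis unfolding N .
    next
      case 3
      have "exp (- t) \<le> 1" if "0 \<le> t" for t :: real using that by simp
      then have "{0..} \<inter> {t. x < exp (- t)} = {}" using 3 by fastforce
      moreover have "{0..1} \<inter> {x<..} = {}" using 3 by auto
      ultimately show ?thesis unfolding M N by simp
    qed
  qed (simp_all add: M_def N_def)
  then have "(\<integral>\<^sup>+u. g u \<partial>M) = (\<integral>\<^sup>+u. g u \<partial>N)" by simp
  moreover have "(\<integral>\<^sup>+u. g u \<partial>M) = (\<integral>\<^sup>+t\<in>{0..}. ennreal (exp (- t)) * g (exp (- t)) \<partial>lborel)"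
    unfolding M_def by (subst nn_integral_distr, simp_all, subst nn_integral_density) (auto simp: mult_ac)
  moreover have "(\<integral>\<^sup>+u. g u \<partial>N) = (\<integral>\<^sup>+u\<in>{0..1}. g u \<partial>lborel)"
    unfolding N_def by (subst nn_integral_density) (auto simp: mult_ac)
  ultimately show ?thesis by simp
qed

section \<open>Hankel matrices acting on rapidly decaying sequences\<close>

text \<open>If the norms are not summable, the right side is \<open>top\<close>; hence later
  estimates can be made in \<open>ennreal\<close> without a prior convergence proof.\<close>

lemma ennreal_norm_suminf_le:
  fixes a :: "nat \<Rightarrow> 'a::banach"
  shows "ennreal (norm (suminf a)) \<le> (\<Sum>n. ennreal (norm (a n)))"
proof (cases "summable (\<lambda>n. norm (a n))")
  case True
  then show ?thesis using summable_norm[OF True] by (simp add: suminf_ennreal2 ennreal_leI)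
next
  case False
  then have "(\<Sum>n. ennreal (norm (a n))) = top" using summable_suminf_not_top[of "\<lambda>n. norm (a n)"] norm_ge_zero by blast
  then show ?thesis by simp
qed

lemma ennreal_suminf_swap:
  fixes f :: "nat \<Rightarrow> nat \<Rightarrow> ennreal"
  shows "(\<Sum>i. \<Sum>j. f i j) = (\<Sum>j. \<Sum>i. f i j)"
  using nn_integral_suminf[of "\<lambda>j i. f i j" "count_space UNIV"] by (simp add: nn_integral_count_space_nat)

lemma ennreal_suminf_triangle:
  fixes A :: "nat \<Rightarrow> nat \<Rightarrow> ennreal"
  shows "(\<Sum>n. \<Sum>i. A n i) = (\<Sum>k. \<Sum>n\<le>k. A n (k - n))"
proof -
  have "(\<Sum>i. A n i) = (\<Sum>k. if n \<le> k then A n (k - n) else 0)" for n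
    by (subst suminf_offset[of "\<lambda>k. if n \<le> k then A n (k - n) else 0" n]) simp_all
  moreover have "(\<Sum>n. if n \<le> k then A n (k - n) else 0) = (\<Sum>n\<le>k. A n (k - n))" for k
    by (subst suminf_finite[of "{..k}"]) auto
  ultimately show ?thesis by (simp add: ennreal_suminf_swap[of "\<lambda>n k. if n \<le> k then A n (k - n) else 0"])
qed

lemma ennreal_suminf_Cauchy_Schwarz:
  fixes f g :: "nat \<Rightarrow> ennreal"
  shows "(\<Sum>n. f n * g n)\<^sup>2 \<le> (\<Sum>n. (f n)\<^sup>2) * (\<Sum>n. (g n)\<^sup>2)"
  using Cauchy_Schwarz_nn_integral[of f "count_space UNIV" g] by (simp add: nn_integral_count_space_nat)

text \<open>Absolute summability along the diagonals n + i = k amounts to unconditional summability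
  over all pairs. The bijection (n, i) -> (n + i, n) and Fubini for unconditional sums, applied on
  both sides, then exchange rows and diagonals.\<close>

lemma suminf_triangle:
  fixes A :: "nat \<Rightarrow> nat \<Rightarrow> 'a::banach"
  assumes "summable (\<lambda>k. \<Sum>n\<le>k. norm (A n (k - n)))"
  shows "summable (\<lambda>i. norm (A n i))" and "(\<Sum>n. \<Sum>i. A n i) = (\<Sum>k. \<Sum>n\<le>k. A n (k - n))"
proof -
  let ?S = "Sigma UNIV (\<lambda>k::nat. {..k})"
  define f where "f = (\<lambda>(k, n). A n (k - n))"
  have bij: "bij_betw (\<lambda>(n, i). (n + i, n)) (UNIV \<times> UNIV) ?S"
    by (rule bij_betwI[where g = "\<lambda>(k, n). (n, k - n)"]) auto
  have abs: "(\<lambda>p. norm (f p)) summable_on ?S"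
  proof (rule Infinite_Sum.abs_summable_on_Sigma_iff[where f = f and A = UNIV and B = "\<lambda>k. {..k}", THEN iffD2], rule conjI)
    show "\<forall>k\<in>UNIV. (\<lambda>n. norm (f (k, n))) summable_on {..k}" by (simp add: summable_on_finite)
    have "summable (\<lambda>k. norm (\<Sum>n\<le>k. norm (A n (k - n))))"
      using assms by (simp add: sum_nonneg)
    then have "(\<lambda>k. norm (\<Sum>n\<le>k. norm (A n (k - n)))) summable_on UNIV"
      by (intro norm_summable_imp_summable_on) simp
    then show "(\<lambda>k. norm (infsum (\<lambda>n. norm (f (k, n))) {..k})) summable_on UNIV"
      by (simp add: f_def)
  qed
  have "(\<lambda>p. norm (f (case p of (n, i) \<Rightarrow> (n + i, n)))) summable_on UNIV \<times> UNIV"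
    using summable_on_reindex_bij_betw[OF bij, of "\<lambda>p. norm (f p)"] abs by simp
  moreover have f_eq: "f (case p of (n, i) \<Rightarrow> (n + i, n)) = A (fst p) (snd p)" for p
    by (auto simp: f_def split: prod.split)
  ultimately have abs2: "(\<lambda>p. norm (A (fst p) (snd p))) summable_on UNIV \<times> UNIV" by simp
  then have sm: "(\<lambda>i. norm (A n i)) summable_on UNIV" for n
    using Infinite_Sum.abs_summable_on_Sigma_iff[THEN iffD1, OF abs2] by simp
  then show "summable (\<lambda>i. norm (A n i))" using summable_on_imp_summable by blast
  have suminf_eq: "suminf g = infsum g UNIV" if "g summable_on UNIV" for g :: "nat \<Rightarrow> 'a"
    using has_sum_imp_sums[OF has_sum_infsum[OF that]] by (simp add: sums_iff)
  have s2: "(\<lambda>p. A (fst p) (snd p)) summable_on UNIV \<times> UNIV" using abs2 by (rule abs_summable_summable)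
  then have s2': "(\<lambda>(n, i). A n i) summable_on UNIV \<times> UNIV" by (simp only: case_prod_unfold)
  have s1: "f summable_on ?S" using abs by (rule abs_summable_summable)
  have i1: "(\<Sum>i. A n i) = infsum (A n) UNIV" for n
    by (rule suminf_eq) (rule abs_summable_summable[OF sm])
  have "(\<Sum>n. \<Sum>i. A n i) = infsum (\<lambda>n. infsum (A n) UNIV) UNIV"
    unfolding i1 by (rule suminf_eq) (rule summable_on_Sigma_banach[OF s2'])
  also have "\<dots> = infsum (\<lambda>p. A (fst p) (snd p)) (UNIV \<times> UNIV)"
    using infsum_Sigma_banach[OF s2] by simp
  also have "\<dots> = infsum f ?S"
    using infsum_reindex_bij_betw[OF bij, of f] by (simp only: f_eq)
  also have "\<dots> = infsum (\<lambda>k. \<Sum>n\<le>k. A n (k - n)) UNIV"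
    using infsum_Sigma_banach[OF s1] by (simp add: f_def)
  also have "\<dots> = (\<Sum>k. \<Sum>n\<le>k. A n (k - n))"
  proof (rule suminf_eq[symmetric])
    have "summable (\<lambda>k. norm (\<Sum>n\<le>k. A n (k - n)))"
      by (rule summable_comparison_test'[OF assms]) (simp add: norm_sum)
    then show "(\<lambda>k. \<Sum>n\<le>k. A n (k - n)) summable_on UNIV" by (rule norm_summable_imp_summable_on)
  qed
  finally show "(\<Sum>n. \<Sum>i. A n i) = (\<Sum>k. \<Sum>n\<le>k. A n (k - n))" .
qed

text \<open>These are the Taylor coefficient sequences of the functions in \<open>Hol_ext\<close>.\<close>

definition geo :: "(nat \<Rightarrow> 'a::real_normed_vector) \<Rightarrow> bool"
  where "geo f \<longleftrightarrow> (\<exists>R>1. ps_conv R f)"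

lemma geoI:
  assumes "\<And>m. norm (f m) \<le> C * q ^ m" "0 \<le> q" "q < 1"
  shows "geo f"
proof -
  \<comment> \<open>Any R with 1 < R and q R < 1 would do; this choice also covers q = 0.\<close>
  define R where "R = 2 / (1 + q)"
  have R: "R > 1" "q * R < 1" using assms(2,3) by (auto simp: R_def field_simps)
  have "ps_conv R f"
    unfolding ps_conv_def
  proof safe
    fix r assume r: "0 \<le> r" "r < R"
    have "q * r < 1" using mult_left_mono[of r R q] r R assms(2) by linarith
    show "summable (\<lambda>n. norm (f n) * r ^ n)"
    proof (rule summable_comparison_test')
      show "summable (\<lambda>n. C * (q * r) ^ n)"
        using \<open>q * r < 1\<close> r assms(2) by (intro summable_mult summable_geometric) (simp add: abs_mult)
      show "norm (norm (f n) * r ^ n) \<le> C * (q * r) ^ n" for n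
        using mult_right_mono[OF assms(1)[of n], of "r ^ n"] r by (simp add: power_mult_distrib)
    qed
  qed
  with R show ?thesis by (auto simp: geo_def)
qed

lemma ps_conv_bound:
  assumes "ps_conv R f" "0 \<le> r" "r < R"
  shows "\<exists>C\<ge>0. \<forall>m. norm (f m) * r ^ m \<le> C"
proof -
  have "(\<lambda>m. norm (f m) * r ^ m) \<longlonglongrightarrow> 0" by (rule summable_LIMSEQ_zero[OF ps_convD[OF assms]])
  then have "Bseq (\<lambda>m. norm (f m) * r ^ m)" by (intro convergent_imp_Bseq) (auto simp: convergent_def)
  then obtain C where C: "C > 0" "\<And>m. norm (norm (f m) * r ^ m) \<le> C" by (meson BseqE)
  then have "norm (f m) * r ^ m \<le> C" for m using abs_le_D1 by (metis real_norm_def)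
  then show ?thesis using C(1) less_imp_le by blast
qed

lemma geo_bound:
  assumes "geo f"
  shows "\<exists>C q. 0 \<le> C \<and> 0 < q \<and> q < 1 \<and> (\<forall>m. norm (f m) \<le> C * q ^ m)"
proof -
  obtain R where R: "R > 1" "ps_conv R f" using assms by (auto simp: geo_def)
  then obtain r where r: "1 < r" "r < R" using dense by blast
  obtain C where C: "C \<ge> 0" "\<And>m. norm (f m) * r ^ m \<le> C" using ps_conv_bound[OF R(2), of r] r by auto
  have "norm (f m) \<le> C * (1 / r) ^ m" for m
    using C(2)[of m] r by (simp add: power_divide field_simps)
  then show ?thesis using C(1) r by (intro exI[of _ C] exI[of _ "1 / r"]) auto
qed

lemma geo_ps_conv: "geo f \<Longrightarrow> ps_conv 1 f"
  unfolding geo_def using ps_conv_mono less_imp_le by blast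

lemma geo_summable_norm: "geo f \<Longrightarrow> summable (\<lambda>m. norm (f m))"
  unfolding geo_def using ps_convD[of _ f 1] by fastforce

lemma geo_le: "geo f \<Longrightarrow> (\<And>m. norm (g m) \<le> K * norm (f m)) \<Longrightarrow> geo g"
  unfolding geo_def using ps_conv_le by blast

lemma geo_finite: 
  assumes "\<And>m. m > M \<Longrightarrow> f m = 0" shows "geo f"
proof (rule geoI[where q = "1/2"])
  fix m
  show "norm (f m) \<le> ((\<Sum>k\<le>M. norm (f k)) * 2 ^ M) * (1/2) ^ m"
  proof (cases "m \<le> M")
    case True
    have "norm (f m) \<le> (\<Sum>k\<le>M. norm (f k))" using True by (intro member_le_sum) auto
    moreover have "(1::real) \<le> 2 ^ M * (1/2) ^ m" using True by (simp add: power_divide power_increasing)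
    ultimately have "norm (f m) * 1 \<le> (\<Sum>k\<le>M. norm (f k)) * (2 ^ M * (1/2) ^ m)"
      by (intro mult_mono) (auto simp: sum_nonneg)
    then show ?thesis by (simp add: mult.assoc)
  qed (use assms in \<open>auto simp: sum_nonneg\<close>)
qed auto

lemma geo_minus:
  assumes "geo f" "geo g" shows "geo (\<lambda>m. f m - g m)"
proof -
  from assms obtain R S where "R > 1" "ps_conv R f" "S > 1" "ps_conv S g" by (auto simp: geo_def)
  then have "ps_conv (min R S) (\<lambda>m. f m - g m)"
    unfolding ps_conv_def
  proof safe
    fix r assume r: "0 \<le> r" "r < min R S" and h: "\<forall>r. 0 \<le> r \<and> r < R \<longrightarrow> summable (\<lambda>n. norm (f n) * r ^ n)"
      "\<forall>r. 0 \<le> r \<and> r < S \<longrightarrow> summable (\<lambda>n. norm (g n) * r ^ n)"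
    show "summable (\<lambda>n. norm (f n - g n) * r ^ n)"
    proof (rule summable_comparison_test')
      show "summable (\<lambda>n. norm (f n) * r ^ n + norm (g n) * r ^ n)" using r h by (intro summable_add) auto
      show "norm (norm (f n - g n) * r ^ n) \<le> norm (f n) * r ^ n + norm (g n) * r ^ n" for n
        using mult_right_mono[OF norm_triangle_ineq4[of "f n" "g n"], of "r ^ n"] r by (simp add: distrib_right)
    qed
  qed
  with \<open>R > 1\<close> \<open>S > 1\<close> show ?thesis unfolding geo_def by (intro exI[of _ "min R S"]) simp
qed

lemma geo_shift:
  assumes "geo f" shows "geo (\<lambda>m. f (m + s))"
proof -
  obtain C q where C: "0 \<le> C" "0 < q" "q < 1" "\<And>m. norm (f m) \<le> C * q ^ m" using geo_bound[OF assms] by blast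
  show ?thesis
  proof (rule geoI)
    show "norm (f (m + s)) \<le> (C * q ^ s) * q ^ m" for m
      using C(4)[of "m + s"] by (simp add: power_add mult_ac)
  qed (use C in auto)
qed

text \<open>All terms are at most C y^p with y = max x q < 1 and there are p + 1 of them; the factor
  1 + p does not harm geometric decay. The sequence is the norm majorant of
  \<open>kernel_mult\<close>, defined below.\<close>

lemma geo_convolution:
  assumes f: "geo f" and x: "0 \<le> x" "x < 1"
  shows "geo (\<lambda>p. \<Sum>i\<le>p. x ^ i * norm (f (p - i)))"
proof -
  obtain C q where C: "0 \<le> C" "0 < q" "q < 1" "\<And>m. norm (f m) \<le> C * q ^ m" using geo_bound[OF f] by blast
  define y where "y = max x q"
  have y: "0 < y" "y < 1" "x \<le> y" "q \<le> y" using C x by (auto simp: y_def)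
  have bound: "(\<Sum>i\<le>p. x ^ i * norm (f (p - i))) \<le> C * ((1 + real p) * y ^ p)" for p
  proof -
    have "x ^ i * norm (f (p - i)) \<le> C * y ^ p" if "i \<le> p" for i
    proof -
      have "norm (f (p - i)) \<le> C * y ^ (p - i)"
        using C(4)[of "p - i"] mult_left_mono[OF power_mono[OF y(4), of "p - i"] C(1)] C(2) by linarith
      then have "x ^ i * norm (f (p - i)) \<le> y ^ i * (C * y ^ (p - i))"
        using x y C by (intro mult_mono power_mono) auto
      also have "\<dots> = C * y ^ p" using that by (simp add: power_add[symmetric] mult.left_commute)
      finally show ?thesis .
    qed
    then have "(\<Sum>i\<le>p. x ^ i * norm (f (p - i))) \<le> of_nat (card {..p}) * (C * y ^ p)"
      by (intro sum_bounded_above) auto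
    then show ?thesis by (simp add: mult_ac)
  qed
  have "ps_conv (1 / y) (\<lambda>p. y ^ p)"
    unfolding ps_conv_def
  proof safe
    fix r assume r: "0 \<le> r" "r < 1 / y"
    then have "y * r < 1" using y by (simp add: pos_less_divide_eq mult.commute)
    then have "summable (\<lambda>n. (y * r) ^ n)" using r y by (intro summable_geometric) simp
    then show "summable (\<lambda>n. norm (y ^ n) * r ^ n)" using y by (simp add: power_mult_distrib)
  qed
  then have "ps_conv (1 / y) (\<lambda>p. (1 + real p) *\<^sub>R y ^ p)"
    by (rule ps_conv_weight[where \<beta> = 1]) simp
  then have "geo (\<lambda>p. (1 + real p) *\<^sub>R y ^ p)" unfolding geo_def using y by (intro exI[of _ "1 / y"]) auto
  then show ?thesis
    by (rule geo_le[where K = C]) (use bound y x in \<open>simp add: sum_nonneg\<close>)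
qed

section \<open>Hankel matrices and the geometric kernel\<close>

definition hank :: "(nat \<Rightarrow> ('h, 'h) cblinfun) \<Rightarrow> (nat \<Rightarrow> 'h) \<Rightarrow> nat \<Rightarrow> 'h::complex_hilbert_space"
  where "hank P f n = (\<Sum>m. cblinfun_apply (P (m + n)) (f m))"

text \<open>The coefficients \<open>P k\<close> may grow like r^(-k) for any r < 1, while
  \<open>f\<close> decays like q^m. A radius \<open>r\<close> between max q s and 1 makes q / r < 1,
  hence decay in \<open>m\<close>, and costs at most (1 / s)^n in \<open>n\<close>. Since s < 1 is
  arbitrary, Hankel images are again analytic on the disc.\<close>

lemma hankel_term_bound:
  fixes P :: "nat \<Rightarrow> 'a::real_normed_vector" and f :: "nat \<Rightarrow> 'b::real_normed_vector"
  assumes P: "ps_conv 1 P" and f: "geo f" and s: "0 < s" "s < 1"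
  shows "\<exists>K x. 0 \<le> K \<and> 0 \<le> x \<and> x < 1 \<and> (\<forall>m n. norm (P (m + n)) * norm (f m) \<le> K * x ^ m * (1 / s) ^ n)"
proof -
  obtain C q where C: "0 \<le> C" "0 < q" "q < 1" "\<And>m. norm (f m) \<le> C * q ^ m" using geo_bound[OF f] by blast
  obtain r where r: "max q s < r" "r < 1" using C s dense[of "max q s" 1] by auto
  then have r0: "0 < r" using s by auto
  obtain K where K: "K \<ge> 0" "\<And>k. norm (P k) * r ^ k \<le> K" using ps_conv_bound[OF P, of r] r r0 by auto
  have "norm (P (m + n)) * norm (f m) \<le> (K * C) * (q / r) ^ m * (1 / s) ^ n" for m n
  proof -
    have "norm (P (m + n)) \<le> K * ((1 / r) ^ m * (1 / r) ^ n)"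
      using K(2)[of "m + n"] r0 by (simp add: power_divide power_add field_simps)
    also have "\<dots> \<le> K * ((1 / r) ^ m * (1 / s) ^ n)"
      using r s K r0 by (intro mult_left_mono power_mono) (auto simp: field_simps)
    finally have "norm (P (m + n)) * norm (f m) \<le> K * ((1 / r) ^ m * (1 / s) ^ n) * (C * q ^ m)"
      using C K r0 s by (intro mult_mono) auto
    then show ?thesis by (simp add: power_divide mult_ac)
  qed
  then show ?thesis using K C r r0 by (intro exI[of _ "K * C"] exI[of _ "q / r"]) auto
qed

lemma hankel_summable:
  fixes P :: "nat \<Rightarrow> 'a::real_normed_vector" and f :: "nat \<Rightarrow> 'b::real_normed_vector"
  assumes P: "ps_conv 1 P" and f: "geo f"
  shows "summable (\<lambda>m. norm (P (m + n)) * norm (f m))"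
proof -
  obtain K x where K: "0 \<le> K" "0 \<le> x" "x < 1" "\<And>m n. norm (P (m + n)) * norm (f m) \<le> K * x ^ m * (1 / (1/2)) ^ n"
    using hankel_term_bound[OF P f, of "1/2"] by auto
  show ?thesis
  proof (rule summable_comparison_test')
    show "summable (\<lambda>m. K * x ^ m * (1 / (1/2)) ^ n)" using K by (intro summable_mult summable_mult2 summable_geometric) auto
  qed (use K in auto)
qed

lemma hank_summable:
  assumes P: "ps_conv 1 P" and f: "geo f"
  shows "summable (\<lambda>m. norm (cblinfun_apply (P (m + n)) (f m)))"
  by (rule summable_comparison_test'[OF hankel_summable[OF assms, of n]]) (simp add: norm_cblinfun_apply)

lemma hank_minus:
  assumes "ps_conv 1 P" "geo f" "geo g"
  shows "hank P (\<lambda>m. f m - g m) n = hank P f n - hank P g n"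
  unfolding hank_def cblinfun_apply_simps
  by (rule suminf_diff[symmetric]) (rule summable_norm_cancel[OF hank_summable], use assms in auto)+

lemma hank_single: "hank P (\<lambda>m. if m = 0 then x else 0) n = cblinfun_apply (P n) x"
  unfolding hank_def by (subst suminf_finite[of "{0}"]) (auto simp: cblinfun_apply_simps)

lemma ps_conv_hank:
  assumes P: "ps_conv 1 P" and f: "geo f"
  shows "ps_conv 1 (hank P f)"
  unfolding ps_conv_def
proof safe
  fix r :: real assume r: "0 \<le> r" "r < 1"
  then obtain s where s: "r < s" "s < 1" using dense by blast
  then have s0: "0 < s" using r by simp
  obtain K x where K: "0 \<le> K" "0 \<le> x" "x < 1" "\<And>m n. norm (P (m + n)) * norm (f m) \<le> K * x ^ m * (1 / s) ^ n"
    using hankel_term_bound[OF P f s0 s(2)] by auto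
  have "norm (hank P f n) \<le> K / (1 - x) * (1 / s) ^ n" for n
  proof -
    have sx: "summable (\<lambda>m. K * x ^ m * (1 / s) ^ n)" using K by (intro summable_mult summable_mult2 summable_geometric) auto
    have "norm (hank P f n) \<le> (\<Sum>m. norm (cblinfun_apply (P (m + n)) (f m)))"
      unfolding hank_def by (rule summable_norm[OF hank_summable[OF P f]])
    also have "\<dots> \<le> (\<Sum>m. K * x ^ m * (1 / s) ^ n)"
      by (intro suminf_le hank_summable[OF P f] sx) (rule order_trans[OF norm_cblinfun_apply K(4)])
    also have "\<dots> = K / (1 - x) * (1 / s) ^ n"
    proof -
      have "(\<lambda>m. (K * (1 / s) ^ n) * x ^ m) sums ((K * (1 / s) ^ n) * (1 / (1 - x)))"
        using K by (intro sums_mult geometric_sums) auto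
      then show ?thesis by (simp add: sums_iff mult_ac)
    qed
    finally show ?thesis .
  qed
  note bound = this
  show "summable (\<lambda>n. norm (hank P f n) * r ^ n)"
  proof (rule summable_comparison_test')
    show "summable (\<lambda>n. K / (1 - x) * (r / s) ^ n)" using r s s0 by (intro summable_mult summable_geometric) auto
    show "norm (norm (hank P f n) * r ^ n) \<le> K / (1 - x) * (r / s) ^ n" for n
      using mult_right_mono[OF bound[of n], of "r ^ n"] r by (simp add: power_divide mult_ac)
  qed
qed

text \<open>The coefficients of \<open>h(w) / (1 - z w)\<close> as a function of \<open>w\<close>.\<close>

definition kernel_mult :: "complex \<Rightarrow> (nat \<Rightarrow> 'a) \<Rightarrow> nat \<Rightarrow> 'a::complex_normed_vector"
  where "kernel_mult z h p = (\<Sum>i\<le>p. z ^ i *\<^sub>C h (p - i))"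

lemma geo_kernel_mult:
  assumes "geo h" "norm z < 1" shows "geo (kernel_mult z h)"
proof (rule geo_le[OF geo_convolution[OF assms(1) norm_ge_zero assms(2)], where K = 1])
  fix p
  have "norm (kernel_mult z h p) \<le> (\<Sum>i\<le>p. norm z ^ i * norm (h (p - i)))"
    unfolding kernel_mult_def by (rule order_trans[OF norm_sum]) (simp add: norm_scaleC norm_power)
  then show "norm (kernel_mult z h p) \<le> 1 * norm (\<Sum>i\<le>p. norm z ^ i * norm (h (p - i)))"
    by (simp add: sum_nonneg)
qed

text \<open>\<open>kernel_mult z h\<close> is the sum over \<open>i\<close> of z^i times the
  \<open>i\<close>-fold shift of \<open>h\<close>, and shifting the argument of a Hankel matrix by
  \<open>i\<close> raises the row index by \<open>i\<close>. Regrouping along i + m = p is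
  legitimate by the decay in \<open>geo_convolution\<close>.\<close>

lemma hank_kernel_mult:
  assumes P: "ps_conv 1 P" and h: "geo h" and z: "norm z < 1"
  shows "hank P (kernel_mult z h) n = (\<Sum>i. z ^ i *\<^sub>C hank P h (n + i))"
proof -
  define A where "A i m = z ^ i *\<^sub>C cblinfun_apply (P (m + (n + i))) (h m)" for i m
  have A: "A i (p - i) = cblinfun_apply (P (p + n)) (z ^ i *\<^sub>C h (p - i))" if "i \<le> p" for i p
    using that by (simp add: A_def cblinfun_apply_simps add_ac)
  have "summable (\<lambda>p. \<Sum>i\<le>p. norm (A i (p - i)))"
  proof (rule summable_comparison_test')
    show "summable (\<lambda>p. norm (P (p + n)) * norm (\<Sum>i\<le>p. norm z ^ i * norm (h (p - i))))"
      by (rule hankel_summable[OF P geo_convolution[OF h norm_ge_zero z]])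
    fix p
    have "(\<Sum>i\<le>p. norm (A i (p - i))) \<le> (\<Sum>i\<le>p. norm (P (p + n)) * (norm z ^ i * norm (h (p - i))))"
    proof (rule sum_mono)
      fix i assume "i \<in> {..p}"
      then have "norm (A i (p - i)) \<le> norm (P (p + n)) * norm (z ^ i *\<^sub>C h (p - i))"
        by (simp add: A norm_cblinfun_apply)
      then show "norm (A i (p - i)) \<le> norm (P (p + n)) * (norm z ^ i * norm (h (p - i)))"
        by (simp add: norm_scaleC norm_power)
    qed
    then show "norm (\<Sum>i\<le>p. norm (A i (p - i))) \<le> norm (P (p + n)) * norm (\<Sum>i\<le>p. norm z ^ i * norm (h (p - i)))"
      by (simp add: sum_nonneg sum_distrib_left)
  qed
  from suminf_triangle(2)[OF this]
  have "(\<Sum>i. \<Sum>m. A i m) = (\<Sum>p. \<Sum>i\<le>p. A i (p - i))" .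
  moreover have "(\<Sum>m. A i m) = z ^ i *\<^sub>C hank P h (n + i)" for i
    unfolding A_def hank_def
    by (rule bounded_linear.suminf[OF bounded_linear_scaleC_right, symmetric])
      (rule summable_norm_cancel[OF hank_summable[OF P h]])
  moreover have "(\<Sum>i\<le>p. A i (p - i)) = cblinfun_apply (P (p + n)) (kernel_mult z h p)" for p
    unfolding kernel_mult_def
    by (subst linear_sum[OF bounded_linear.linear[OF bounded_linear_cblinfun_apply]]) (simp add: A)
  ultimately show ?thesis by (simp add: hank_def)
qed

text \<open>The function \<open>D^(1+\<alpha>) \<Gamma> h\<close>.\<close>

definition hank_deriv :: "real \<Rightarrow> (nat \<Rightarrow> ('h, 'h) cblinfun) \<Rightarrow> (nat \<Rightarrow> 'h) \<Rightarrow> complex \<Rightarrow> 'h::complex_hilbert_space"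
  where "hank_deriv \<alpha> P h z = psum (\<lambda>k. (1 + real k) powr (1 + \<alpha>) *\<^sub>R hank P h k) z"

section \<open>The derivative of a Hankel image through the kernel\<close>

lemma sum_powr_telescope:
  "(\<Sum>n\<le>k. (1 + real n) powr p - real n powr p) = (1 + real k) powr p"
  by (induction k) (simp_all add: add.commute)

lemma powr_diff_le:
  assumes "\<alpha> > 0"
  shows "(1 + real n) powr (1 + \<alpha>) - real n powr (1 + \<alpha>) \<le> (1 + \<alpha>) * (1 + real n) powr \<alpha>"
proof (cases "n = 0")
  case False
  then have n: "real n > 0" by simp
  have "\<exists>\<xi>. real n < \<xi> \<and> \<xi> < 1 + real n \<and>
      (1 + real n) powr (1 + \<alpha>) - real n powr (1 + \<alpha>) = (1 + real n - real n) * ((1 + \<alpha>) * \<xi> powr \<alpha>)"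
    by (rule MVT2) (use n in \<open>auto intro!: derivative_eq_intros\<close>)
  then obtain \<xi> where \<xi>: "real n < \<xi>" "\<xi> < 1 + real n"
    "(1 + real n) powr (1 + \<alpha>) - real n powr (1 + \<alpha>) = (1 + \<alpha>) * \<xi> powr \<alpha>" by auto
  have "\<xi> powr \<alpha> \<le> (1 + real n) powr \<alpha>" using \<xi> n assms by (intro powr_mono2) auto
  then show ?thesis using \<xi>(3) assms by simp
qed (use assms in simp)

text \<open>Summation by parts: (1 + k)^(1+\<alpha>) is the sum of the increments \<open>c n\<close>
  over n \<le> k. After the exchange of sums each increment multiplies a tail of the series of the
  Hankel image, and \<open>hank_kernel_mult\<close> recognises that tail as one row of \<Gamma>
  applied to the kernel. The increments are only of order (1 + n)^\<alpha>, the weight that a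
  bounded D^\<alpha> \<Gamma> controls.\<close>

lemma hank_deriv_eq:
  assumes P: "ps_conv 1 P" and h: "geo h" and z: "norm z < 1" and \<alpha>: "\<alpha> > 0"
  shows "hank_deriv \<alpha> P h z = (\<Sum>n. ((1 + real n) powr (1 + \<alpha>) - real n powr (1 + \<alpha>)) *\<^sub>R z ^ n *\<^sub>C hank P (kernel_mult z h) n)"
proof -
  define c where "c n = (1 + real n) powr (1 + \<alpha>) - real n powr (1 + \<alpha>)" for n
  have c0: "c n \<ge> 0" for n using \<alpha> by (simp add: c_def powr_mono2)
  define A where "A n i = c n *\<^sub>R z ^ (n + i) *\<^sub>C hank P h (n + i)" for n i
  have pc: "ps_conv 1 (\<lambda>k. (1 + real k) powr (1 + \<alpha>) *\<^sub>R hank P h k)"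
    by (rule ps_conv_weight[OF ps_conv_hank[OF P h], where \<beta> = "1 + \<alpha>"]) simp
  have "summable (\<lambda>k. \<Sum>n\<le>k. norm (A n (k - n)))"
  proof -
    have "(\<Sum>n\<le>k. norm (A n (k - n))) = norm (z ^ k *\<^sub>C (1 + real k) powr (1 + \<alpha>) *\<^sub>R hank P h k)" for k
    proof -
      have "(\<Sum>n\<le>k. norm (A n (k - n))) = (\<Sum>n\<le>k. c n) * norm (z ^ k *\<^sub>C hank P h k)"
        unfolding sum_distrib_right by (intro sum.cong) (auto simp: A_def c0)
      then show ?thesis by (simp add: c_def sum_powr_telescope norm_scaleC)
    qed
    then show ?thesis using ps_conv_summable_norm[OF pc z] by simp
  qed
  note tri = suminf_triangle[OF this]
  have "(\<Sum>n\<le>k. A n (k - n)) = z ^ k *\<^sub>C (1 + real k) powr (1 + \<alpha>) *\<^sub>R hank P h k" for k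
  proof -
    have "(\<Sum>n\<le>k. A n (k - n)) = (\<Sum>n\<le>k. c n) *\<^sub>R z ^ k *\<^sub>C hank P h k"
      unfolding scaleR_sum_left by (intro sum.cong) (auto simp: A_def)
    then show ?thesis by (simp add: c_def sum_powr_telescope scaleC_scaleR)
  qed
  then have hank_deriv: "hank_deriv \<alpha> P h z = (\<Sum>n. \<Sum>i. A n i)" unfolding hank_deriv_def psum_def tri(2) by simp
  have "(\<Sum>i. A n i) = c n *\<^sub>R z ^ n *\<^sub>C hank P (kernel_mult z h) n" for n
  proof -
    have sm: "summable (\<lambda>i. z ^ i *\<^sub>C hank P h (n + i))"
    proof -
      obtain s where s: "norm z < s" "s < 1" using z dense by blast
      then have s0: "0 < s" using norm_ge_zero[of z] by linarith
      have "summable (\<lambda>k. norm (hank P h k) * s ^ k)" using ps_convD[OF ps_conv_hank[OF P h], of s] s s0 by simp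
      then have "summable (\<lambda>i. norm (hank P h (i + n)) * s ^ (i + n))" by (rule summable_ignore_initial_segment)
      then have "summable (\<lambda>i. (norm (hank P h (i + n)) * s ^ (i + n)) * (1 / s ^ n))" by (rule summable_mult2)
      then have "summable (\<lambda>i. norm (hank P h (n + i)) * s ^ i)" using s0 by (simp add: power_add add.commute)
      moreover have "norm (z ^ i *\<^sub>C hank P h (n + i)) \<le> norm (hank P h (n + i)) * s ^ i" for i
        using mult_left_mono[OF power_mono[of "norm z" s i], of "norm (hank P h (n + i))"] s
        by (simp add: norm_scaleC norm_power mult.commute)
      ultimately show ?thesis by (rule summable_comparison_test')
    qed
    have "bounded_linear (\<lambda>x::'a. c n *\<^sub>R z ^ n *\<^sub>C x)"
      by (rule bounded_linear_compose[OF bounded_linear_scaleR_right bounded_linear_scaleC_right])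
    from bounded_linear.suminf[OF this sm]
    show ?thesis unfolding hank_kernel_mult[OF P h z] by (simp add: A_def scaleC_scaleC power_add)
  qed
  then show ?thesis unfolding hank_deriv by (simp add: c_def)
qed

text \<open>\<open>N\<close> bounds the square of the operator norm of D^\<alpha> \<Gamma>. The
  homogeneous form applies directly to sequences such as \<open>kernel_mult z h\<close>, whose norm
  is not 1.\<close>

definition hankel_bounded :: "real \<Rightarrow> (nat \<Rightarrow> ('h, 'h) cblinfun) \<Rightarrow> real \<Rightarrow> 'h::complex_hilbert_space itself \<Rightarrow> bool"
  where "hankel_bounded \<alpha> P N _ \<longleftrightarrow> 0 \<le> N \<and> (\<forall>f::nat \<Rightarrow> 'h. geo f \<longrightarrow>
    (\<Sum>n. ennreal (((1 + real n) powr \<alpha> * norm (hank P f n))\<^sup>2)) \<le> ennreal N * sq_sum f)"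

text \<open>Cauchy-Schwarz in \<open>n\<close> between |z|^n and (1 + n)^\<alpha> times the rows:
  the first factor sums to 1 / (1 - |z|^2), the second is controlled by boundedness applied to the
  kernel.\<close>

lemma hank_deriv_bound:
  fixes P :: "nat \<Rightarrow> ('h::complex_hilbert_space, 'h) cblinfun"
  assumes P: "ps_conv 1 P" and N: "hankel_bounded \<alpha> P N TYPE('h)" and h: "geo h" and z: "norm z < 1" and \<alpha>: "\<alpha> > 0"
  shows "nsq (hank_deriv \<alpha> P h z)
    \<le> ennreal ((1 + \<alpha>)\<^sup>2 * N / (1 - (norm z)\<^sup>2)) * sq_sum (kernel_mult z h)"
proof -
  define c where "c n = (1 + real n) powr (1 + \<alpha>) - real n powr (1 + \<alpha>)" for n
  define X where "X = hank P (kernel_mult z h)"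
  have c0: "c n \<ge> 0" for n using \<alpha> by (simp add: c_def powr_mono2)
  have z2: "(norm z)\<^sup>2 < 1" using z by (simp add: abs_square_less_1)
  have "ennreal (norm (hank_deriv \<alpha> P h z)) \<le> (\<Sum>n. ennreal (norm (c n *\<^sub>R z ^ n *\<^sub>C X n)))"
    unfolding hank_deriv_eq[OF P h z \<alpha>] c_def X_def by (rule ennreal_norm_suminf_le)
  also have "\<dots> \<le> (\<Sum>n. ennreal ((1 + \<alpha>) * norm z ^ n) * ennreal ((1 + real n) powr \<alpha> * norm (X n)))"
  proof (rule suminf_le)
    fix n
    have "norm (c n *\<^sub>R z ^ n *\<^sub>C X n) \<le> ((1 + \<alpha>) * (1 + real n) powr \<alpha>) * (norm z ^ n * norm (X n))"
      using mult_right_mono[OF powr_diff_le[OF \<alpha>, of n], of "norm z ^ n * norm (X n)"] c0[of n]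
      by (simp add: norm_scaleC norm_power c_def)
    then show "ennreal (norm (c n *\<^sub>R z ^ n *\<^sub>C X n)) \<le> ennreal ((1 + \<alpha>) * norm z ^ n) * ennreal ((1 + real n) powr \<alpha> * norm (X n))"
      using \<alpha> by (simp add: ennreal_mult[symmetric] ennreal_leI mult_ac)
  qed auto
  finally have "(ennreal (norm (hank_deriv \<alpha> P h z)))\<^sup>2 \<le> (\<Sum>n. ennreal ((1 + \<alpha>) * norm z ^ n) * ennreal ((1 + real n) powr \<alpha> * norm (X n)))\<^sup>2"
    by (rule power_mono) simp
  also have "\<dots> \<le> (\<Sum>n. (ennreal ((1 + \<alpha>) * norm z ^ n))\<^sup>2) * (\<Sum>n. (ennreal ((1 + real n) powr \<alpha> * norm (X n)))\<^sup>2)"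
    by (rule ennreal_suminf_Cauchy_Schwarz)
  also have "(\<Sum>n. (ennreal ((1 + \<alpha>) * norm z ^ n))\<^sup>2) = ennreal ((1 + \<alpha>)\<^sup>2 * (1 / (1 - (norm z)\<^sup>2)))"
  proof -
    have "(\<lambda>n. (1 + \<alpha>)\<^sup>2 * ((norm z)\<^sup>2) ^ n) sums ((1 + \<alpha>)\<^sup>2 * (1 / (1 - (norm z)\<^sup>2)))"
      using z2 by (intro sums_mult geometric_sums) auto
    moreover have "(ennreal ((1 + \<alpha>) * norm z ^ n))\<^sup>2 = ennreal ((1 + \<alpha>)\<^sup>2 * ((norm z)\<^sup>2) ^ n)" for n
      using \<alpha> by (simp add: ennreal_power power_mult_distrib power_mult[symmetric] mult.commute)
    ultimately show ?thesis by (simp only:) (rule suminf_ennreal_eq, simp)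
  qed
  finally have "nsq (hank_deriv \<alpha> P h z)
      \<le> ennreal ((1 + \<alpha>)\<^sup>2 * (1 / (1 - (norm z)\<^sup>2))) * (\<Sum>n. ennreal (((1 + real n) powr \<alpha> * norm (X n))\<^sup>2))"
    by (simp add: ennreal_power)
  also have "\<dots> \<le> ennreal ((1 + \<alpha>)\<^sup>2 * (1 / (1 - (norm z)\<^sup>2))) * (ennreal N * sq_sum (kernel_mult z h))"
    using N geo_kernel_mult[OF h z] unfolding hankel_bounded_def X_def by (intro mult_left_mono) auto
  also have "\<dots> = ennreal ((1 + \<alpha>)\<^sup>2 * N / (1 - (norm z)\<^sup>2)) * sq_sum (kernel_mult z h)"
  proof -
    have "0 \<le> N" using N by (simp add: hankel_bounded_def)
    then have "ennreal ((1 + \<alpha>)\<^sup>2 * (1 / (1 - (norm z)\<^sup>2))) * ennreal N = ennreal ((1 + \<alpha>)\<^sup>2 * N / (1 - (norm z)\<^sup>2))"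
      using z2 by (simp add: ennreal_mult[symmetric])
    then show ?thesis by (simp only: mult.assoc[symmetric])
  qed
  finally show ?thesis .
qed

section \<open>Decay of Hankel images in weighted norms\<close>

lemma powr_increment_ge:
  assumes "0 < \<delta>" "\<delta> \<le> 1"
  shows "\<delta> * (1 + real s) powr (\<delta> - 1) \<le> (1 + real s) powr \<delta> - real s powr \<delta>"
proof (cases "s = 0")
  case False
  then have s: "real s > 0" by simp
  have "\<exists>\<xi>. real s < \<xi> \<and> \<xi> < 1 + real s \<and>
      (1 + real s) powr \<delta> - real s powr \<delta> = (1 + real s - real s) * (\<delta> * \<xi> powr (\<delta> - 1))"
    by (rule MVT2) (use s in \<open>auto intro!: derivative_eq_intros\<close>)
  then obtain \<xi> where \<xi>: "real s < \<xi>" "\<xi> < 1 + real s"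
    "(1 + real s) powr \<delta> - real s powr \<delta> = \<delta> * \<xi> powr (\<delta> - 1)" by auto
  have "(1 + real s) powr (\<delta> - 1) \<le> \<xi> powr (\<delta> - 1)" using \<xi> s assms by (intro powr_mono2') auto
  then show ?thesis using \<xi>(3) assms by simp
qed (use assms in simp)

lemma powr_decrement_ge:
  assumes "0 < \<delta>" "0 < s"
  shows "\<delta> * (1 + real s) powr (- \<delta> - 1) \<le> real s powr (- \<delta>) - (1 + real s) powr (- \<delta>)"
proof -
  have s: "real s > 0" using assms by simp
  have "\<exists>\<xi>. real s < \<xi> \<and> \<xi> < 1 + real s \<and>
      (1 + real s) powr (- \<delta>) - real s powr (- \<delta>) = (1 + real s - real s) * ((- \<delta>) * \<xi> powr (- \<delta> - 1))"
    by (rule MVT2) (use s in \<open>auto intro!: derivative_eq_intros\<close>)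
  then obtain \<xi> where \<xi>: "real s < \<xi>" "\<xi> < 1 + real s"
    "(1 + real s) powr (- \<delta>) - real s powr (- \<delta>) = - \<delta> * \<xi> powr (- \<delta> - 1)" by auto
  have "(1 + real s) powr (- \<delta> - 1) \<le> \<xi> powr (- \<delta> - 1)" using \<xi> s assms by (intro powr_mono2') auto
  then have "\<delta> * (1 + real s) powr (- \<delta> - 1) \<le> \<delta> * \<xi> powr (- \<delta> - 1)" using assms by simp
  then show ?thesis using \<xi>(3) by linarith
qed

text \<open>For s \<le> j the first factor is at most (1 + j)^(-2\<delta>) and the second sums to at
  most (1 + j)^\<delta> / \<delta>. For s > j the product is at most (1 + s)^(-1-\<delta>), with
  tail at most (1 + j)^(-\<delta>) / \<delta>. The two ranges contribute equally, hence the
  2.\<close>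

lemma weight_sum_le:
  assumes \<delta>: "0 < \<delta>" "\<delta> \<le> 1"
  shows "(\<Sum>s. ennreal ((1 + real j + real s) powr (- 2 * \<delta>) * (1 + real s) powr (\<delta> - 1)))
    \<le> ennreal (2 / \<delta> * (1 + real j) powr (- \<delta>))"
proof -
  define J where "J = 1 + real j"
  have J: "J \<ge> 1" by (simp add: J_def)
  define t where "t s = (J + real s) powr (- 2 * \<delta>) * (1 + real s) powr (\<delta> - 1)" for s
  txt \<open>\<open>G\<close> grows by at least \<open>\<delta> t M\<close> in each step; its two branches agree at \<open>M = j + 1\<close>.\<close>
  define G where "G M = (if M \<le> Suc j then J powr (- 2 * \<delta>) * real M powr \<delta> else 2 * J powr (- \<delta>) - real M powr (- \<delta>))" for M
  have partial: "\<delta> * (\<Sum>s<M. t s) \<le> G M" for M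
  proof (induction M)
    case (Suc M)
    have "\<delta> * t M \<le> G (Suc M) - G M"
    proof (cases "M \<le> j")
      case True
      have "(J + real M) powr (- 2 * \<delta>) \<le> J powr (- 2 * \<delta>)" using J \<delta> by (intro powr_mono2') auto
      then have "\<delta> * t M \<le> J powr (- 2 * \<delta>) * (\<delta> * (1 + real M) powr (\<delta> - 1))"
        unfolding t_def using \<delta> by (simp add: mult.left_commute mult_right_mono)
      also have "\<dots> \<le> J powr (- 2 * \<delta>) * ((1 + real M) powr \<delta> - real M powr \<delta>)"
        by (intro mult_left_mono powr_increment_ge \<delta>) auto
      finally show ?thesis using True by (simp add: G_def algebra_simps)
    next
      case False
      have eq: "G M = 2 * J powr (- \<delta>) - real M powr (- \<delta>)"
      proof (cases "M = Suc j")
        case True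
        have "J powr (- 2 * \<delta>) * J powr \<delta> = J powr (- \<delta>)" by (simp add: powr_add[symmetric])
        then show ?thesis using True by (simp add: G_def J_def add.commute)
      next
        case False
        with \<open>\<not> M \<le> j\<close> show ?thesis by (simp add: G_def)
      qed
      have "(J + real M) powr (- 2 * \<delta>) \<le> (1 + real M) powr (- 2 * \<delta>)" using J \<delta> by (intro powr_mono2') auto
      then have "\<delta> * t M \<le> \<delta> * ((1 + real M) powr (- 2 * \<delta>) * (1 + real M) powr (\<delta> - 1))"
        unfolding t_def using \<delta> by (intro mult_left_mono mult_right_mono) auto
      also have "\<dots> = \<delta> * (1 + real M) powr (- \<delta> - 1)" by (simp add: powr_add[symmetric])
      also have "\<dots> \<le> real M powr (- \<delta>) - (1 + real M) powr (- \<delta>)"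
        using False by (intro powr_decrement_ge \<delta>) auto
      also have "\<dots> = G (Suc M) - G M" unfolding eq using False by (simp add: G_def add.commute)
      finally show ?thesis .
    qed
    then show ?case using Suc.IH by (simp add: distrib_left)
  qed (simp add: G_def)
  have G_le: "G M \<le> 2 * J powr (- \<delta>)" for M
  proof (cases "M \<le> Suc j")
    case True
    then have "real M powr \<delta> \<le> J powr \<delta>" using \<delta> by (intro powr_mono2) (auto simp: J_def)
    then have "J powr (- 2 * \<delta>) * real M powr \<delta> \<le> J powr (- 2 * \<delta>) * J powr \<delta>" by (intro mult_left_mono) auto
    also have "\<dots> = J powr (- \<delta>)" by (simp add: powr_add[symmetric])
    also have "\<dots> \<le> 2 * J powr (- \<delta>)" by simp
    finally show ?thesis using True by (simp add: G_def)
  qed (simp add: G_def)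
  have "(\<Sum>s<M. ennreal (t s)) \<le> ennreal (2 / \<delta> * J powr (- \<delta>))" for M
  proof -
    have "(\<Sum>s<M. t s) \<le> 2 / \<delta> * J powr (- \<delta>)"
      using order_trans[OF partial[of M] G_le[of M]] \<delta> by (simp add: field_simps)
    moreover have "(\<Sum>s<M. ennreal (t s)) = ennreal (\<Sum>s<M. t s)" by (simp add: t_def sum_ennreal)
    ultimately show ?thesis by (simp add: ennreal_leI)
  qed
  then have "(\<Sum>s. ennreal (t s)) \<le> ennreal (2 / \<delta> * J powr (- \<delta>))"
    by (intro suminf_le_const) auto
  then show ?thesis by (simp add: t_def J_def)
qed

text \<open>Every \<open>f m\<close> is split evenly over the shifts \<open>s \<le> m\<close>. Shifting the argument by \<open>s\<close> moves the
  row index up by \<open>s\<close>, where the weight \<open>(1 + n)^\<alpha>\<close> is larger.\<close>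

lemma hank_average:
  assumes P: "ps_conv 1 P" and f: "geo f"
  shows "hank P f j = (\<Sum>s. hank P (\<lambda>m. (1 / (1 + real (m + s))) *\<^sub>R f (m + s)) (j + s))"
proof -
  define A where "A s m = (1 / (1 + real (m + s))) *\<^sub>R cblinfun_apply (P (m + s + j)) (f (m + s))" for s m
  have "summable (\<lambda>k. \<Sum>s\<le>k. norm (A s (k - s)))"
  proof -
    have "(\<Sum>s\<le>k. norm (A s (k - s))) = norm (cblinfun_apply (P (k + j)) (f k))" for k
      by (simp add: A_def)
    then show ?thesis using hank_summable[OF P f] by simp
  qed
  from suminf_triangle(2)[OF this]
  have "(\<Sum>s. \<Sum>m. A s m) = (\<Sum>k. \<Sum>s\<le>k. A s (k - s))" .
  moreover have "(\<Sum>s\<le>k. A s (k - s)) = cblinfun_apply (P (k + j)) (f k)" for k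
  proof -
    have "(\<Sum>s\<le>k. A s (k - s)) = (\<Sum>s\<le>k. (1 / (1 + real k)) *\<^sub>R cblinfun_apply (P (k + j)) (f k))"
      by (intro sum.cong) (auto simp: A_def)
    also have "\<dots> = (real (Suc k) * (1 / (1 + real k))) *\<^sub>R cblinfun_apply (P (k + j)) (f k)"
      by (simp only: sum_constant_scaleR scaleR_scaleR card_atMost)
    also have "real (Suc k) * (1 / (1 + real k)) = 1" by simp
    finally show ?thesis by simp
  qed
  moreover have "(\<Sum>m. A s m) = hank P (\<lambda>m. (1 / (1 + real (m + s))) *\<^sub>R f (m + s)) (j + s)" for s
    by (simp add: A_def hank_def cblinfun_apply_simps add_ac)
  ultimately show ?thesis by (simp add: hank_def)
qed

lemma ennreal_suminf_shift_le: "(\<Sum>j. g (j + s)) \<le> (\<Sum>j. g j :: ennreal)"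
proof -
  have "(\<Sum>j. g j) = (\<Sum>j. g (j + s)) + (\<Sum>j<s. g j)" by (rule suminf_offset) simp
  then show ?thesis by simp
qed

lemma powr_square: "(x powr y)\<^sup>2 = (x::real) powr (2 * y)"
  by (simp add: power2_eq_square powr_add[symmetric])

text \<open>Weighted Cauchy-Schwarz applied to the average over shifts. In row j + s boundedness
  provides the extra factor (1 + j + s)^(-\<alpha>), whose decay in \<open>s\<close> makes the sum
  over all shifts affordable; on the other side the factor 1 / (1 + m + s) in \<open>h s\<close>
  leaves a negative power as weight on \<open>f\<close>.\<close>

lemma hank_decay:
  fixes P :: "nat \<Rightarrow> ('h::complex_hilbert_space, 'h) cblinfun"
  assumes P: "ps_conv 1 P" and N: "hankel_bounded \<alpha> P N TYPE('h)" and f: "geo f"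
    and \<delta>: "0 < \<delta>" "\<delta> \<le> 1" "\<delta> \<le> \<alpha>"
  shows "(\<Sum>j. ennreal ((1 + real j) powr (2 * \<alpha> - \<delta>) * (norm (hank P f j))\<^sup>2))
    \<le> ennreal (2 * N / \<delta>) * (\<Sum>m. ennreal ((1 + real m) powr (- \<delta>) * (norm (f m))\<^sup>2))"
proof -
  have N0: "0 \<le> N" using N by (simp add: hankel_bounded_def)
  let ?F = "\<Sum>k. ennreal ((1 + real k) powr (- \<delta>) * (norm (f k))\<^sup>2)"
  let ?w = "\<lambda>s. (1 + real s) powr (1 - \<delta>)"
  define h where "h s m = (1 / (1 + real (m + s))) *\<^sub>R f (m + s)" for s m
  have geo_h: "geo (h s)" for s
    by (rule geo_le[OF geo_shift[OF f, of s], where K = 1]) (simp add: h_def field_simps mult_left_le_one_le)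
  define a where "a s n = (1 + real n) powr \<alpha> * norm (hank P (h s) n)" for s n
  have a_sum: "(\<Sum>n. ennreal ((a s n)\<^sup>2)) \<le> ennreal N * sq_sum (h s)" for s
    using N geo_h unfolding hankel_bounded_def a_def by blast
  have step: "ennreal ((1 + real j) powr (2 * \<alpha> - \<delta>) * (norm (hank P f j))\<^sup>2)
      \<le> ennreal (2 / \<delta>) * (\<Sum>s. ennreal (?w s * (a s (j + s))\<^sup>2))" for j
  proof -
    define J where "J = 1 + real j"
    have J: "J \<ge> 1" by (simp add: J_def)
    \<comment> \<open>The powers (1 + s)^((\<delta>-1)/2) and (1 + s)^((1-\<delta>)/2) cancel in the
      product of \<open>u\<close> and \<open>v\<close>. They are chosen so that the squares of
      \<open>u\<close> lead to the sum in \<open>weight_sum_le\<close>.\<close>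
    define u where "u s = (J + real s) powr (- \<alpha>) * (1 + real s) powr ((\<delta> - 1) / 2)" for s
    define v where "v s = (1 + real s) powr ((1 - \<delta>) / 2) * a s (j + s)" for s
    have uv: "norm (hank P (h s) (j + s)) = u s * v s" for s
    proof -
      have "(J + real s) powr (- \<alpha>) * (J + real s) powr \<alpha> = 1" using J by (simp add: powr_add[symmetric])
      moreover have "(1 + real s) powr ((\<delta> - 1) / 2) * (1 + real s) powr ((1 - \<delta>) / 2) = 1"
        by (simp add: powr_add[symmetric] diff_divide_distrib)
      moreover have "a s (j + s) = (J + real s) powr \<alpha> * norm (hank P (h s) (j + s))" by (simp add: a_def J_def add.assoc)
      ultimately show ?thesis unfolding u_def v_def by (simp add: mult_ac)
    qed
    have u2: "(u s)\<^sup>2 \<le> J powr (- 2 * \<alpha> + 2 * \<delta>) * ((J + real s) powr (- 2 * \<delta>) * (1 + real s) powr (\<delta> - 1))" for s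
    proof -
      have "(u s)\<^sup>2 = (J + real s) powr (- 2 * \<alpha>) * (1 + real s) powr (\<delta> - 1)"
        
      proof -
        have "2 * (- \<alpha>) = - 2 * \<alpha>" "2 * ((\<delta> - 1) / 2) = \<delta> - 1" by simp_all
        then show ?thesis by (simp only: u_def power_mult_distrib powr_square)
      qed
      also have "(J + real s) powr (- 2 * \<alpha>) = (J + real s) powr (- 2 * \<alpha> + 2 * \<delta>) * (J + real s) powr (- 2 * \<delta>)"
        by (simp add: powr_add[symmetric])
      \<comment> \<open>Here \<delta> \<le> \<alpha> enters: the exponent -2\<alpha> + 2\<delta> is
        at most 0, so \<open>J + real s\<close> may be replaced by \<open>J\<close>.\<close>
      also have "\<dots> \<le> J powr (- 2 * \<alpha> + 2 * \<delta>) * (J + real s) powr (- 2 * \<delta>)"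
        using J \<delta> by (intro mult_right_mono powr_mono2') auto
      finally show ?thesis by (simp add: mult.assoc mult_right_mono)
    qed
    have "(ennreal (norm (hank P f j)))\<^sup>2 \<le> (\<Sum>s. ennreal (norm (hank P (h s) (j + s))))\<^sup>2"
      unfolding hank_average[OF P f, of j] h_def by (intro power_mono ennreal_norm_suminf_le) simp
    also have "\<dots> = (\<Sum>s. ennreal (u s) * ennreal (v s))\<^sup>2"
      unfolding uv by (subst ennreal_mult'') (auto simp: v_def a_def)
    also have "\<dots> \<le> (\<Sum>s. (ennreal (u s))\<^sup>2) * (\<Sum>s. (ennreal (v s))\<^sup>2)" by (rule ennreal_suminf_Cauchy_Schwarz)
    also have "\<dots> \<le> ennreal (2 / \<delta> * J powr (- 2 * \<alpha> + \<delta>)) * (\<Sum>s. (ennreal (v s))\<^sup>2)"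
    proof (rule mult_right_mono)
      have "(\<Sum>s. (ennreal (u s))\<^sup>2) \<le> (\<Sum>s. ennreal (J powr (- 2 * \<alpha> + 2 * \<delta>)) * ennreal ((J + real s) powr (- 2 * \<delta>) * (1 + real s) powr (\<delta> - 1)))"
        by (intro suminf_le) (use u2 in \<open>auto simp: ennreal_power u_def ennreal_mult[symmetric] ennreal_leI\<close>)
      also have "\<dots> \<le> ennreal (J powr (- 2 * \<alpha> + 2 * \<delta>)) * ennreal (2 / \<delta> * J powr (- \<delta>))"
        unfolding ennreal_suminf_cmult using weight_sum_le[OF \<delta>(1,2), of j] by (intro mult_left_mono) (simp_all add: J_def)
      also have "\<dots> = ennreal (2 / \<delta> * J powr (- 2 * \<alpha> + \<delta>))"
      proof -
        have "J powr (- 2 * \<alpha> + 2 * \<delta>) * J powr (- \<delta>) = J powr (- 2 * \<alpha> + \<delta>)" by (simp add: powr_add[symmetric])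
        then show ?thesis using \<delta> by (simp add: ennreal_mult[symmetric] mult.left_commute)
      qed
      finally show "(\<Sum>s. (ennreal (u s))\<^sup>2) \<le> ennreal (2 / \<delta> * J powr (- 2 * \<alpha> + \<delta>))" .
    qed simp
    finally have *: "nsq (hank P f j) \<le> ennreal (2 / \<delta> * J powr (- 2 * \<alpha> + \<delta>)) * (\<Sum>s. (ennreal (v s))\<^sup>2)"
      by (simp add: ennreal_power)
    have "ennreal (J powr (2 * \<alpha> - \<delta>) * (norm (hank P f j))\<^sup>2) = ennreal (J powr (2 * \<alpha> - \<delta>)) * nsq (hank P f j)"
      by (simp add: ennreal_mult)
    also have "\<dots> \<le> ennreal (J powr (2 * \<alpha> - \<delta>)) * (ennreal (2 / \<delta> * J powr (- 2 * \<alpha> + \<delta>)) * (\<Sum>s. (ennreal (v s))\<^sup>2))"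
      by (intro mult_left_mono *) simp
    also have "\<dots> = ennreal (J powr (2 * \<alpha> - \<delta>) * (2 / \<delta> * J powr (- 2 * \<alpha> + \<delta>))) * (\<Sum>s. (ennreal (v s))\<^sup>2)"
    proof -
      have "ennreal (J powr (2 * \<alpha> - \<delta>) * (2 / \<delta> * J powr (- 2 * \<alpha> + \<delta>)))
          = ennreal (J powr (2 * \<alpha> - \<delta>)) * ennreal (2 / \<delta> * J powr (- 2 * \<alpha> + \<delta>))"
        by (rule ennreal_mult) (use \<delta> in auto)
      then show ?thesis by (simp only: mult.assoc)
    qed
    also have "J powr (2 * \<alpha> - \<delta>) * (2 / \<delta> * J powr (- 2 * \<alpha> + \<delta>)) = 2 / \<delta>"
    proof -
      have "J powr (2 * \<alpha> - \<delta>) * J powr (- 2 * \<alpha> + \<delta>) = 1" using J by (simp add: powr_add[symmetric])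
      then show ?thesis by (simp add: mult.left_commute)
    qed
    also have "(\<Sum>s. (ennreal (v s))\<^sup>2) = (\<Sum>s. ennreal (?w s * (a s (j + s))\<^sup>2))"
    proof (rule suminf_cong)
      fix s
      have "2 * ((1 - \<delta>) / 2) = 1 - \<delta>" by simp
      then have "(v s)\<^sup>2 = ?w s * (a s (j + s))\<^sup>2"
        by (simp only: v_def power_mult_distrib powr_square)
      moreover have "0 \<le> v s" by (simp add: v_def a_def)
      ultimately show "(ennreal (v s))\<^sup>2 = ennreal (?w s * (a s (j + s))\<^sup>2)"
        by (simp add: ennreal_power)
    qed
    finally show ?thesis by (simp add: J_def)
  qed
  have "(\<Sum>j. ennreal ((1 + real j) powr (2 * \<alpha> - \<delta>) * (norm (hank P f j))\<^sup>2))
      \<le> (\<Sum>j. ennreal (2 / \<delta>) * (\<Sum>s. ennreal (?w s * (a s (j + s))\<^sup>2)))"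
    by (intro suminf_le step) auto
  also have "\<dots> = ennreal (2 / \<delta>) * (\<Sum>s. \<Sum>j. ennreal (?w s) * ennreal ((a s (j + s))\<^sup>2))"
    by (subst ennreal_suminf_cmult, subst ennreal_suminf_swap) (simp add: ennreal_mult)
  also have "\<dots> \<le> ennreal (2 / \<delta>) * (\<Sum>s. ennreal (?w s) * (ennreal N * sq_sum (h s)))"
  proof (intro mult_left_mono suminf_le)
    fix s
    show "(\<Sum>j. ennreal (?w s) * ennreal ((a s (j + s))\<^sup>2))
        \<le> ennreal (?w s) * (ennreal N * sq_sum (h s))"
      unfolding ennreal_suminf_cmult
      by (intro mult_left_mono order_trans[OF ennreal_suminf_shift_le a_sum]) simp
  qed auto
  also have "\<dots> = ennreal (2 / \<delta>) * (ennreal N * (\<Sum>s. \<Sum>m. ennreal (?w s) * nsq (h s m)))"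
    by (simp only: mult.left_commute[of _ "ennreal N"] ennreal_suminf_cmult)
  also have "(\<Sum>s. \<Sum>m. ennreal (?w s) * nsq (h s m))
      = (\<Sum>k. \<Sum>s\<le>k. ennreal (?w s) * nsq (h s (k - s)))"
    by (rule ennreal_suminf_triangle)
  also have "ennreal (2 / \<delta>) * (ennreal N * \<dots>) \<le> ennreal (2 / \<delta>) * (ennreal N * ?F)"
  proof (intro mult_left_mono suminf_le)
    fix k
    define K where "K = 1 + real k"
    have K: "K \<ge> 1" by (simp add: K_def)
    have "(\<Sum>s\<le>k. ennreal (?w s) * nsq (h s (k - s)))
        \<le> (\<Sum>s\<le>k. ennreal (K powr (1 - \<delta>) * (norm (f k) / K)\<^sup>2))"
    proof (rule sum_mono)
      fix s assume s: "s \<in> {..k}"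
      have "?w s \<le> K powr (1 - \<delta>)" using s \<delta> by (intro powr_mono2) (auto simp: K_def)
      moreover have "norm (h s (k - s)) = norm (f k) / K" using s by (simp add: h_def K_def)
      ultimately show "ennreal (?w s) * nsq (h s (k - s)) \<le> ennreal (K powr (1 - \<delta>) * (norm (f k) / K)\<^sup>2)"
        by (subst ennreal_mult[symmetric]) (auto intro!: ennreal_leI mult_right_mono)
    qed
    also have "\<dots> = ennreal (\<Sum>s\<le>k. K powr (1 - \<delta>) * (norm (f k) / K)\<^sup>2)"
      by (rule sum_ennreal) simp
    \<comment> \<open>There are \<open>K\<close> equal terms, and K * K^(1-\<delta>) / K^2 =
      K^(-\<delta>).\<close>
    also have "(\<Sum>s\<le>k. K powr (1 - \<delta>) * (norm (f k) / K)\<^sup>2) = K powr (- \<delta>) * (norm (f k))\<^sup>2"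
    proof -
      have "K powr (1 - \<delta>) = K * K powr (- \<delta>)" using K by (simp add: powr_diff powr_minus_divide)
      moreover have "real (card {..k}) = K" by (simp add: K_def)
      ultimately show ?thesis using K by (simp add: power2_eq_square power_divide field_simps)
    qed
    finally show "(\<Sum>s\<le>k. ennreal (?w s) * nsq (h s (k - s)))
        \<le> ennreal ((1 + real k) powr (- \<delta>) * (norm (f k))\<^sup>2)" by (simp add: K_def)
  qed auto
  also have "\<dots> = ennreal (2 * N / \<delta>) * ?F"
    using N0 \<delta> by (simp add: mult.assoc[symmetric] ennreal_mult[symmetric])
  finally show ?thesis .
qed

section \<open>Means over circles\<close>

lemma circle_mean_psum:
  fixes X :: "nat \<Rightarrow> 'h::complex_hilbert_space"
  assumes X: "ps_conv 1 X" and z: "norm z < 1"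
  shows "(\<integral>\<^sup>+t\<in>{0..1}. nsq (psum X (cis (2 * pi * t) * z)) \<partial>lborel)
    = (\<Sum>k. ennreal (((norm z)\<^sup>2) ^ k * (norm (X k))\<^sup>2))"
proof -
  have eq: "psum X (cis (2 * pi * t) * z) = (\<Sum>k. cis (2 * pi * of_int (int k) * t) *\<^sub>C z ^ k *\<^sub>C X k)" for t
    unfolding psum_def by (intro suminf_cong) (simp add: power_mult_distrib scaleC_scaleC Complex.DeMoivre mult_ac)
  have norm_eq: "(norm (z ^ k *\<^sub>C X k))\<^sup>2 = ((norm z)\<^sup>2) ^ k * (norm (X k))\<^sup>2" for k
    by (simp add: norm_scaleC norm_power power_mult_distrib power_mult[symmetric] mult.commute)
  show ?thesis
    unfolding eq norm_eq[symmetric]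
    by (rule circle_parseval[OF _ ps_conv_summable_norm[OF X z], of int]) simp
qed

lemma circle_mean_psum_cnj:
  fixes X :: "nat \<Rightarrow> 'h::complex_hilbert_space"
  assumes X: "ps_conv 1 X" and z: "norm z < 1"
  shows "(\<integral>\<^sup>+t\<in>{0..1}. nsq (psum X (cnj (cis (2 * pi * t) * z))) \<partial>lborel)
    = (\<Sum>k. ennreal (((norm z)\<^sup>2) ^ k * (norm (X k))\<^sup>2))"
proof -
  have eq: "psum X (cnj (cis (2 * pi * t) * z)) = (\<Sum>k. cis (2 * pi * of_int (- int k) * t) *\<^sub>C cnj z ^ k *\<^sub>C X k)" for t
    unfolding psum_def by (intro suminf_cong) (simp add: power_mult_distrib scaleC_scaleC Complex.DeMoivre cis_cnj mult_ac)
  have norm_eq: "((norm z)\<^sup>2) ^ k * (norm (X k))\<^sup>2 = (norm (cnj z ^ k *\<^sub>C X k))\<^sup>2" for k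
    by (simp add: norm_scaleC norm_power power_mult_distrib power_mult[symmetric] mult.commute)
  have "inj (\<lambda>k. - int k)" by (simp add: inj_on_def)
  moreover have "summable (\<lambda>k. norm (cnj z ^ k *\<^sub>C X k))"
    using ps_conv_summable_norm[OF X, of "cnj z"] z by simp
  ultimately show ?thesis
    unfolding eq norm_eq by (rule circle_parseval)
qed

text \<open>The coefficients of \<open>f(w) - f(cnj z)\<close> as a function of \<open>w\<close>.\<close>

definition recentre :: "(nat \<Rightarrow> 'h) \<Rightarrow> complex \<Rightarrow> nat \<Rightarrow> 'h::complex_normed_vector"
  where "recentre f z m = f m - (if m = 0 then psum f (cnj z) else 0)"

lemma geo_recentre: "geo f \<Longrightarrow> geo (recentre f z)"
  unfolding recentre_def by (rule geo_minus) (auto intro: geo_finite[of 0])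

lemma kernel_mult_recentre:
  "kernel_mult z (recentre f z) p = (\<Sum>i\<le>p. z ^ i *\<^sub>C f (p - i)) - z ^ p *\<^sub>C psum f (cnj z)"
proof -
  have "kernel_mult z (recentre f z) p = (\<Sum>i\<le>p. z ^ i *\<^sub>C f (p - i)) - (\<Sum>i\<le>p. z ^ i *\<^sub>C (if p - i = 0 then psum f (cnj z) else 0))"
    by (simp add: kernel_mult_def recentre_def scaleC_diff_right sum_subtractf)
  also have "(\<Sum>i\<le>p. z ^ i *\<^sub>C (if p - i = 0 then psum f (cnj z) else 0)) = (\<Sum>i\<in>{p}. z ^ i *\<^sub>C psum f (cnj z))"
    by (intro sum.mono_neutral_cong_right) auto
  finally show ?thesis by simp
qed

text \<open>The value is explained by monomials: for f(w) = w^m and |w| = 1 the numbers 1 - z w and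
  w - cnj z have equal modulus, so |w^m - (cnj z)^m| / |1 - z w| is the modulus of a polynomial
  quotient with mean square 1 + u + ... + u^(m-1). Rotating \<open>z\<close> decouples different
  \<open>m\<close>. The factor is at most \<open>m\<close>, whereas without recentring it would be 1
  / (1 - u).\<close>

lemma circle_mean_kernel_mult_recentre:
  fixes f :: "nat \<Rightarrow> 'h::complex_hilbert_space"
  assumes f: "geo f" and z: "norm z < 1"
  shows "(\<integral>\<^sup>+t\<in>{0..1}. (\<Sum>p. nsq (kernel_mult (cis (2 * pi * t) * z) (recentre f (cis (2 * pi * t) * z)) p)) \<partial>lborel)
    = (\<Sum>m. ennreal ((1 - ((norm z)\<^sup>2) ^ m) / (1 - (norm z)\<^sup>2) * (norm (f m))\<^sup>2))"
proof -
  define u where "u = (norm z)\<^sup>2"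
  have u: "0 \<le> u" "u < 1" using z by (auto simp: u_def abs_square_less_1)
  let ?e = "\<lambda>t. cis (2 * pi * t) * z"
  let ?S = "\<lambda>t p. kernel_mult (?e t) (recentre f (?e t)) p"
  let ?c = "\<lambda>p m t. cis (2 * pi * of_int (int p - int m) * t)"
  \<comment> \<open>\<open>k p m\<close> is the coefficient with which \<open>f m\<close> enters
    entry \<open>p\<close> at the angle t = 0. At angle \<open>t\<close> it acquires the frequency p
    - m, and for fixed \<open>p\<close> these frequencies are distinct, so Parseval applies to each
    \<open>p\<close> separately.\<close>
  define k where "k p m = (if m \<le> p then z ^ (p - m) else 0) - z ^ p * cnj z ^ m" for p m
  have pc: "ps_conv 1 f" using geo_ps_conv[OF f] .
  have zz: "z * cnj z = of_real u" unfolding u_def by (rule complex_norm_square[symmetric])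
  have k_norm: "(norm (k p m))\<^sup>2 = (if m \<le> p then u ^ (p - m) * (1 - u ^ m)\<^sup>2 else u ^ p * u ^ m)" for p m
  proof (cases "m \<le> p")
    case True
    have "z ^ p * cnj z ^ m = z ^ (p - m) * of_real (u ^ m)"
    proof -
      have "z ^ p = z ^ (p - m) * z ^ m" using True by (simp add: power_add[symmetric])
      then have "z ^ p * cnj z ^ m = z ^ (p - m) * (z * cnj z) ^ m" by (simp add: power_mult_distrib mult.assoc)
      then show ?thesis by (simp add: zz)
    qed
    then have "k p m = z ^ (p - m) * of_real (1 - u ^ m)" using True by (simp add: k_def algebra_simps)
    then have "(norm (k p m))\<^sup>2 = (norm z ^ (p - m))\<^sup>2 * (1 - u ^ m)\<^sup>2"
      by (simp only: norm_mult norm_power norm_of_real power_mult_distrib power2_abs)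
    then show ?thesis using True by (simp add: u_def power_mult[symmetric] mult.commute)
  next
    case False
    then show ?thesis by (simp add: k_def norm_mult norm_power power_mult_distrib u_def power_mult[symmetric] mult.commute)
  qed
  have S_eq: "?S t p = (\<Sum>m. ?c p m t *\<^sub>C k p m *\<^sub>C f m)" for t p
  proof -
    have e: "norm (?e t) < 1" using z by (simp add: norm_mult)
    have "(\<Sum>i\<le>p. ?e t ^ i *\<^sub>C f (p - i)) = (\<Sum>m\<le>p. ?e t ^ (p - m) *\<^sub>C f m)"
      by (rule sum.reindex_bij_witness[where i = "\<lambda>m. p - m" and j = "\<lambda>i. p - i"]) auto
    also have "\<dots> = (\<Sum>m. (if m \<le> p then ?e t ^ (p - m) else 0) *\<^sub>C f m)"
      by (subst suminf_finite[of "{..p}"]) auto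
    finally have 1: "(\<lambda>m. (if m \<le> p then ?e t ^ (p - m) else 0) *\<^sub>C f m) sums (\<Sum>i\<le>p. ?e t ^ i *\<^sub>C f (p - i))"
      using sums_finite[of "{..p}" "\<lambda>m. (if m \<le> p then ?e t ^ (p - m) else 0) *\<^sub>C f m"] by (simp add: sums_iff)
    have "(\<lambda>m. cnj (?e t) ^ m *\<^sub>C f m) sums psum f (cnj (?e t))"
      by (rule psum_sums[OF pc]) (use e in \<open>simp only: complex_mod_cnj\<close>)
    from bounded_linear.sums[OF bounded_linear_scaleC_right this, of "?e t ^ p"]
    have "(\<lambda>m. (if m \<le> p then ?e t ^ (p - m) else 0) *\<^sub>C f m - ?e t ^ p *\<^sub>C cnj (?e t) ^ m *\<^sub>C f m) sums ?S t p"
      unfolding kernel_mult_recentre by (rule sums_diff[OF 1])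
    moreover have "(if m \<le> p then ?e t ^ (p - m) else 0) *\<^sub>C f m - ?e t ^ p *\<^sub>C cnj (?e t) ^ m *\<^sub>C f m
        = ?c p m t *\<^sub>C k p m *\<^sub>C f m" for m
    proof -
      have c: "cis (2 * pi * t) ^ p * cnj (cis (2 * pi * t)) ^ m = ?c p m t"
        by (simp add: cis_cnj Complex.DeMoivre cis_mult algebra_simps)
      have d: "cis (2 * pi * t) ^ (p - m) = ?c p m t" if "m \<le> p"
        using that by (simp add: Complex.DeMoivre of_nat_diff mult_ac)
      have "?e t ^ p * cnj (?e t) ^ m = ?c p m t * (z ^ p * cnj z ^ m)"
        unfolding c[symmetric] by (simp add: power_mult_distrib mult_ac)
      moreover have "(if m \<le> p then ?e t ^ (p - m) else 0) = ?c p m t * (if m \<le> p then z ^ (p - m) else 0)"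
        by (auto simp: power_mult_distrib d)
      ultimately show ?thesis
        by (simp only: scaleC_scaleC scaleC.diff_left[symmetric] k_def right_diff_distrib)
    qed
    ultimately show ?thesis by (simp add: sums_iff)
  qed
  have meas: "(\<lambda>t. nsq (?S t p) * indicator {0..1} t) \<in> borel_measurable lborel" for p
  proof -
    have "continuous_on UNIV (\<lambda>t. psum f (cnj (?e t)))"
      by (rule continuous_on_compose2[OF continuous_on_psum[OF pc]])
        (use z in \<open>auto simp: norm_mult cis_conv_exp intro!: continuous_intros\<close>)
    then have "continuous_on UNIV (\<lambda>t. (norm (?S t p))\<^sup>2)"
      unfolding kernel_mult_recentre cis_conv_exp by (intro continuous_intros)
    then have "(\<lambda>t. (norm (?S t p))\<^sup>2) \<in> borel_measurable borel" by (rule borel_measurable_continuous_onI)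
    then show ?thesis by measurable
  qed
  have mean: "(\<integral>\<^sup>+t. nsq (?S t p) * indicator {0..1} t \<partial>lborel) = (\<Sum>m. ennreal ((norm (k p m))\<^sup>2 * (norm (f m))\<^sup>2))" for p
  proof -
    have "summable (\<lambda>m. norm (k p m *\<^sub>C f m))"
    proof (rule summable_comparison_test'[OF summable_mult[OF geo_summable_norm[OF f], of 2]])
      fix m
      have "norm (k p m) \<le> norm (if m \<le> p then z ^ (p - m) else 0) + norm (z ^ p * cnj z ^ m)"
        unfolding k_def by (rule norm_triangle_ineq4)
      also have "\<dots> \<le> 1 + 1 * 1" using z unfolding norm_mult
        by (intro add_mono mult_mono) (auto simp: norm_power power_le_one)
      finally show "norm (norm (k p m *\<^sub>C f m)) \<le> 2 * norm (f m)" by (simp add: norm_scaleC mult_right_mono)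
    qed
    moreover have "inj (\<lambda>m. int p - int m)" by (simp add: inj_on_def)
    ultimately show ?thesis unfolding S_eq
      by (subst circle_parseval) (simp_all add: norm_scaleC power_mult_distrib)
  qed
  have k_sum: "(\<Sum>p. nsq (k p m)) = ennreal ((1 - u ^ m) / (1 - u))" for m
  proof -
    have "(\<Sum>p. nsq (k p m)) = (\<Sum>p. nsq (k (p + m) m)) + (\<Sum>p<m. nsq (k p m))"
      by (rule suminf_offset) simp
    also have "(\<Sum>p. nsq (k (p + m) m)) = ennreal ((1 - u ^ m)\<^sup>2 * (1 / (1 - u)))"
    proof -
      have "(\<lambda>p. (1 - u ^ m)\<^sup>2 * u ^ p) sums ((1 - u ^ m)\<^sup>2 * (1 / (1 - u)))" using u by (intro sums_mult geometric_sums) auto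
      moreover have "(norm (k (p + m) m))\<^sup>2 = (1 - u ^ m)\<^sup>2 * u ^ p" for p by (simp add: k_norm)
      ultimately show ?thesis by (simp only:) (rule suminf_ennreal_eq, use u in auto)
    qed
    also have "(\<Sum>p<m. nsq (k p m)) = ennreal (u ^ m * ((1 - u ^ m) / (1 - u)))"
    proof -
      have "(\<Sum>p<m. nsq (k p m)) = ennreal (\<Sum>p<m. (norm (k p m))\<^sup>2)" by (rule sum_ennreal) simp
      also have "(\<Sum>p<m. (norm (k p m))\<^sup>2) = u ^ m * (\<Sum>p<m. u ^ p)"
        unfolding sum_distrib_left by (intro sum.cong) (auto simp: k_norm)
      also have "(\<Sum>p<m. u ^ p) = (1 - u ^ m) / (1 - u)" using u by (simp add: sum_gp_strict)
      finally show ?thesis .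
    qed
    also have "ennreal ((1 - u ^ m)\<^sup>2 * (1 / (1 - u))) + ennreal (u ^ m * ((1 - u ^ m) / (1 - u)))
        = ennreal ((1 - u ^ m) / (1 - u))"
    proof -
      have v: "0 \<le> u ^ m" "u ^ m \<le> 1" using u by (auto simp: power_le_one)
      have "(1 - u ^ m)\<^sup>2 + u ^ m * (1 - u ^ m) = 1 - u ^ m" by (simp add: power2_eq_square algebra_simps)
      then have "(1 - u ^ m)\<^sup>2 * (1 / (1 - u)) + u ^ m * ((1 - u ^ m) / (1 - u)) = (1 - u ^ m) / (1 - u)"
        by (simp add: add_divide_distrib[symmetric])
      then show ?thesis using u v by (subst ennreal_plus[symmetric]) auto
    qed
    finally show ?thesis .
  qed
  have "(\<integral>\<^sup>+t\<in>{0..1}. sq_sum (?S t) \<partial>lborel)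
      = (\<integral>\<^sup>+t. (\<Sum>p. nsq (?S t p) * indicator {0..1} t) \<partial>lborel)"
    by simp
  also have "\<dots> = (\<Sum>p. \<integral>\<^sup>+t. nsq (?S t p) * indicator {0..1} t \<partial>lborel)"
    by (rule nn_integral_suminf) (rule meas)
  also have "\<dots> = (\<Sum>p. \<Sum>m. nsq (k p m) * nsq (f m))"
    unfolding mean by (simp add: ennreal_mult)
  also have "\<dots> = (\<Sum>m. \<Sum>p. nsq (k p m) * nsq (f m))"
    by (rule ennreal_suminf_swap)
  also have "\<dots> = (\<Sum>m. ennreal ((1 - u ^ m) / (1 - u)) * nsq (f m))"
    unfolding ennreal_suminf_multc k_sum ..
  also have "\<dots> = (\<Sum>m. ennreal ((1 - u ^ m) / (1 - u) * (norm (f m))\<^sup>2))"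
    using u by (intro suminf_cong ennreal_mult[symmetric]) (auto simp: power_le_one)
  finally show ?thesis by (simp add: u_def)
qed

section \<open>Bounded Hankel operators satisfy the Carleson condition\<close>

lemma hank_deriv_single:
  assumes P: "ps_conv 1 P" and z: "norm z < 1"
  shows "hank_deriv \<alpha> P (\<lambda>m. if m = 0 then x else 0) z
    = cblinfun_apply (psum (\<lambda>k. (1 + real k) powr (1 + \<alpha>) *\<^sub>R P k) z) x"
proof -
  have "ps_conv 1 (\<lambda>k. (1 + real k) powr (1 + \<alpha>) *\<^sub>R P k)"
    by (rule ps_conv_weight[OF P, where \<beta> = "1 + \<alpha>"]) simp
  from psum_sums[OF this z]
  have "(\<lambda>k. cblinfun_apply (z ^ k *\<^sub>C (1 + real k) powr (1 + \<alpha>) *\<^sub>R P k) x) sums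
      cblinfun_apply (psum (\<lambda>k. (1 + real k) powr (1 + \<alpha>) *\<^sub>R P k) z) x"
    by (rule bounded_linear.sums[OF bounded_linear_cblinfun_apply_left])
  then show ?thesis
    unfolding hank_deriv_def hank_single psum_def[of "\<lambda>k. (1 + real k) powr (1 + \<alpha>) *\<^sub>R cblinfun_apply (P k) x"]
    by (simp add: cblinfun_apply_simps sums_iff)
qed

lemma ps_conv_hank_deriv:
  assumes "ps_conv 1 P" "geo f"
  shows "ps_conv 1 (\<lambda>k. (1 + real k) powr (1 + \<alpha>) *\<^sub>R hank P f k)"
  by (rule ps_conv_weight[OF ps_conv_hank[OF assms], where \<beta> = "1 + \<alpha>"]) simp

lemma hank_deriv_minus:
  assumes "ps_conv 1 P" "geo f" "geo g" "norm z < 1"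
  shows "hank_deriv \<alpha> P (\<lambda>m. f m - g m) z = hank_deriv \<alpha> P f z - hank_deriv \<alpha> P g z"
  using sums_diff[OF psum_sums[OF ps_conv_hank_deriv[OF assms(1,2)] assms(4)] psum_sums[OF ps_conv_hank_deriv[OF assms(1,3)] assms(4)]]
  unfolding hank_deriv_def psum_def[of "\<lambda>k. (1 + real k) powr (1 + \<alpha>) *\<^sub>R hank P (\<lambda>m. f m - g m) k"]
  by (simp add: hank_minus[OF assms(1-3)] scaleR_diff_right scaleC_diff_right sums_iff)

text \<open>The function \<open>z \<mapsto> (D^(1+\<alpha>) \<phi>)(z) f(cnj z)\<close>.\<close>

definition carl :: "real \<Rightarrow> (nat \<Rightarrow> ('h, 'h) cblinfun) \<Rightarrow> (nat \<Rightarrow> 'h) \<Rightarrow> complex \<Rightarrow> 'h::complex_hilbert_space"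
  where "carl \<alpha> P f z = cblinfun_apply (psum (\<lambda>k. (1 + real k) powr (1 + \<alpha>) *\<^sub>R P k) z) (psum f (cnj z))"

lemma continuous_on_carl:
  fixes f :: "nat \<Rightarrow> 'h::complex_hilbert_space"
  assumes "ps_conv 1 P" "geo f"
  shows "continuous_on (ball 0 1) (carl \<alpha> P f)"
  unfolding carl_def
proof (intro continuous_intros)
  show "continuous_on (ball 0 1) (psum (\<lambda>k. (1 + real k) powr (1 + \<alpha>) *\<^sub>R P k))"
    by (rule continuous_on_psum, rule ps_conv_weight[OF assms(1), where \<beta> = "1 + \<alpha>"]) simp
  show "continuous_on (ball 0 1) (\<lambda>z. psum f (cnj z))"
    by (rule continuous_on_compose2[OF continuous_on_psum[OF geo_ps_conv[OF assms(2)]]])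
      (auto intro!: continuous_intros)
qed

text \<open>Only the low part stays recentred and retains the cancellation between a function and
  its value at \<open>cnj z\<close>; the high part contributes these two terms individually.\<close>

lemma carl_decompose:
  fixes f lo hi :: "nat \<Rightarrow> 'h::complex_hilbert_space"
  assumes P: "ps_conv 1 P" and geo: "geo f" "geo hi" and lo: "lo = (\<lambda>m. f m - hi m)" and z: "norm z < 1"
  shows "carl \<alpha> P f z = hank_deriv \<alpha> P f z - hank_deriv \<alpha> P (recentre lo z) z - hank_deriv \<alpha> P hi z
    + hank_deriv \<alpha> P (\<lambda>m. if m = 0 then psum hi (cnj z) else 0) z"
proof -
  have z': "norm (cnj z) < 1" using z by simp
  have "psum lo (cnj z) = psum f (cnj z) - psum hi (cnj z)"
    using sums_diff[OF psum_sums[OF geo_ps_conv[OF geo(1)] z'] psum_sums[OF geo_ps_conv[OF geo(2)] z']]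
    unfolding psum_def[of lo] by (simp add: lo scaleC_diff_right sums_iff)
  moreover have "hank_deriv \<alpha> P (recentre lo z) z = hank_deriv \<alpha> P lo z - hank_deriv \<alpha> P (\<lambda>m. if m = 0 then psum lo (cnj z) else 0) z"
    unfolding recentre_def by (rule hank_deriv_minus[OF P _ _ z]) (auto simp: lo intro: geo_minus geo geo_finite[of 0])
  moreover have "hank_deriv \<alpha> P lo z = hank_deriv \<alpha> P f z - hank_deriv \<alpha> P hi z" unfolding lo by (rule hank_deriv_minus[OF P geo z])
  ultimately show ?thesis
    unfolding carl_def hank_deriv_single[OF P z] by (simp add: cblinfun_apply_simps)
qed

lemma norm_sum4_le:
  fixes a :: "'a::real_normed_vector"
  shows "(norm (a - b - c + d))\<^sup>2 \<le> 4 * ((norm a)\<^sup>2 + (norm b)\<^sup>2 + (norm c)\<^sup>2 + (norm d)\<^sup>2)"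
proof -
  have "a - b - c + d = (a + (- b)) + ((- c) + d)" by simp
  then have "(norm (a - b - c + d))\<^sup>2 \<le> 2 * (norm (a + (- b)))\<^sup>2 + 2 * (norm ((- c) + d))\<^sup>2"
    by (simp only: norm_add_le_2)
  then show ?thesis using norm_add_le_2[of a "- b"] norm_add_le_2[of "- c" d] by simp
qed

section \<open>Elementary weight bounds and the split by frequency\<close>

lemma one_minus_power_le_exp:
  assumes "0 \<le> u" "u \<le> 1" shows "u ^ k \<le> exp (- (real k * (1 - u)))"
proof -
  have "u \<le> exp (- (1 - u))" using exp_ge_add_one_self[of "- (1 - u)"] by simp
  then have "u ^ k \<le> exp (- (1 - u)) ^ k" using assms(1) by (rule power_mono)
  then show ?thesis by (simp add: exp_of_nat_mult[symmetric] algebra_simps)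
qed

text \<open>With y = k (1 - u) one has u^k \<le> exp (-y), and ((1 + k) (1 - u))^(2+\<delta>) \<le>
  (1 + y)^3 as \<delta> \<le> 1. The constant 27 = 3^3 comes from (1 + y/3)^3 \<le> exp y.\<close>

lemma weight_power_le:
  assumes u: "0 \<le> u" "u < 1" and \<delta>: "0 < \<delta>" "\<delta> \<le> 1"
  shows "(1 + real k) powr (2 + \<delta>) * u ^ k \<le> 27 * (1 - u) powr (- 2 - \<delta>)"
proof -
  define \<tau> where "\<tau> = 1 - u"
  define y where "y = real k * \<tau>"
  have \<tau>: "0 < \<tau>" "\<tau> \<le> 1" using u by (auto simp: \<tau>_def)
  have y: "0 \<le> y" using \<tau> by (simp add: y_def)
  have "(1 + y) ^ 3 \<le> (3 * (1 + y / 3)) ^ 3" using y by (intro power_mono) auto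
  also have "\<dots> = 27 * (1 + y / real 3) ^ 3" by (simp only: power_mult_distrib) simp
  also have "\<dots> \<le> 27 * exp y" using y by (intro mult_left_mono exp_ge_one_plus_x_over_n_power_n) auto
  finally have "(1 + y) ^ 3 * exp (- y) \<le> 27 * exp y * exp (- y)" by (intro mult_right_mono) auto
  then have cube: "(1 + y) ^ 3 * exp (- y) \<le> 27" by (simp add: mult.assoc exp_minus_inverse)
  have "((1 + real k) * \<tau>) powr (2 + \<delta>) \<le> (1 + y) powr (2 + \<delta>)"
    using \<tau> \<delta> by (intro powr_mono2) (auto simp: y_def distrib_right)
  also have "\<dots> \<le> (1 + y) powr 3" using y \<delta> by (intro powr_mono) auto
  also have "\<dots> = (1 + y) ^ 3" using y by (simp add: powr_numeral)
  finally have "((1 + real k) * \<tau>) powr (2 + \<delta>) * u ^ k \<le> (1 + y) ^ 3 * exp (- y)"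
    using one_minus_power_le_exp[of u k] u y by (intro mult_mono) (auto simp: y_def \<tau>_def)
  also note cube
  finally have *: "(1 + real k) powr (2 + \<delta>) * \<tau> powr (2 + \<delta>) * u ^ k \<le> 27"
    using \<tau> by (simp add: powr_mult)
  have inv: "\<tau> powr (- 2 - \<delta>) * \<tau> powr (2 + \<delta>) = 1" using \<tau> by (simp add: powr_add[symmetric])
  have "(1 + real k) powr (2 + \<delta>) * u ^ k
      = (\<tau> powr (- 2 - \<delta>) * \<tau> powr (2 + \<delta>)) * ((1 + real k) powr (2 + \<delta>) * u ^ k)"
    by (simp only: inv mult_1)
  also have "\<dots> = \<tau> powr (- 2 - \<delta>) * ((1 + real k) powr (2 + \<delta>) * \<tau> powr (2 + \<delta>) * u ^ k)"
    by (simp only: mult_ac)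
  also have "\<dots> \<le> \<tau> powr (- 2 - \<delta>) * 27" using * by (intro mult_left_mono) auto
  finally show ?thesis by (simp add: \<tau>_def mult.commute)
qed

text \<open>For y = m (1 - u) > 1 one has exp (-y) \<le> 1/y \<le> y^(-\<delta>). The exponential
  gain is traded for the power occurring in \<open>hank_decay\<close>, so that both high terms share
  one weight.\<close>

lemma power_le_powr_tail:
  assumes u: "0 \<le> u" "u \<le> 1" and \<delta>: "\<delta> \<le> 1" and m: "real m * (1 - u) > 1"
  shows "u ^ m \<le> (real m * (1 - u)) powr (- \<delta>)"
proof -
  define y where "y = real m * (1 - u)"
  have y: "y > 1" using m by (simp add: y_def)
  have "u ^ m \<le> exp (- y)" using one_minus_power_le_exp[OF u] by (simp add: y_def)
  also have "\<dots> \<le> 1 / y"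
  proof -
    have "y \<le> exp y" using exp_ge_add_one_self[of y] by linarith
    then show ?thesis using y by (simp add: exp_minus field_simps)
  qed
  also have "\<dots> = y powr (- 1)" using y by (simp add: powr_minus_divide)
  also have "\<dots> \<le> y powr (- \<delta>)" using y \<delta> by (intro powr_mono) auto
  finally show ?thesis by (simp add: y_def)
qed

lemma kernel_mult_single: "kernel_mult z (\<lambda>m. if m = 0 then x else 0) p = z ^ p *\<^sub>C x"
proof -
  have "kernel_mult z (\<lambda>m. if m = 0 then x else 0) p = (\<Sum>i\<in>{p}. z ^ i *\<^sub>C x)"
    unfolding kernel_mult_def by (intro sum.mono_neutral_cong_right) auto
  then show ?thesis by simp
qed

text \<open>For a constant the kernel is the geometric sequence z^p x, which costs a second factor 1
  / (1 - |z|^2).\<close>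

lemma hank_deriv_single_bound:
  fixes P :: "nat \<Rightarrow> ('h::complex_hilbert_space, 'h) cblinfun"
  assumes P: "ps_conv 1 P" and N: "hankel_bounded \<alpha> P N TYPE('h)" and z: "norm z < 1" and \<alpha>: "\<alpha> > 0"
  shows "nsq (hank_deriv \<alpha> P (\<lambda>m. if m = 0 then x else 0) z)
    \<le> ennreal ((1 + \<alpha>)\<^sup>2 * N / (1 - (norm z)\<^sup>2)\<^sup>2) * nsq x"
proof -
  have N0: "0 \<le> N" using N by (simp add: hankel_bounded_def)
  have u: "(norm z)\<^sup>2 < 1" using z by (simp add: abs_square_less_1)
  have "(\<lambda>p. ((norm z)\<^sup>2) ^ p * (norm x)\<^sup>2) sums (1 / (1 - (norm z)\<^sup>2) * (norm x)\<^sup>2)"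
    using u by (intro sums_mult2 geometric_sums) auto
  moreover have "(norm (kernel_mult z (\<lambda>m. if m = 0 then x else 0) p))\<^sup>2 = ((norm z)\<^sup>2) ^ p * (norm x)\<^sup>2" for p
    by (simp add: kernel_mult_single norm_scaleC norm_power power_mult_distrib power_mult[symmetric] mult.commute)
  ultimately have eq: "(\<Sum>p. nsq (kernel_mult z (\<lambda>m. if m = 0 then x else 0) p)) = ennreal (1 / (1 - (norm z)\<^sup>2) * (norm x)\<^sup>2)"
    by (simp only:) (rule suminf_ennreal_eq, auto)
  have "nsq (hank_deriv \<alpha> P (\<lambda>m. if m = 0 then x else 0) z)
      \<le> ennreal ((1 + \<alpha>)\<^sup>2 * N / (1 - (norm z)\<^sup>2)) * ennreal (1 / (1 - (norm z)\<^sup>2) * (norm x)\<^sup>2)"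
    unfolding eq[symmetric] by (rule hank_deriv_bound[OF P N _ z \<alpha>]) (rule geo_finite[of 0], simp)
  also have "\<dots> = ennreal ((1 + \<alpha>)\<^sup>2 * N / (1 - (norm z)\<^sup>2)\<^sup>2) * nsq x"
    using u N0 by (simp add: ennreal_mult[symmetric] power2_eq_square)
  finally show ?thesis .
qed

text \<open>The cut-off frequency 1 / (1 - u) is the scale up to which 1 - u^m behaves like m (1 -
  u). Written as a product, the condition stays meaningful at u = 1, where every frequency is
  low.\<close>

definition lowp :: "real \<Rightarrow> (nat \<Rightarrow> 'a::zero) \<Rightarrow> nat \<Rightarrow> 'a"
  where "lowp u f m = (if real m * (1 - u) \<le> 1 then f m else 0)"

definition highp :: "real \<Rightarrow> (nat \<Rightarrow> 'a::zero) \<Rightarrow> nat \<Rightarrow> 'a"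
  where "highp u f m = (if real m * (1 - u) \<le> 1 then 0 else f m)"

lemma geo_lowp: "geo f \<Longrightarrow> geo (lowp u f)"
  by (erule geo_le[where K = 1]) (simp add: lowp_def)

lemma geo_highp: "geo f \<Longrightarrow> geo (highp u f)"
  by (erule geo_le[where K = 1]) (simp add: highp_def)

text \<open>The weight of N |f m|^2 in the circle estimate. First branch: one factor 1 / (1 - u)
  from \<open>hank_deriv_bound\<close>, the remaining quotient from the recentred kernel. Second
  branch: 54 / \<delta> is 27 from \<open>weight_power_le\<close> times 2 / \<delta> from
  \<open>hank_decay\<close>, and (1 + \<alpha>)^2 comes from
  \<open>hank_deriv_single_bound\<close>.\<close>

definition cweight :: "real \<Rightarrow> real \<Rightarrow> nat \<Rightarrow> real \<Rightarrow> real"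
  where "cweight \<alpha> \<delta> m u = (if real m * (1 - u) \<le> 1 then (1 + \<alpha>)\<^sup>2 * (1 - u ^ m) / (1 - u)\<^sup>2
    else (54 / \<delta> + (1 + \<alpha>)\<^sup>2) * real m powr (- \<delta>) * (1 - u) powr (- 2 - \<delta>))"

lemma nn_integral_combination:
  assumes [measurable]: "A \<in> borel_measurable M" "B \<in> borel_measurable M" "C \<in> borel_measurable M" "D \<in> borel_measurable M"
  shows "(\<integral>\<^sup>+t. 4 * (A t + b * B t + C t + d * D t) \<partial>M)
    = 4 * ((\<integral>\<^sup>+t. A t \<partial>M) + b * (\<integral>\<^sup>+t. B t \<partial>M) + (\<integral>\<^sup>+t. C t \<partial>M) + d * (\<integral>\<^sup>+t. D t \<partial>M))"
  by (subst nn_integral_cmult) (simp_all add: nn_integral_add nn_integral_cmult)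

text \<open>The cut-off belongs to this circle; as u is constant on it, \<open>lo\<close> and
  \<open>hi\<close> do not depend on the angle and Parseval applies to them. The term of
  \<open>f\<close> itself is kept exactly, to be integrated in the radius; the other three are
  collected in \<open>cweight\<close>.\<close>

lemma circle_mean_carl:
  fixes P :: "nat \<Rightarrow> ('h::complex_hilbert_space, 'h) cblinfun"
  assumes P: "ps_conv 1 P" and N: "hankel_bounded \<alpha> P N TYPE('h)" and f: "geo f" and z: "norm z < 1" and \<alpha>: "\<alpha> > 0"
    and \<delta>: "0 < \<delta>" "\<delta> \<le> 1" "\<delta> \<le> \<alpha>"
  shows "(\<integral>\<^sup>+t\<in>{0..1}. nsq (carl \<alpha> P f (cis (2 * pi * t) * z)) \<partial>lborel)
    \<le> 4 * ((\<Sum>k. ennreal (((norm z)\<^sup>2) ^ k * ((1 + real k) powr (1 + \<alpha>) * norm (hank P f k))\<^sup>2))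
         + (\<Sum>m. ennreal (cweight \<alpha> \<delta> m ((norm z)\<^sup>2)) * ennreal (N * (norm (f m))\<^sup>2)))"
proof -
  have N0: "0 \<le> N" using N by (simp add: hankel_bounded_def)
  define u where "u = (norm z)\<^sup>2"
  define \<tau> where "\<tau> = 1 - u"
  have u: "0 \<le> u" "u < 1" using z by (auto simp: u_def abs_square_less_1)
  then have \<tau>: "0 < \<tau>" "\<tau> \<le> 1" by (auto simp: \<tau>_def)
  define lo where "lo = lowp u f"
  define hi where "hi = highp u f"
  have lo: "geo lo" and hi: "geo hi" using f by (auto simp: lo_def hi_def geo_lowp geo_highp)
  have lo_eq: "lo = (\<lambda>m. f m - hi m)" by (auto simp: lo_def hi_def lowp_def highp_def)
  let ?e = "\<lambda>t. cis (2 * pi * t) * z"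
  have e: "norm (?e t) < 1" "(norm (?e t))\<^sup>2 = u" for t using z by (simp_all add: norm_mult u_def)
  define X where "X g k = (1 + real k) powr (1 + \<alpha>) *\<^sub>R hank P g k" for g k
  have X: "ps_conv 1 (X g)" if "geo g" for g unfolding X_def by (rule ps_conv_hank_deriv[OF P that])
  define c2 where "c2 = (1 + \<alpha>)\<^sup>2 * N / \<tau>"
  define c4 where "c4 = (1 + \<alpha>)\<^sup>2 * N / \<tau>\<^sup>2"
  have c: "0 \<le> c2" "0 \<le> c4" using N0 \<tau> by (auto simp: c2_def c4_def)
  define W where "W t = (\<Sum>p. nsq (kernel_mult (?e t) (recentre lo (?e t)) p))" for t
  have pointwise: "nsq (carl \<alpha> P f (?e t))
      \<le> 4 * (nsq (psum (X f) (?e t)) + ennreal c2 * W t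
        + nsq (psum (X hi) (?e t)) + ennreal c4 * nsq (psum hi (cnj (?e t))))" for t
  proof -
    let ?a = "hank_deriv \<alpha> P f (?e t)" and ?b = "hank_deriv \<alpha> P (recentre lo (?e t)) (?e t)" and ?c = "hank_deriv \<alpha> P hi (?e t)"
      and ?d = "hank_deriv \<alpha> P (\<lambda>m. if m = 0 then psum hi (cnj (?e t)) else 0) (?e t)"
    have "nsq (carl \<alpha> P f (?e t)) \<le> ennreal (4 * ((norm ?a)\<^sup>2 + (norm ?b)\<^sup>2 + (norm ?c)\<^sup>2 + (norm ?d)\<^sup>2))"
      unfolding carl_decompose[OF P f hi lo_eq e(1)] by (intro ennreal_leI norm_sum4_le)
    also have "\<dots> = 4 * (nsq ?a + nsq ?b + nsq ?c + nsq ?d)"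
      by (simp add: ennreal_mult)
    also have "\<dots> \<le> 4 * (nsq ?a + ennreal c2 * W t + nsq ?c + ennreal c4 * nsq (psum hi (cnj (?e t))))"
    proof (intro mult_left_mono add_mono order_refl)
      show "nsq ?b \<le> ennreal c2 * W t"
        using hank_deriv_bound[OF P N geo_recentre[OF lo] e(1) \<alpha>] by (simp only: W_def c2_def e(2) \<tau>_def)
      show "nsq ?d \<le> ennreal c4 * nsq (psum hi (cnj (?e t)))"
        using hank_deriv_single_bound[OF P N e(1) \<alpha>] by (simp only: c4_def e(2) \<tau>_def)
    qed simp
    finally show ?thesis by (simp only: hank_deriv_def X_def[abs_def])
  qed
  have cont_e: "continuous_on UNIV ?e" unfolding cis_conv_exp by (intro continuous_intros)
  have meas_psum: "(\<lambda>t. nsq (psum Y (?e t)) * indicator {0..1} t) \<in> borel_measurable lborel"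
    if "ps_conv 1 Y" for Y :: "nat \<Rightarrow> 'h"
  proof -
    have "continuous_on UNIV (\<lambda>t. psum Y (?e t))"
      by (rule continuous_on_compose2[OF continuous_on_psum[OF that] cont_e]) (use e(1) in auto)
    then have "(\<lambda>t. (norm (psum Y (?e t)))\<^sup>2) \<in> borel_measurable borel"
      by (intro borel_measurable_continuous_onI continuous_intros)
    then show ?thesis by measurable
  qed
  have meas_cnj: "(\<lambda>t. nsq (psum Y (cnj (?e t))) * indicator {0..1} t) \<in> borel_measurable lborel"
    if "ps_conv 1 Y" for Y :: "nat \<Rightarrow> 'h"
  proof -
    have "continuous_on UNIV (\<lambda>t. psum Y (cnj (?e t)))"
      by (rule continuous_on_compose2[OF continuous_on_psum[OF that] continuous_on_cnj[OF cont_e]])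
        (use e(1) in \<open>auto simp only: mem_ball_0 complex_mod_cnj\<close>)
    then have "(\<lambda>t. (norm (psum Y (cnj (?e t))))\<^sup>2) \<in> borel_measurable borel"
      by (intro borel_measurable_continuous_onI continuous_intros)
    then show ?thesis by measurable
  qed
  have meas_W: "(\<lambda>t. W t * indicator {0..1} t) \<in> borel_measurable lborel"
  proof -
    have "continuous_on UNIV (\<lambda>t. psum lo (cnj (?e t)))"
      by (rule continuous_on_compose2[OF continuous_on_psum[OF geo_ps_conv[OF lo]] continuous_on_cnj[OF cont_e]])
        (use e(1) in \<open>auto simp only: mem_ball_0 complex_mod_cnj\<close>)
    then have "continuous_on UNIV (\<lambda>t. (norm (kernel_mult (?e t) (recentre lo (?e t)) p))\<^sup>2)" for p
      unfolding kernel_mult_recentre using cont_e by (intro continuous_intros)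
    then have "(\<lambda>t. (norm (kernel_mult (?e t) (recentre lo (?e t)) p))\<^sup>2) \<in> borel_measurable borel" for p
      by (rule borel_measurable_continuous_onI)
    then show ?thesis unfolding W_def by measurable
  qed
  let ?I = "\<lambda>F. \<integral>\<^sup>+t. F t * indicator {0..1::real} t \<partial>lborel"
  let ?A = "\<Sum>k. ennreal (u ^ k * (norm (X f k))\<^sup>2)"
  let ?L = "\<Sum>m. ennreal ((1 - u ^ m) / \<tau> * (norm (lo m))\<^sup>2)"
  let ?H = "\<Sum>k. ennreal (u ^ k * (norm (X hi k))\<^sup>2)"
  let ?T = "\<Sum>m. ennreal (u ^ m * (norm (hi m))\<^sup>2)"
  let ?D = "\<Sum>m. ennreal ((1 + real m) powr (- \<delta>) * (norm (hi m))\<^sup>2)"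
  let ?R = "\<Sum>m. ennreal (cweight \<alpha> \<delta> m u) * ennreal (N * (norm (f m))\<^sup>2)"
  have "?I (\<lambda>t. nsq (carl \<alpha> P f (?e t)))
      \<le> (\<integral>\<^sup>+t. 4 * (nsq (psum (X f) (?e t)) * indicator {0..1} t + ennreal c2 * (W t * indicator {0..1} t)
        + nsq (psum (X hi) (?e t)) * indicator {0..1} t
        + ennreal c4 * (nsq (psum hi (cnj (?e t))) * indicator {0..1} t)) \<partial>lborel)"
    by (intro nn_integral_mono) (use pointwise in \<open>auto simp: indicator_def\<close>)
  also have "\<dots> = 4 * (?I (\<lambda>t. nsq (psum (X f) (?e t))) + ennreal c2 * ?I W
        + ?I (\<lambda>t. nsq (psum (X hi) (?e t)))
        + ennreal c4 * ?I (\<lambda>t. nsq (psum hi (cnj (?e t)))))"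
    by (rule nn_integral_combination[OF meas_psum[OF X[OF f]] meas_W meas_psum[OF X[OF hi]] meas_cnj[OF geo_ps_conv[OF hi]]])
  also have "?I (\<lambda>t. nsq (psum (X f) (?e t))) = ?A"
    unfolding u_def by (rule circle_mean_psum[OF X[OF f] z])
  also have "?I W = ?L"
    unfolding W_def u_def \<tau>_def by (rule circle_mean_kernel_mult_recentre[OF lo z])
  also have "?I (\<lambda>t. nsq (psum (X hi) (?e t))) = ?H"
    unfolding u_def by (rule circle_mean_psum[OF X[OF hi] z])
  also have "?I (\<lambda>t. nsq (psum hi (cnj (?e t)))) = ?T"
    unfolding u_def by (rule circle_mean_psum_cnj[OF geo_ps_conv[OF hi] z])
  finally have main: "?I (\<lambda>t. nsq (carl \<alpha> P f (?e t)))
      \<le> 4 * (?A + ennreal c2 * ?L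
        + ?H + ennreal c4 * ?T)" .
  define c3 where "c3 = 27 * \<tau> powr (- 2 - \<delta>)"
  have "?H
      \<le> (\<Sum>k. ennreal c3 * ennreal ((1 + real k) powr (2 * \<alpha> - \<delta>) * (norm (hank P hi k))\<^sup>2))"
  proof (rule suminf_le)
    fix k
    have "u ^ k * (norm (X hi k))\<^sup>2 = u ^ k * (((1 + real k) powr (1 + \<alpha>))\<^sup>2 * (norm (hank P hi k))\<^sup>2)"
      by (simp add: X_def power_mult_distrib)
    \<comment> \<open>Of the exponent 2 + 2\<alpha>, the part 2 + \<delta> is absorbed by u^k and
      the part 2\<alpha> - \<delta> is left for \<open>hank_decay\<close>.\<close>
    also have "((1 + real k) powr (1 + \<alpha>))\<^sup>2 = (1 + real k) powr (2 + \<delta>) * (1 + real k) powr (2 * \<alpha> - \<delta>)"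
      by (simp add: powr_square powr_add[symmetric] algebra_simps)
    also have "u ^ k * ((1 + real k) powr (2 + \<delta>) * (1 + real k) powr (2 * \<alpha> - \<delta>) * (norm (hank P hi k))\<^sup>2)
        = ((1 + real k) powr (2 + \<delta>) * u ^ k) * ((1 + real k) powr (2 * \<alpha> - \<delta>) * (norm (hank P hi k))\<^sup>2)"
      by (simp add: mult_ac)
    also have "\<dots> \<le> c3 * ((1 + real k) powr (2 * \<alpha> - \<delta>) * (norm (hank P hi k))\<^sup>2)"
      unfolding c3_def \<tau>_def by (intro mult_right_mono weight_power_le u \<delta>) auto
    finally show "ennreal (u ^ k * (norm (X hi k))\<^sup>2) \<le> ennreal c3 * ennreal ((1 + real k) powr (2 * \<alpha> - \<delta>) * (norm (hank P hi k))\<^sup>2)"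
      by (subst ennreal_mult[symmetric]) (auto simp: c3_def intro: ennreal_leI)
  qed auto
  also have "\<dots> \<le> ennreal c3 * (ennreal (2 * N / \<delta>) * ?D)"
    unfolding ennreal_suminf_cmult by (intro mult_left_mono hank_decay[OF P N hi \<delta>]) simp
  finally have hi3: "?H
      \<le> ennreal c3 * (ennreal (2 * N / \<delta>) * ?D)" .
  \<comment> \<open>At least one of \<open>lo m\<close> and \<open>hi m\<close> vanishes, so every
    \<open>m\<close> meets just one branch of \<open>cweight\<close>.\<close>
  have termwise: "ennreal c2 * ennreal ((1 - u ^ m) / \<tau> * (norm (lo m))\<^sup>2)
      + ennreal c3 * (ennreal (2 * N / \<delta>) * ennreal ((1 + real m) powr (- \<delta>) * (norm (hi m))\<^sup>2))
      + ennreal c4 * ennreal (u ^ m * (norm (hi m))\<^sup>2)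
      \<le> ennreal (cweight \<alpha> \<delta> m u) * ennreal (N * (norm (f m))\<^sup>2)" for m
  proof -
    have um: "0 \<le> u ^ m" "u ^ m \<le> 1" using u by (auto simp: power_le_one)
    have c3: "0 \<le> c3" by (simp add: c3_def)
    show ?thesis
    proof (cases "real m * (1 - u) \<le> 1")
      case True
      then have "ennreal c2 * ennreal ((1 - u ^ m) / \<tau> * (norm (lo m))\<^sup>2) = ennreal (cweight \<alpha> \<delta> m u) * ennreal (N * (norm (f m))\<^sup>2)"
        using c um \<tau> N0 by (subst (1 2) ennreal_mult[symmetric])
          (auto simp: lo_def lowp_def cweight_def c2_def \<tau>_def power2_eq_square)
      then show ?thesis using True by (simp add: hi_def highp_def)
    next
      case False
      then have m1: "real m * \<tau> > 1" by (simp add: \<tau>_def)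
      then have m0: "real m > 0" using \<tau> by (cases "m = 0") auto
      have t1: "(1 + real m) powr (- \<delta>) \<le> real m powr (- \<delta>)" using m0 \<delta> by (intro powr_mono2') auto
      have "u ^ m \<le> (real m * \<tau>) powr (- \<delta>)" using power_le_powr_tail[of u \<delta> m] u \<delta> m1 by (simp add: \<tau>_def)
      also have "\<dots> = real m powr (- \<delta>) * \<tau> powr (- \<delta>)" using m0 \<tau> by (simp add: powr_mult)
      finally have "u ^ m / \<tau>\<^sup>2 \<le> real m powr (- \<delta>) * \<tau> powr (- \<delta>) / \<tau>\<^sup>2" by (intro divide_right_mono) auto
      also have "\<dots> = real m powr (- \<delta>) * \<tau> powr (- 2 - \<delta>)"
      proof -
        have "- 2 - \<delta> = - \<delta> + (- 2)" by simp
        then have "\<tau> powr (- 2 - \<delta>) = \<tau> powr (- \<delta>) * \<tau> powr (- 2)" by (simp only: powr_add)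
        also have "\<tau> powr (- 2) = 1 / \<tau>\<^sup>2" using \<tau> by (simp add: powr_minus_divide)
        finally show ?thesis by simp
      qed
      finally have t2: "u ^ m / \<tau>\<^sup>2 \<le> real m powr (- \<delta>) * \<tau> powr (- 2 - \<delta>)" .
      have "c3 * (2 * N / \<delta> * ((1 + real m) powr (- \<delta>) * (norm (f m))\<^sup>2)) + c4 * (u ^ m * (norm (f m))\<^sup>2)
          = ((54 / \<delta>) * (1 + real m) powr (- \<delta>) * \<tau> powr (- 2 - \<delta>) + (1 + \<alpha>)\<^sup>2 * (u ^ m / \<tau>\<^sup>2)) * (N * (norm (f m))\<^sup>2)"
        by (simp add: c3_def c4_def algebra_simps)
      also have "\<dots> \<le> ((54 / \<delta>) * real m powr (- \<delta>) * \<tau> powr (- 2 - \<delta>) + (1 + \<alpha>)\<^sup>2 * (real m powr (- \<delta>) * \<tau> powr (- 2 - \<delta>))) * (N * (norm (f m))\<^sup>2)"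
        using t1 t2 \<delta> N0 by (intro mult_right_mono add_mono mult_left_mono) auto
      also have "\<dots> = cweight \<alpha> \<delta> m u * (N * (norm (f m))\<^sup>2)"
        using False by (simp add: cweight_def \<tau>_def algebra_simps)
      finally have "ennreal (c3 * (2 * N / \<delta> * ((1 + real m) powr (- \<delta>) * (norm (f m))\<^sup>2)) + c4 * (u ^ m * (norm (f m))\<^sup>2))
          \<le> ennreal (cweight \<alpha> \<delta> m u * (N * (norm (f m))\<^sup>2))" by (rule ennreal_leI)
      moreover have "0 \<le> cweight \<alpha> \<delta> m u" using False \<delta> by (simp add: cweight_def)
      moreover have "lo m = 0" "hi m = f m" using False by (auto simp: lo_def hi_def lowp_def highp_def)
      ultimately show ?thesis using c c3 N0 \<delta> um
        by (simp add: ennreal_mult[symmetric] ennreal_plus[symmetric] del: ennreal_plus)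
    qed
  qed
  have "ennreal c2 * ?L
        + ?H + ennreal c4 * ?T
      \<le> ennreal c2 * ?L
        + ennreal c3 * (ennreal (2 * N / \<delta>) * ?D)
        + ennreal c4 * ?T"
    by (intro add_mono order_refl hi3)
  also have "\<dots> = (\<Sum>m. ennreal c2 * ennreal ((1 - u ^ m) / \<tau> * (norm (lo m))\<^sup>2)
      + ennreal c3 * (ennreal (2 * N / \<delta>) * ennreal ((1 + real m) powr (- \<delta>) * (norm (hi m))\<^sup>2))
      + ennreal c4 * ennreal (u ^ m * (norm (hi m))\<^sup>2))"
    unfolding ennreal_suminf_cmult[symmetric] by (simp only: suminf_add[OF summableI summableI])
  also have "\<dots> \<le> ?R"
    by (intro suminf_le termwise) auto
  finally have rest: "ennreal c2 * ?L
        + ?H + ennreal c4 * ?T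
      \<le> ?R" .
  have "?I (\<lambda>t. nsq (carl \<alpha> P f (?e t)))
      \<le> 4 * (?A + ?R)"
  proof (rule order_trans[OF main])
    show "4 * (?A + ennreal c2 * ?L
        + ?H + ennreal c4 * ?T)
      \<le> 4 * (?A + ?R)"
      unfolding add.assoc by (intro mult_left_mono add_left_mono rest[unfolded add.assoc]) simp
  qed
  then show ?thesis by (simp add: u_def X_def)
qed

section \<open>Integration in the radius\<close>

text \<open>The integral equals 1 / ((k + 1) (k + 2)): the Carleson weight regains the one
  derivative by which D^(1+\<alpha>) exceeds D^\<alpha>.\<close>

lemma nn_integral_moment_le:
  "(\<integral>\<^sup>+u\<in>{0..1}. ennreal ((1 - u) * u ^ k) \<partial>lborel) \<le> ennreal (1 / (1 + real k)\<^sup>2)"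
proof -
  have "(\<integral>\<^sup>+u. ennreal ((1 - u) * u ^ k * indicator {0..1} u) \<partial>lborel) = ennreal (1 / (1 + real k) - 1 / (2 + real k))"
  proof -
    have d: "((\<lambda>u. u ^ Suc j / real (Suc j)) has_field_derivative x ^ j) (at x within S)" for j S and x :: real
      by (rule DERIV_cong[OF DERIV_cdivide[OF DERIV_pow]]) simp
    let ?F = "\<lambda>u::real. u ^ Suc k / real (Suc k) - u ^ Suc (Suc k) / real (Suc (Suc k))"
    have "((\<lambda>u. (1 - u) * u ^ k) has_integral (?F 1 - ?F 0)) {0..1}"
    proof (rule fundamental_theorem_of_calculus)
      fix x :: real
      have "(?F has_field_derivative x ^ k - x ^ Suc k) (at x within {0..1})"
        by (intro DERIV_diff d)
      then show "(?F has_vector_derivative (1 - x) * x ^ k) (at x within {0..1})"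
        by (simp add: has_real_derivative_iff_has_vector_derivative left_diff_distrib)
    qed simp
    then have int: "((\<lambda>u. (1 - u) * u ^ k) has_integral (1 / (1 + real k) - 1 / (2 + real k))) {0..1}"
      by (simp add: add.commute)
    show ?thesis
      using nn_integral_has_integral_lebesgue[OF _ int] by (simp add: mult.commute[of _ "indicator _ _"])
  qed
  moreover have "1 / (1 + real k) - 1 / (2 + real k) \<le> 1 / (1 + real k)\<^sup>2"
    by (simp add: divide_simps power2_eq_square)
  moreover have "(\<integral>\<^sup>+u\<in>{0..1}. ennreal ((1 - u) * u ^ k) \<partial>lborel) = (\<integral>\<^sup>+u. ennreal ((1 - u) * u ^ k * indicator {0..1} u) \<partial>lborel)"
    by (intro nn_integral_cong) (auto simp: indicator_def)
  ultimately show ?thesis by (simp only:) (rule ennreal_leI)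
qed

lemma cweight_measurable [measurable]: "cweight \<alpha> \<delta> m \<in> borel_measurable borel"
  unfolding cweight_def[abs_def] by measurable

text \<open>The Bernoulli inequality bounds the low branch by (1 + \<alpha>)^2 m on an interval of
  length 1/m. The high branch has the antiderivative \<open>F\<close>, whose value at 1 - 1/m is
  free of \<open>m\<close>. For m = 0 the weight is 0.\<close>

lemma nn_integral_cweight_le:
  assumes \<alpha>: "\<alpha> > 0" and \<delta>: "0 < \<delta>" "\<delta> \<le> 1"
  shows "(\<integral>\<^sup>+u\<in>{0..1}. ennreal ((1 - u) * cweight \<alpha> \<delta> m u) \<partial>lborel)
    \<le> ennreal ((1 + \<alpha>)\<^sup>2 + (54 / \<delta> + (1 + \<alpha>)\<^sup>2) / \<delta>)"
proof (cases "m = 0")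
  case True
  then show ?thesis by (simp add: cweight_def)
next
  case False
  define c where "c = 54 / \<delta> + (1 + \<alpha>)\<^sup>2"
  have c: "0 \<le> c" using \<delta> by (simp add: c_def)
  define x where "x = real m"
  have x: "x \<ge> 1" using False by (simp add: x_def)
  \<comment> \<open>The point where m (1 - u) = 1. It is counted in both indicators of
    \<open>point\<close>, which an upper bound tolerates.\<close>
  define s where "s = 1 - 1 / x"
  have s: "0 \<le> s" "s < 1" using x by (auto simp: s_def field_simps)
  define f where "f u = c * x powr (- \<delta>) * (1 - u) powr (- \<delta> - 1)" for u
  define F where "F u = c * x powr (- \<delta>) / \<delta> * (1 - u) powr (- \<delta>)" for u
  have point: "ennreal ((1 - u) * cweight \<alpha> \<delta> m u) * indicator {0..1} u
      \<le> ennreal ((1 + \<alpha>)\<^sup>2 * x) * indicator {s..1} u + ennreal (f u) * indicator {0..s} u" for u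
  proof (cases "u \<in> {0..1}")
    case u: True
    show ?thesis
    proof (cases "real m * (1 - u) \<le> 1")
      case True
      then have us: "u \<in> {s..1}" using u x by (auto simp: s_def x_def field_simps)
      have "(1 - u) * cweight \<alpha> \<delta> m u \<le> (1 + \<alpha>)\<^sup>2 * x"
      \<comment> \<open>At u = 1 the outer factor 1 - u is 0, whatever value division by zero gives
        \<open>cweight\<close> there.\<close>
      proof (cases "u = 1")
        case False
        have "1 - u ^ m \<le> x * (1 - u)"
          using Bernoulli_inequality[of "u - 1" m] u by (simp add: x_def algebra_simps)
        then have "(1 - u ^ m) / (1 - u) \<le> x" using False u by (simp add: field_simps)
        then have "(1 + \<alpha>)\<^sup>2 * ((1 - u ^ m) / (1 - u)) \<le> (1 + \<alpha>)\<^sup>2 * x" by (intro mult_left_mono) auto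
        moreover have "(1 - u) * cweight \<alpha> \<delta> m u = (1 + \<alpha>)\<^sup>2 * ((1 - u ^ m) / (1 - u))"
          using True False by (simp add: cweight_def power2_eq_square)
        ultimately show ?thesis by simp
      qed (use x in simp)
      then have "ennreal ((1 - u) * cweight \<alpha> \<delta> m u) \<le> ennreal ((1 + \<alpha>)\<^sup>2 * x)" by (rule ennreal_leI)
      then show ?thesis using u us by (simp add: add_increasing2)
    next
      case False
      then have us: "u < s" using u x by (auto simp: s_def x_def field_simps)
      then have u1: "1 - u > 0" using s by simp
      have "(1 - u) * (1 - u) powr (- 2 - \<delta>) = (1 - u) powr (- \<delta> - 1)"
      proof -
        have "- \<delta> - 1 = 1 + (- 2 - \<delta>)" by simp
        then have "(1 - u) powr (- \<delta> - 1) = (1 - u) powr 1 * (1 - u) powr (- 2 - \<delta>)" by (simp only: powr_add)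
        then show ?thesis using u1 by simp
      qed
      then have "(1 - u) * cweight \<alpha> \<delta> m u = f u"
        using False by (simp add: cweight_def f_def c_def x_def mult.left_commute)
      then show ?thesis using u us by simp
    qed
  qed simp
  have [measurable]: "f \<in> borel_measurable borel" unfolding f_def[abs_def] by measurable
  have "(\<integral>\<^sup>+u. ennreal (f u) * indicator {0..s} u \<partial>lborel) = ennreal (F s - F 0)"
  proof (rule nn_integral_FTC_Icc)
    fix u assume "u \<in> {0..s}"
    then have u1: "1 - u > 0" using s by simp
    show "(F has_real_derivative f u) (at u)"
      unfolding F_def[abs_def] f_def using \<delta> u1 by (auto intro!: derivative_eq_intros simp: field_simps)
    show "0 \<le> f u" using c by (simp add: f_def)
  qed (use s in simp_all)
  also have "\<dots> \<le> ennreal (c / \<delta>)"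
  proof (rule ennreal_leI)
    have "x powr (- \<delta>) * (1 / x) powr (- \<delta>) = 1" using x by (simp add: powr_mult[symmetric])
    then have "F s = c / \<delta>" by (simp add: F_def s_def)
    moreover have "0 \<le> F 0" using c \<delta> by (simp add: F_def)
    ultimately show "F s - F 0 \<le> c / \<delta>" by simp
  qed
  finally have f_int: "(\<integral>\<^sup>+u. ennreal (f u) * indicator {0..s} u \<partial>lborel) \<le> ennreal (c / \<delta>)" .
  have "(\<integral>\<^sup>+u\<in>{0..1}. ennreal ((1 - u) * cweight \<alpha> \<delta> m u) \<partial>lborel)
      \<le> (\<integral>\<^sup>+u. ennreal ((1 + \<alpha>)\<^sup>2 * x) * indicator {s..1} u + ennreal (f u) * indicator {0..s} u \<partial>lborel)"
    by (intro nn_integral_mono point)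
  also have "\<dots> = ennreal ((1 + \<alpha>)\<^sup>2 * x) * ennreal (1 - s) + (\<integral>\<^sup>+u. ennreal (f u) * indicator {0..s} u \<partial>lborel)"
    using s by (simp add: nn_integral_add nn_integral_cmult_indicator)
  also have "\<dots> \<le> ennreal ((1 + \<alpha>)\<^sup>2 * x) * ennreal (1 - s) + ennreal (c / \<delta>)"
    by (intro add_left_mono f_int)
  also have "\<dots> = ennreal ((1 + \<alpha>)\<^sup>2 + c / \<delta>)"
    using x s c \<delta> by (simp add: ennreal_mult[symmetric] s_def)
  finally show ?thesis by (simp add: c_def)
qed

text \<open>The 4 comes from splitting into four terms, pi from area measure in the variable u, 1
  from the term of \<open>f\<close> itself, and the rest from \<open>nn_integral_cweight_le\<close>;
  \<delta> = min \<alpha> 1 is the largest value that \<open>hank_decay\<close> permits.\<close>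

definition carl_const :: "real \<Rightarrow> real"
  where "carl_const \<alpha> = (let \<delta> = min \<alpha> 1 in 4 * pi * (1 + ((1 + \<alpha>)\<^sup>2 + (54 / \<delta> + (1 + \<alpha>)\<^sup>2) / \<delta>)))"

lemma carl_const_pos: "\<alpha> > 0 \<Longrightarrow> carl_const \<alpha> > 0"
  unfolding carl_const_def Let_def
  by (intro mult_pos_pos add_pos_nonneg add_nonneg_nonneg divide_nonneg_nonneg) auto

lemma carl_measurable:
  fixes f :: "nat \<Rightarrow> 'h::complex_hilbert_space"
  assumes "ps_conv 1 P" "geo f"
  shows "(\<lambda>z. ennreal ((norm (carl \<alpha> P f z))\<^sup>2 * (1 - (norm z)\<^sup>2)) * indicator (ball 0 1) z) \<in> borel_measurable borel"
proof -
  have "continuous_on (ball 0 1) (\<lambda>z. (norm (carl \<alpha> P f z))\<^sup>2 * (1 - (norm z)\<^sup>2))"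
    by (intro continuous_intros continuous_on_carl[OF assms])
  then have "(\<lambda>z. indicator (ball 0 1) z *\<^sub>R ((norm (carl \<alpha> P f z))\<^sup>2 * (1 - (norm z)\<^sup>2))) \<in> borel_measurable borel"
    by (intro borel_measurable_continuous_on_indicator) auto
  then have "(\<lambda>z. ennreal (indicator (ball 0 1) z *\<^sub>R ((norm (carl \<alpha> P f z))\<^sup>2 * (1 - (norm z)\<^sup>2)))) \<in> borel_measurable borel"
    by measurable
  moreover have "ennreal (indicator (ball 0 1) z *\<^sub>R ((norm (carl \<alpha> P f z))\<^sup>2 * (1 - (norm z)\<^sup>2)))
      = ennreal ((norm (carl \<alpha> P f z))\<^sup>2 * (1 - (norm z)\<^sup>2)) * indicator (ball 0 1) z" for z
    by (simp add: indicator_def)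
  ultimately show ?thesis by simp
qed

lemma circle_mean_weighted:
  assumes z: "norm z < 1" and meas: "(\<lambda>t. nsq (g (cis (2 * pi * t) * z)) * indicator {0..1} t) \<in> borel_measurable lborel"
  shows "(\<integral>\<^sup>+t\<in>{0..1}. ennreal ((norm (g (cis (2 * pi * t) * z)))\<^sup>2 * (1 - (norm (cis (2 * pi * t) * z))\<^sup>2)) \<partial>lborel)
    = ennreal (1 - (norm z)\<^sup>2) * (\<integral>\<^sup>+t\<in>{0..1}. nsq (g (cis (2 * pi * t) * z)) \<partial>lborel)"
proof -
  have "ennreal ((norm (g (cis (2 * pi * t) * z)))\<^sup>2 * (1 - (norm (cis (2 * pi * t) * z))\<^sup>2)) * indicator {0..1} t
      = ennreal (1 - (norm z)\<^sup>2) * (nsq (g (cis (2 * pi * t) * z)) * indicator {0..1} t)" for t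
    by (simp add: norm_mult ennreal_mult'' mult_ac)
  then show ?thesis using meas by (simp add: nn_integral_cmult)
qed

lemma carl_circle_measurable:
  fixes f :: "nat \<Rightarrow> 'h::complex_hilbert_space"
  assumes "ps_conv 1 P" "geo f" and z: "norm z < 1"
  shows "(\<lambda>t. nsq (carl \<alpha> P f (cis (2 * pi * t) * z)) * indicator {0..1} t) \<in> borel_measurable lborel"
proof -
  have "continuous_on UNIV (\<lambda>t. carl \<alpha> P f (cis (2 * pi * t) * z))"
    by (rule continuous_on_compose2[OF continuous_on_carl[OF assms(1,2)]])
      (use z in \<open>auto simp: norm_mult cis_conv_exp intro!: continuous_intros\<close>)
  then have "(\<lambda>t. (norm (carl \<alpha> P f (cis (2 * pi * t) * z)))\<^sup>2) \<in> borel_measurable borel"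
    by (intro borel_measurable_continuous_onI continuous_intros)
  then show ?thesis by measurable
qed

text \<open>The circle estimate depends on |z| only and is integrated as a function \<open>K\<close>
  of u. After sums and integral are exchanged, each coefficient meets one of the two radial
  integrals above.\<close>

lemma carl_bound:
  fixes P :: "nat \<Rightarrow> ('h::complex_hilbert_space, 'h) cblinfun"
  assumes P: "ps_conv 1 P" and N: "hankel_bounded \<alpha> P N TYPE('h)" and f: "geo f" and \<alpha>: "\<alpha> > 0"
  shows "(\<integral>\<^sup>+z\<in>ball 0 1. ennreal ((norm (carl \<alpha> P f z))\<^sup>2 * (1 - (norm z)\<^sup>2)) \<partial>lborel)
    \<le> ennreal (carl_const \<alpha> * N) * sq_sum f"
proof -
  have N0: "0 \<le> N" using N by (simp add: hankel_bounded_def)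
  define \<delta> where "\<delta> = min \<alpha> 1"
  have \<delta>: "0 < \<delta>" "\<delta> \<le> 1" "\<delta> \<le> \<alpha>" using \<alpha> by (auto simp: \<delta>_def)
  define W where "W = (1 + \<alpha>)\<^sup>2 + (54 / \<delta> + (1 + \<alpha>)\<^sup>2) / \<delta>"
  have W: "0 \<le> W" using \<delta> by (simp add: W_def)
  define b where "b k = ((1 + real k) powr (1 + \<alpha>) * norm (hank P f k))\<^sup>2" for k
  define d where "d m = N * (norm (f m))\<^sup>2" for m
  have bd: "0 \<le> b k" "0 \<le> d k" for k using N0 by (auto simp: b_def d_def)
  define K where "K u = ennreal (1 - u) * (4 * ((\<Sum>k. ennreal (u ^ k * b k)) + (\<Sum>m. ennreal (cweight \<alpha> \<delta> m u) * ennreal (d m))))" for u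
  have [measurable]: "K \<in> borel_measurable borel" unfolding K_def[abs_def] by measurable
  let ?q = "\<lambda>z. ennreal ((norm (carl \<alpha> P f z))\<^sup>2 * (1 - (norm z)\<^sup>2))"
  let ?m = "\<lambda>k. \<integral>\<^sup>+u\<in>{0..1}. ennreal ((1 - u) * u ^ k) \<partial>lborel"
  let ?w = "\<lambda>m. \<integral>\<^sup>+u\<in>{0..1}. ennreal ((1 - u) * cweight \<alpha> \<delta> m u) \<partial>lborel"
  let ?B = "\<lambda>u. \<Sum>k. ennreal (b k) * (ennreal ((1 - u) * u ^ k) * indicator {0..1} u)"
  let ?D = "\<lambda>u. \<Sum>m. ennreal (d m) * (ennreal ((1 - u) * cweight \<alpha> \<delta> m u) * indicator {0..1} u)"
  let ?s = "\<Sum>m. nsq (f m)"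
  have "(\<integral>\<^sup>+z\<in>ball 0 1. ?q z \<partial>lborel) = (\<integral>\<^sup>+z\<in>ball 0 1. (\<integral>\<^sup>+t\<in>{0..1}. ?q (cis (2 * pi * t) * z) \<partial>lborel) \<partial>lborel)"
    by (rule nn_integral_disc_circle_means[OF carl_measurable[OF P f]])
  also have "\<dots> \<le> (\<integral>\<^sup>+z\<in>ball (0::complex) 1. K ((norm z)\<^sup>2) \<partial>lborel)"
  proof (rule nn_integral_mono)
    fix z :: complex
    show "(\<integral>\<^sup>+t\<in>{0..1}. ?q (cis (2 * pi * t) * z) \<partial>lborel) * indicator (ball 0 1) z \<le> K ((norm z)\<^sup>2) * indicator (ball 0 1) z"
    proof (cases "norm z < 1")
      case True
      have "(\<integral>\<^sup>+t\<in>{0..1}. ?q (cis (2 * pi * t) * z) \<partial>lborel) \<le> K ((norm z)\<^sup>2)"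
        unfolding circle_mean_weighted[OF True carl_circle_measurable[OF P f True]] K_def b_def d_def
        by (intro mult_left_mono circle_mean_carl[OF P N f True \<alpha> \<delta>]) simp
      then show ?thesis by (rule mult_right_mono) simp
    qed simp
  qed
  also have "\<dots> = ennreal pi * (\<integral>\<^sup>+u\<in>{0..1}. K u \<partial>lborel)"
    by (rule nn_integral_disc_radial) simp
  also have "(\<integral>\<^sup>+u\<in>{0..1}. K u \<partial>lborel) = 4 * ((\<Sum>k. ennreal (b k) * ?m k)
      + (\<Sum>m. ennreal (d m) * ?w m))"
  proof -
    have "K u * indicator {0..1} u = 4 * (?B u
        + ?D u)" for u
    proof (cases "u \<in> {0..1}")
      case True
      then have u: "0 \<le> u" "u \<le> 1" by auto
      have "K u = 4 * ((\<Sum>k. ennreal (1 - u) * ennreal (u ^ k * b k)) + (\<Sum>m. ennreal (1 - u) * (ennreal (cweight \<alpha> \<delta> m u) * ennreal (d m))))"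
        unfolding K_def ennreal_suminf_cmult by (simp only: distrib_left mult_ac)
      also have "(\<Sum>k. ennreal (1 - u) * ennreal (u ^ k * b k)) = (\<Sum>k. ennreal (b k) * ennreal ((1 - u) * u ^ k))"
        using u bd by (intro suminf_cong) (simp add: ennreal_mult mult_ac)
      also have "(\<Sum>m. ennreal (1 - u) * (ennreal (cweight \<alpha> \<delta> m u) * ennreal (d m))) = (\<Sum>m. ennreal (d m) * ennreal ((1 - u) * cweight \<alpha> \<delta> m u))"
        using u by (intro suminf_cong) (simp add: ennreal_mult' mult_ac)
      finally show ?thesis using True by simp
    qed simp
    then have "(\<integral>\<^sup>+u\<in>{0..1}. K u \<partial>lborel) = (\<integral>\<^sup>+u. 4 * (?B u
        + ?D u) \<partial>lborel)"
      by (simp only:)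
    also have "\<dots> = 4 * ((\<integral>\<^sup>+u. ?B u \<partial>lborel)
        + (\<integral>\<^sup>+u. ?D u \<partial>lborel))"
      by (subst nn_integral_cmult, measurable, subst nn_integral_add, measurable)
    also have "(\<integral>\<^sup>+u. ?B u \<partial>lborel)
        = (\<Sum>k. ennreal (b k) * ?m k)"
      by (subst nn_integral_suminf, measurable, subst nn_integral_cmult, measurable)
    also have "(\<integral>\<^sup>+u. ?D u \<partial>lborel)
        = (\<Sum>m. ennreal (d m) * ?w m)"
      by (subst nn_integral_suminf, measurable, subst nn_integral_cmult, measurable)
    finally show ?thesis .
  qed
  also have "ennreal pi * (4 * ((\<Sum>k. ennreal (b k) * ?m k)
      + (\<Sum>m. ennreal (d m) * ?w m)))
    \<le> ennreal pi * (4 * (ennreal N * ?s + ennreal N * ?s * ennreal W))"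
  proof (intro mult_left_mono add_mono)
    have "(\<Sum>k. ennreal (b k) * ?m k) \<le> (\<Sum>k. ennreal (((1 + real k) powr \<alpha> * norm (hank P f k))\<^sup>2))"
    proof (rule suminf_le)
      fix k
      have "ennreal (b k) * ?m k \<le> ennreal (b k) * ennreal (1 / (1 + real k)\<^sup>2)"
        by (intro mult_left_mono nn_integral_moment_le) simp
      also have "\<dots> = ennreal (b k * (1 / (1 + real k)\<^sup>2))" by (rule ennreal_mult[symmetric]) (use bd in auto)
      also have "b k * (1 / (1 + real k)\<^sup>2) = ((1 + real k) powr \<alpha> * norm (hank P f k))\<^sup>2"
        by (simp add: b_def powr_add power_mult_distrib)
      finally show "ennreal (b k) * ?m k \<le> ennreal (((1 + real k) powr \<alpha> * norm (hank P f k))\<^sup>2)" .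
    qed auto
    also have "\<dots> \<le> ennreal N * ?s" using N f unfolding hankel_bounded_def by blast
    finally show "(\<Sum>k. ennreal (b k) * ?m k) \<le> ennreal N * ?s" .
    have "(\<Sum>m. ennreal (d m) * ?w m) \<le> (\<Sum>m. ennreal (d m) * ennreal W)"
      unfolding W_def by (intro suminf_le mult_left_mono nn_integral_cweight_le \<alpha> \<delta>) auto
    also have "\<dots> = ennreal N * ?s * ennreal W"
      using N0 by (simp add: d_def ennreal_mult)
    finally show "(\<Sum>m. ennreal (d m) * ?w m)
        \<le> ennreal N * ?s * ennreal W" .
  qed auto
  also have "\<dots> = ennreal (carl_const \<alpha> * N) * ?s"
  proof -
    have "carl_const \<alpha> = pi * 4 * (1 + W)" by (simp add: carl_const_def Let_def \<delta>_def[symmetric] W_def)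
    then have "ennreal (carl_const \<alpha> * N) = ennreal pi * 4 * (1 + ennreal W) * ennreal N"
      using W N0 by (simp add: ennreal_mult)
    then show ?thesis by (simp only: distrib_left distrib_right mult_ac mult_1 mult_1_right)
  qed
  finally show ?thesis .
qed

section \<open>The Carleson condition bounds the Hankel operator\<close>

text \<open>The substitution t -> c t is made in the nonnegative integral, where integrability is no
  issue; the finite value then yields the ordinary integral.\<close>

lemma Gamma_integral_scaled:
  fixes x c :: real
  assumes x: "x > 0" and c: "c > 0"
  shows "((\<lambda>t. indicator {0..} t * (t powr (x - 1) * exp (- (c * t)))) has_integral (Gamma x / c powr x)) UNIV"
proof -
  let ?J = "\<integral>\<^sup>+t. ennreal (indicator {0..} t * (t powr (x - 1) * exp (- (c * t)))) \<partial>lborel"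
  have "ennreal (Gamma x) = (\<integral>\<^sup>+t. ennreal (indicator {0..} t * t powr (x - 1) / exp t) \<partial>lborel)"
    by (rule Gamma_conv_nn_integral_real[OF x])
  also have "\<dots> = ennreal c * (\<integral>\<^sup>+t. ennreal (indicator {0..} (c * t) * (c * t) powr (x - 1) / exp (c * t)) \<partial>lborel)"
    by (subst nn_integral_real_affine[where c = c and t = 0]) (use c in auto)
  also have "(\<integral>\<^sup>+t. ennreal (indicator {0..} (c * t) * (c * t) powr (x - 1) / exp (c * t)) \<partial>lborel)
      = (\<integral>\<^sup>+t. ennreal (c powr (x - 1)) * ennreal (indicator {0..} t * (t powr (x - 1) * exp (- (c * t)))) \<partial>lborel)"
  proof (rule nn_integral_cong)
    fix t :: real
    have "indicator {0..} (c * t) * (c * t) powr (x - 1) / exp (c * t)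
        = c powr (x - 1) * (indicator {0..} t * (t powr (x - 1) * exp (- (c * t))))"
    proof (cases "t \<ge> 0")
      case True
      then have "c * t \<ge> 0" using c by simp
      then show ?thesis using True c by (simp add: powr_mult exp_minus divide_inverse)
    next
      case False
      then have "\<not> c * t \<ge> 0" using c by (simp add: zero_le_mult_iff)
      then show ?thesis using False by simp
    qed
    then show "ennreal (indicator {0..} (c * t) * (c * t) powr (x - 1) / exp (c * t))
        = ennreal (c powr (x - 1)) * ennreal (indicator {0..} t * (t powr (x - 1) * exp (- (c * t))))"
      by (simp only:) (rule ennreal_mult, auto)
  qed
  also have "\<dots> = ennreal (c powr (x - 1)) * ?J" by (rule nn_integral_cmult) measurable
  also have "ennreal c * (ennreal (c powr (x - 1)) * ?J) = ennreal (c powr x) * ?J"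
  proof -
    have "c * c powr (x - 1) = c powr x" using c by (simp add: powr_diff)
    then have "ennreal c * ennreal (c powr (x - 1)) = ennreal (c powr x)" using c by (simp add: ennreal_mult[symmetric])
    then show ?thesis by (simp only: mult.assoc[symmetric])
  qed
  finally have "ennreal (1 / c powr x) * ennreal (Gamma x) = ennreal (1 / c powr x) * ennreal (c powr x) * ?J"
    by (simp only: mult.assoc)
  moreover have "ennreal (1 / c powr x) * ennreal (c powr x) = 1" using c by (simp add: ennreal_mult[symmetric])
  moreover have "ennreal (1 / c powr x) * ennreal (Gamma x) = ennreal (Gamma x / c powr x)"
    using Gamma_real_pos[OF x] by (simp add: ennreal_mult[symmetric])
  ultimately have "?J = ennreal (Gamma x / c powr x)" by simp
  moreover have "0 \<le> Gamma x / c powr x" using Gamma_real_pos[OF x] by simp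
  ultimately show ?thesis by (intro nn_integral_has_integral) auto
qed

text \<open>Up to the factor \<open>z^n\<close>, this is the \<open>n\<close>-th Fourier coefficient of \<open>carl \<alpha> P f\<close> on the circle
  \<open>|z|^2 = u\<close> if \<open>f m = 0\<close> for \<open>m \<ge> M\<close>.\<close>

definition poly_moment :: "real \<Rightarrow> (nat \<Rightarrow> ('h, 'h) cblinfun) \<Rightarrow> (nat \<Rightarrow> 'h) \<Rightarrow> nat \<Rightarrow> nat \<Rightarrow> real \<Rightarrow> 'h::complex_hilbert_space"
  where "poly_moment \<alpha> P f M n u = (\<Sum>m<M. ((1 + real (m + n)) powr (1 + \<alpha>) * u ^ m) *\<^sub>R cblinfun_apply (P (m + n)) (f m))"

lemma continuous_on_poly_moment [continuous_intros]:
  "continuous_on S g \<Longrightarrow> continuous_on S (\<lambda>t. poly_moment \<alpha> P f M n (g t))"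
  unfolding poly_moment_def by (intro continuous_intros)

lemma hank_poly:
  assumes "\<And>m. m \<ge> M \<Longrightarrow> f m = 0"
  shows "hank P f n = (\<Sum>m<M. cblinfun_apply (P (m + n)) (f m))"
  unfolding hank_def by (rule suminf_finite) (use assms in \<open>auto simp: cblinfun_apply_simps not_less\<close>)

lemma linear_cinner_left: "linear (\<lambda>x::'h::complex_hilbert_space. cinner x y)"
  by (rule bounded_linear.linear[OF bounded_linear_cinner_left])

text \<open>The numerator is the integral of t^(2\<alpha>) (1 + 1/t) exp (-t), the factor 1 + 1/t
  being an upper bound for 1 / (1 - exp (-t)). The denominator is the square of the normalising
  factor in the Gamma integral for the power -1-\<alpha>.\<close>

definition hank_const :: "real \<Rightarrow> real"
  where "hank_const \<alpha> = (Gamma (2 * \<alpha> + 1) + Gamma (2 * \<alpha>)) / (Gamma (\<alpha> + 1))\<^sup>2"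

lemma hank_const_pos:
  assumes "\<alpha> > 0" shows "hank_const \<alpha> > 0"
proof -
  have "Gamma (2 * \<alpha> + 1) > 0" "Gamma (2 * \<alpha>) > 0" "Gamma (\<alpha> + 1) > 0" using assms by (auto intro!: Gamma_real_pos)
  then show ?thesis unfolding hank_const_def by (intro divide_pos_pos add_pos_pos) auto
qed

text \<open>The vector y = \<Gamma> f n is paired with itself, so that only scalar integrals occur:
  Gamma(1+\<alpha>) |y|^2 is the integral of t^\<alpha> exp (-(1+n) t) times the real part of the
  pairing of \<open>G t\<close> with \<open>y\<close>. Cauchy-Schwarz takes the form of a pointwise
  weighted arithmetic-geometric inequality, whose |y|^2 term is absorbed on the left. The remaining
  weight contains t^(2\<alpha>-1), integrable at 0 since \<alpha> > 0.\<close>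

lemma hank_le_moment:
  fixes P :: "nat \<Rightarrow> ('h::complex_hilbert_space, 'h) cblinfun"
  assumes \<alpha>: "\<alpha> > 0" and f: "\<And>m. m \<ge> M \<Longrightarrow> f m = 0"
  shows "ennreal (((1 + real n) powr \<alpha> * norm (hank P f n))\<^sup>2)
    \<le> ennreal (hank_const \<alpha>) * (\<integral>\<^sup>+u\<in>{0..1}. ennreal ((1 - u) * (u ^ n * (norm (poly_moment \<alpha> P f M n u))\<^sup>2)) \<partial>lborel)"
    (is "_ \<le> _ * ?A")
proof (cases "?A = top")
  case True
  then show ?thesis using hank_const_pos[OF \<alpha>] by (simp add: ennreal_mult_top)
next
  case False
  define a where "a = enn2real ?A"
  have a: "?A = ennreal a" "0 \<le> a" using False by (simp_all add: a_def less_top)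
  define y where "y = hank P f n"
  define G where "G t = poly_moment \<alpha> P f M n (exp (- t))" for t
  have cG: "continuous_on UNIV G" unfolding G_def by (intro continuous_intros)
  define L where "L = Gamma (\<alpha> + 1)"
  define L' where "L' = Gamma (2 * \<alpha> + 1) + Gamma (2 * \<alpha>)"
  have L: "L > 0" using \<alpha> unfolding L_def by (intro Gamma_real_pos) auto
  have L': "L' > 0" using \<alpha> unfolding L'_def by (intro add_pos_pos Gamma_real_pos) auto
  define c where "c = 1 + real n"
  let ?i = "\<lambda>t::real. indicator {0..} t :: real"
  let ?x = "\<lambda>m. cblinfun_apply (P (m + n)) (f m)"
  let ?k = "\<lambda>m. (1 + real (m + n)) powr (1 + \<alpha>) * Re (cinner (?x m) y)"
  let ?t = "\<lambda>m t. ?i t * (t powr (\<alpha> + 1 - 1) * exp (- ((1 + real (m + n)) * t)))"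
  have c: "c \<ge> 1" by (simp add: c_def)
  have main_int: "((\<lambda>t. ?i t * (t powr \<alpha> * exp (- (c * t)) * Re (cinner (G t) y))) has_integral (L * (norm y)\<^sup>2)) UNIV"
  proof -
    have "((\<lambda>t. \<Sum>m<M. ?k m
          * ?t m t)
        has_integral (\<Sum>m<M. ?k m
          * (Gamma (\<alpha> + 1) / (1 + real (m + n)) powr (\<alpha> + 1)))) UNIV"
      by (intro has_integral_sum has_integral_mult_right Gamma_integral_scaled) (use \<alpha> in auto)
    also have "(\<Sum>m<M. ?k m
          * (Gamma (\<alpha> + 1) / (1 + real (m + n)) powr (\<alpha> + 1))) = (\<Sum>m<M. L * Re (cinner (?x m) y))"
      by (intro sum.cong refl) (simp add: L_def add.commute[of \<alpha> 1])
    also have "\<dots> = L * Re (cinner (\<Sum>m<M. ?x m) y)"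
      by (simp add: linear_sum[OF linear_cinner_left] sum_distrib_left)
    also have "\<dots> = L * (norm y)\<^sup>2"
    proof -
      have "(\<Sum>m<M. ?x m) = y"
        unfolding y_def by (rule hank_poly[OF f, symmetric])
      then show ?thesis by (simp only: cinner_self Re_complex_of_real)
    qed
    also have "(\<lambda>t. \<Sum>m<M. ?k m
          * ?t m t)
        = (\<lambda>t. ?i t * (t powr \<alpha> * exp (- (c * t)) * Re (cinner (G t) y)))"
    proof
      fix t
      have "Re (cinner (G t) y) = (\<Sum>m<M. (1 + real (m + n)) powr (1 + \<alpha>) * exp (- t) ^ m * Re (cinner (?x m) y))"
        unfolding G_def poly_moment_def
        by (simp add: linear_sum[OF linear_cinner_left] linear_cmul[OF linear_cinner_left] del: mult_minus_right)
      moreover have "exp (- ((1 + real (m + n)) * t)) = exp (- (c * t)) * exp (- t) ^ m" for m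
        by (simp add: c_def exp_of_nat_mult[symmetric] exp_add[symmetric] algebra_simps)
      ultimately show "(\<Sum>m<M. ?k m
          * ?t m t)
        = ?i t * (t powr \<alpha> * exp (- (c * t)) * Re (cinner (G t) y))"
        by (simp add: sum_distrib_left mult_ac)
    qed
    finally show ?thesis .
  qed
  \<comment> \<open>The integrand of \<open>?A\<close> after u = exp (-t): with c = 1 + n the factor
    exp (-c t) combines u^n with the Jacobian.\<close>
  define p where "p t = exp (- (c * t)) * (1 - exp (- t)) * (norm (G t))\<^sup>2" for t
  have p_int: "((\<lambda>t. ?i t * p t) has_integral a) UNIV"
  proof (rule nn_integral_has_integral)
    have "continuous_on UNIV p" unfolding p_def by (intro continuous_intros cG)
    then have "p \<in> borel_measurable borel" by (rule borel_measurable_continuous_onI)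
    then show "(\<lambda>t. ?i t * p t) \<in> borel_measurable borel" by measurable
    show "0 \<le> ?i t * p t" for t by (auto simp: p_def indicator_def)
    have "continuous_on UNIV (\<lambda>u. (1 - u) * (u ^ n * (norm (poly_moment \<alpha> P f M n u))\<^sup>2))" by (intro continuous_intros)
    then have "(\<lambda>u. (1 - u) * (u ^ n * (norm (poly_moment \<alpha> P f M n u))\<^sup>2)) \<in> borel_measurable borel"
      by (rule borel_measurable_continuous_onI)
    then have meas: "(\<lambda>u. ennreal ((1 - u) * (u ^ n * (norm (poly_moment \<alpha> P f M n u))\<^sup>2))) \<in> borel_measurable borel"
      by (rule measurable_compose[OF _ measurable_ennreal])
    have "(\<integral>\<^sup>+t. ennreal (?i t * p t) \<partial>lborel)
        = (\<integral>\<^sup>+t\<in>{0..}. ennreal (exp (- t)) * ennreal ((1 - exp (- t)) * (exp (- t) ^ n * (norm (poly_moment \<alpha> P f M n (exp (- t))))\<^sup>2)) \<partial>lborel)"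
    proof (rule nn_integral_cong)
      fix t :: real
      have "exp (- (c * t)) = exp (- t) * exp (- t) ^ n"
        by (simp add: c_def exp_of_nat_mult[symmetric] exp_add[symmetric] algebra_simps)
      then have "p t = exp (- t) * ((1 - exp (- t)) * (exp (- t) ^ n * (norm (poly_moment \<alpha> P f M n (exp (- t))))\<^sup>2))"
        by (simp add: p_def G_def mult_ac)
      then show "ennreal (?i t * p t) = ennreal (exp (- t)) * ennreal ((1 - exp (- t)) * (exp (- t) ^ n * (norm (poly_moment \<alpha> P f M n (exp (- t))))\<^sup>2)) * indicator {0..} t"
        by (simp add: indicator_def ennreal_mult'[symmetric])
    qed
    also have "\<dots> = ?A" by (rule nn_integral_exp_substitution[OF meas])
    finally show "(\<integral>\<^sup>+t. ennreal (?i t * p t) \<partial>lborel) = ennreal a" using a(1) by simp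
  qed (rule a(2))
  define r where "r t = (t powr (2 * \<alpha> + 1 - 1) * exp (- (c * t))) + (t powr (2 * \<alpha> - 1) * exp (- (c * t)))" for t
  define R where "R = Gamma (2 * \<alpha> + 1) / c powr (2 * \<alpha> + 1) + Gamma (2 * \<alpha>) / c powr (2 * \<alpha>)"
  have r_int: "((\<lambda>t. ?i t * r t) has_integral R) UNIV"
    unfolding r_def R_def distrib_left
    by (intro has_integral_add Gamma_integral_scaled) (use \<alpha> c in auto)
  have R_le: "R \<le> L' / c powr (2 * \<alpha>)"
  proof -
    have "c powr (2 * \<alpha>) \<le> c powr (2 * \<alpha> + 1)" using c by (intro powr_mono) auto
    then have "Gamma (2 * \<alpha> + 1) / c powr (2 * \<alpha> + 1) \<le> Gamma (2 * \<alpha> + 1) / c powr (2 * \<alpha>)"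
      using c \<alpha> by (intro divide_left_mono) (auto intro!: less_imp_le[OF Gamma_real_pos])
    then show ?thesis by (simp add: R_def L'_def add_divide_distrib)
  qed
  \<comment> \<open>The value for which, after \<open>R_le\<close>, the |y|^2 term on the right is
    exactly half of the left side.\<close>
  define \<mu> where "\<mu> = L' / c powr (2 * \<alpha>) / L"
  have \<mu>: "\<mu> > 0" using L L' c by (simp add: \<mu>_def)
  have "L * (norm y)\<^sup>2 \<le> (1 / 2) * (\<mu> * a + (norm y)\<^sup>2 / \<mu> * R)"
  proof (rule has_integral_le[OF main_int])
    show "((\<lambda>t. (1 / 2) * (\<mu> * (?i t * p t) + (norm y)\<^sup>2 / \<mu> * (?i t * r t))) has_integral (1 / 2) * (\<mu> * a + (norm y)\<^sup>2 / \<mu> * R)) UNIV"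
      by (intro has_integral_mult_right has_integral_add p_int r_int)
    fix t :: real
    show "?i t * (t powr \<alpha> * exp (- (c * t)) * Re (cinner (G t) y)) \<le> (1 / 2) * (\<mu> * (?i t * p t) + (norm y)\<^sup>2 / \<mu> * (?i t * r t))"
    proof (cases "t > 0")
      case True
      define w where "w = 1 - exp (- t)"
      have w: "w > 0" using True by (simp add: w_def)
      have w_inv: "1 / w \<le> 1 + 1 / t"
      proof -
        have "1 + t \<le> exp t" using exp_ge_add_one_self[of t] by simp
        then have "(1 + t) * exp (- t) \<le> exp t * exp (- t)" by (intro mult_right_mono) auto
        then have "(1 + t) * exp (- t) \<le> 1" by (simp add: exp_minus_inverse)
        then have "t \<le> (1 + t) * w" by (simp add: w_def algebra_simps)
        then show ?thesis using True w by (simp add: field_simps)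
      qed
      \<comment> \<open>Chosen so that t^\<alpha> s^2 = \<mu> (1 - exp (-t)), which is the weight in
        \<open>p\<close>.\<close>
      define s where "s = sqrt (\<mu> * w / t powr \<alpha>)"
      have s2: "s\<^sup>2 = \<mu> * w / t powr \<alpha>" and s: "s > 0" using \<mu> w True by (auto simp: s_def)
      have sc: "cinner (of_real s *\<^sub>C G t) (of_real (1 / s) *\<^sub>C y) = cinner (G t) y"
        using s by (simp add: cinner_scaleC_left cinner_scaleC_right)
      have "2 * Re (cinner (G t) y) \<le> (norm (of_real s *\<^sub>C G t))\<^sup>2 + (norm (of_real (1 / s) *\<^sub>C y))\<^sup>2"
        using Re_cinner_le[of "of_real s *\<^sub>C G t" "of_real (1 / s) *\<^sub>C y"] unfolding sc .
      also have "\<dots> = s\<^sup>2 * (norm (G t))\<^sup>2 + (norm y)\<^sup>2 / s\<^sup>2"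
        using s by (simp add: norm_scaleC norm_divide power_mult_distrib power_divide)
      finally have "t powr \<alpha> * (2 * Re (cinner (G t) y)) \<le> t powr \<alpha> * (\<mu> * w / t powr \<alpha> * (norm (G t))\<^sup>2 + (norm y)\<^sup>2 / (\<mu> * w / t powr \<alpha>))"
        unfolding s2 by (intro mult_left_mono) auto
      also have "\<dots> = \<mu> * (w * (norm (G t))\<^sup>2) + (norm y)\<^sup>2 / \<mu> * ((t powr \<alpha>)\<^sup>2 * (1 / w))"
        using True w \<mu> by (simp add: field_simps power2_eq_square)
      also have "\<dots> \<le> \<mu> * (w * (norm (G t))\<^sup>2) + (norm y)\<^sup>2 / \<mu> * ((t powr \<alpha>)\<^sup>2 * (1 + 1 / t))"
        using w_inv \<mu> by (intro add_left_mono mult_left_mono) auto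
      also have "(t powr \<alpha>)\<^sup>2 * (1 + 1 / t) = t powr (2 * \<alpha> + 1 - 1) + t powr (2 * \<alpha> - 1)"
        using True by (simp add: powr_square powr_diff distrib_left)
      finally have "exp (- (c * t)) * (t powr \<alpha> * (2 * Re (cinner (G t) y)))
          \<le> exp (- (c * t)) * (\<mu> * (w * (norm (G t))\<^sup>2) + (norm y)\<^sup>2 / \<mu> * (t powr (2 * \<alpha> + 1 - 1) + t powr (2 * \<alpha> - 1)))"
        by (intro mult_left_mono) auto
      also have "\<dots> = \<mu> * p t + (norm y)\<^sup>2 / \<mu> * r t"
        by (simp add: p_def r_def w_def distrib_left distrib_right mult_ac)
      finally show ?thesis using True by (simp add: mult_ac)
    next
      case False
      show ?thesis
      proof (cases "t = 0")
        case True
        then show ?thesis using \<alpha> by (simp add: p_def r_def)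
      qed (use False in simp)
    qed
  qed
  also have "\<dots> \<le> (1 / 2) * (\<mu> * a + (norm y)\<^sup>2 / \<mu> * (L' / c powr (2 * \<alpha>)))"
    using R_le \<mu> by (intro mult_left_mono add_left_mono) auto
  also have "(norm y)\<^sup>2 / \<mu> * (L' / c powr (2 * \<alpha>)) = (norm y)\<^sup>2 * L"
    using L L' c by (simp add: \<mu>_def field_simps)
  finally have "L * (norm y)\<^sup>2 \<le> \<mu> * a" by (simp add: algebra_simps)
  then have "c powr (2 * \<alpha>) / L * (L * (norm y)\<^sup>2) \<le> c powr (2 * \<alpha>) / L * (\<mu> * a)"
    using L by (intro mult_left_mono) auto
  also have "c powr (2 * \<alpha>) / L * (L * (norm y)\<^sup>2) = (c powr \<alpha> * norm y)\<^sup>2"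
    using L by (simp add: power_mult_distrib powr_square)
  also have "c powr (2 * \<alpha>) / L * (\<mu> * a) = hank_const \<alpha> * a"
    using L c by (simp add: \<mu>_def hank_const_def L_def[symmetric] L'_def[symmetric] power2_eq_square)
  finally have "ennreal ((c powr \<alpha> * norm y)\<^sup>2) \<le> ennreal (hank_const \<alpha> * a)" by (rule ennreal_leI)
  then show ?thesis
    using hank_const_pos[OF \<alpha>] a by (simp add: c_def y_def ennreal_mult)
qed

text \<open>The Hankel matrix records only the frequencies n \<ge> 0 of the function on the circle;
  dropping the negative ones from Parseval gives an inequality. As \<open>f\<close> is a polynomial,
  the frequencies k - m are bounded below, and one natural index suffices.\<close>

lemma carl_circle_expansion:
  fixes f :: "nat \<Rightarrow> 'h::complex_hilbert_space"
  assumes P: "ps_conv 1 P" and f: "\<And>m. m \<ge> M \<Longrightarrow> f m = 0" and z: "norm z < 1"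
  shows "(\<Sum>n. ennreal (((norm z)\<^sup>2) ^ n * (norm (poly_moment \<alpha> P f M n ((norm z)\<^sup>2)))\<^sup>2))
    \<le> (\<integral>\<^sup>+t\<in>{0..1}. nsq (carl \<alpha> P f (cis (2 * pi * t) * z)) \<partial>lborel)"
proof -
  define u where "u = (norm z)\<^sup>2"
  define \<Phi> where "\<Phi> k = (1 + real k) powr (1 + \<alpha>) *\<^sub>R P k" for k
  have pc: "ps_conv 1 \<Phi>" unfolding \<Phi>_def by (rule ps_conv_weight[OF P, where \<beta> = "1 + \<alpha>"]) simp
  define Y where "Y m k = (z ^ k * cnj z ^ m) *\<^sub>C cblinfun_apply (\<Phi> k) (f m)" for m k
  \<comment> \<open>Index \<open>i\<close> carries the frequency i - M, so that k = m + i - M;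
    frequency \<open>n\<close> sits at index n + M, where the power u^m arises from z^m (cnj
    z)^m.\<close>
  define V where "V i = (\<Sum>m<M. if M \<le> m + i then Y m (m + i - M) else 0)" for i
  let ?v = "\<lambda>m i. if M \<le> m + i then Y m (m + i - M) else 0"
  let ?c = "\<lambda>i M t. cis (2 * pi * of_int (int i - int M) * t)"
  have Y_sum: "summable (\<lambda>k. norm (Y m k))" for m
  proof (rule summable_comparison_test')
    show "summable (\<lambda>k. norm (z ^ k *\<^sub>C \<Phi> k) * norm (cnj z ^ m *\<^sub>C f m))"
      by (intro summable_mult2 ps_conv_summable_norm[OF pc z])
    fix k
    have "Y m k = cblinfun_apply (z ^ k *\<^sub>C \<Phi> k) (cnj z ^ m *\<^sub>C f m)"
      by (simp add: Y_def cblinfun_apply_simps scaleC_scaleC mult.commute)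
    then show "norm (norm (Y m k)) \<le> norm (z ^ k *\<^sub>C \<Phi> k) * norm (cnj z ^ m *\<^sub>C f m)"
      by (simp add: norm_cblinfun_apply)
  qed
  have V_sum: "summable (\<lambda>i. norm (V i))"
  proof (rule summable_comparison_test')
    show "summable (\<lambda>i. \<Sum>m<M. norm (?v m i))"
    proof (rule summable_sum)
      fix m assume m: "m \<in> {..<M}"
      have "summable (\<lambda>i. norm (if M \<le> m + (i + (M - m)) then Y m (m + (i + (M - m)) - M) else 0))"
        using m Y_sum[of m] by simp
      then show "summable (\<lambda>i. norm (?v m i))"
        by (rule summable_iff_shift[THEN iffD1])
    qed
  qed (simp add: V_def norm_sum)
  have expand: "carl \<alpha> P f (cis (2 * pi * t) * z) = (\<Sum>i. ?c i M t *\<^sub>C V i)" for t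
  proof -
    let ?e = "cis (2 * pi * t) * z"
    have e: "norm ?e < 1" using z by (simp add: norm_mult)
    have pf: "psum f (cnj ?e) = (\<Sum>m<M. cnj ?e ^ m *\<^sub>C f m)"
      unfolding psum_def by (rule suminf_finite) (use f in \<open>auto simp: not_less\<close>)
    have "(\<lambda>i. \<Sum>m<M. ?c i M t *\<^sub>C (?v m i))
        sums (\<Sum>m<M. cblinfun_apply (psum \<Phi> ?e) (cnj ?e ^ m *\<^sub>C f m))"
    proof (rule sums_sum)
      fix m assume "m \<in> {..<M}"
      then have m: "m < M" by simp
      let ?g = "\<lambda>i. ?c i M t *\<^sub>C (?v m i)"
      have "(\<lambda>k. cblinfun_apply (?e ^ k *\<^sub>C \<Phi> k) (cnj ?e ^ m *\<^sub>C f m)) sums cblinfun_apply (psum \<Phi> ?e) (cnj ?e ^ m *\<^sub>C f m)"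
        by (rule bounded_linear.sums[OF bounded_linear_cblinfun_apply_left psum_sums[OF pc e]])
      moreover have "cblinfun_apply (?e ^ k *\<^sub>C \<Phi> k) (cnj ?e ^ m *\<^sub>C f m) = ?g (k + (M - m))" for k
      proof -
        have c: "cis (2 * pi * t) ^ k * cnj (cis (2 * pi * t)) ^ m = ?c k m t"
          by (simp add: cis_cnj Complex.DeMoivre cis_mult algebra_simps)
        have "cblinfun_apply (?e ^ k *\<^sub>C \<Phi> k) (cnj ?e ^ m *\<^sub>C f m) = (?e ^ k * cnj ?e ^ m) *\<^sub>C cblinfun_apply (\<Phi> k) (f m)"
          by (simp add: cblinfun_apply_simps scaleC_scaleC mult.commute)
        also have "?e ^ k * cnj ?e ^ m = ?c k m t * (z ^ k * cnj z ^ m)"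
          unfolding c[symmetric] by (simp add: power_mult_distrib mult_ac)
        finally have *: "cblinfun_apply (?e ^ k *\<^sub>C \<Phi> k) (cnj ?e ^ m *\<^sub>C f m) = ?c k m t *\<^sub>C Y m k"
          by (simp only: Y_def scaleC_scaleC)
        have "int (k + (M - m)) - int M = int k - int m" "M \<le> m + (k + (M - m))" "m + (k + (M - m)) - M = k"
          using m by auto
        then show ?thesis unfolding * by (simp only: if_True)
      qed
      ultimately have "(\<lambda>k. ?g (k + (M - m))) sums cblinfun_apply (psum \<Phi> ?e) (cnj ?e ^ m *\<^sub>C f m)" by (simp only:)
      moreover have "?g i = 0" if "i < M - m" for i using that by auto
      ultimately show "?g sums cblinfun_apply (psum \<Phi> ?e) (cnj ?e ^ m *\<^sub>C f m)"
        by (subst (asm) sums_zero_iff_shift) auto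
    qed
    moreover have "(\<Sum>m<M. ?c i M t *\<^sub>C (?v m i))
        = ?c i M t *\<^sub>C V i" for i
      unfolding V_def by (rule scaleC.sum_right[symmetric])
    moreover have "(\<Sum>m<M. cblinfun_apply (psum \<Phi> ?e) (cnj ?e ^ m *\<^sub>C f m)) = carl \<alpha> P f ?e"
      unfolding carl_def pf \<Phi>_def[symmetric, abs_def]
      by (rule linear_sum[OF bounded_linear.linear[OF bounded_linear_cblinfun_apply], symmetric])
    ultimately show ?thesis by (simp add: sums_iff)
  qed
  have V_norm: "(norm (V (n + M)))\<^sup>2 = u ^ n * (norm (poly_moment \<alpha> P f M n u))\<^sup>2" for n
  proof -
    have zz: "z * cnj z = of_real u" unfolding u_def by (rule complex_norm_square[symmetric])
    have "V (n + M) = (\<Sum>m<M. z ^ n *\<^sub>C ((1 + real (m + n)) powr (1 + \<alpha>) * u ^ m) *\<^sub>R cblinfun_apply (P (m + n)) (f m))"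
      unfolding V_def
    proof (intro sum.cong refl)
      fix m
      have "z ^ (m + n) * cnj z ^ m = z ^ n * (z * cnj z) ^ m" by (simp add: power_add power_mult_distrib mult_ac)
      then have zm: "z ^ (m + n) * cnj z ^ m = z ^ n * of_real (u ^ m)" by (simp only: zz of_real_power)
      have "Y m (m + n) = z ^ n *\<^sub>C of_real (u ^ m) *\<^sub>C cblinfun_apply (\<Phi> (m + n)) (f m)"
        by (simp only: Y_def zm scaleC_scaleC)
      also have "of_real (u ^ m) *\<^sub>C cblinfun_apply (\<Phi> (m + n)) (f m) = u ^ m *\<^sub>R cblinfun_apply (\<Phi> (m + n)) (f m)"
        by (rule scaleC_of_real)
      also have "\<dots> = ((1 + real (m + n)) powr (1 + \<alpha>) * u ^ m) *\<^sub>R cblinfun_apply (P (m + n)) (f m)"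
        by (simp add: \<Phi>_def cblinfun_apply_simps mult.commute)
      finally show "(if M \<le> m + (n + M) then Y m (m + (n + M) - M) else 0)
          = z ^ n *\<^sub>C ((1 + real (m + n)) powr (1 + \<alpha>) * u ^ m) *\<^sub>R cblinfun_apply (P (m + n)) (f m)" by simp
    qed
    also have "\<dots> = z ^ n *\<^sub>C poly_moment \<alpha> P f M n u" unfolding poly_moment_def by (rule scaleC.sum_right[symmetric])
    finally show ?thesis
      by (simp add: norm_scaleC norm_power power_mult_distrib u_def power_mult[symmetric] mult.commute)
  qed
  have "(\<Sum>n. ennreal (u ^ n * (norm (poly_moment \<alpha> P f M n u))\<^sup>2)) = (\<Sum>n. nsq (V (n + M)))"
    by (simp only: V_norm)
  also have "\<dots> \<le> sq_sum V" by (rule ennreal_suminf_shift_le)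
  also have "\<dots> = (\<integral>\<^sup>+t\<in>{0..1}. nsq (carl \<alpha> P f (cis (2 * pi * t) * z)) \<partial>lborel)"
    unfolding expand by (rule circle_parseval[symmetric, OF _ V_sum]) (simp add: inj_on_def)
  finally show ?thesis by (simp only: u_def)
qed

text \<open>\<open>hank_le_moment\<close> summed over \<open>n\<close>; the factor 1 / pi undoes the
  one of the radial formula. General sequences are reached by truncation in
  \<open>hank_energy_le\<close>.\<close>

lemma hank_bound_poly:
  fixes f :: "nat \<Rightarrow> 'h::complex_hilbert_space"
  assumes P: "ps_conv 1 P" and f: "\<And>m. m \<ge> M \<Longrightarrow> f m = 0" and \<alpha>: "\<alpha> > 0"
  shows "(\<Sum>n. ennreal (((1 + real n) powr \<alpha> * norm (hank P f n))\<^sup>2))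
    \<le> ennreal (hank_const \<alpha> / pi) * (\<integral>\<^sup>+z\<in>ball 0 1. ennreal ((norm (carl \<alpha> P f z))\<^sup>2 * (1 - (norm z)\<^sup>2)) \<partial>lborel)"
proof -
  have geo: "geo f" by (rule geo_finite[of M]) (use f in auto)
  let ?p = "\<lambda>n u. (norm (poly_moment \<alpha> P f M n u))\<^sup>2"
  define K where "K u = ennreal (1 - u) * (\<Sum>n. ennreal (u ^ n * ?p n u))" for u
  have meas0: "(\<lambda>u. ?p n u) \<in> borel_measurable borel" for n
    by (intro borel_measurable_continuous_onI continuous_intros)
  note [measurable] = meas0
  have [measurable]: "K \<in> borel_measurable borel" unfolding K_def[abs_def] by measurable
  let ?q = "\<lambda>z. ennreal ((norm (carl \<alpha> P f z))\<^sup>2 * (1 - (norm z)\<^sup>2))"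
  let ?A = "\<lambda>n. \<integral>\<^sup>+u\<in>{0..1}. ennreal ((1 - u) * (u ^ n * ?p n u)) \<partial>lborel"
  have "(\<Sum>n. ?A n) = (\<integral>\<^sup>+u\<in>{0..1}. K u \<partial>lborel)"
  proof -
    have "K u * indicator {0..1} u = (\<Sum>n. ennreal ((1 - u) * (u ^ n * ?p n u)) * indicator {0..1} u)" for u
    proof (cases "u \<in> {0..1}")
      case True
      then show ?thesis unfolding K_def by (simp add: ennreal_mult)
    qed simp
    then have "(\<integral>\<^sup>+u\<in>{0..1}. K u \<partial>lborel) = (\<integral>\<^sup>+u. (\<Sum>n. ennreal ((1 - u) * (u ^ n * ?p n u)) * indicator {0..1} u) \<partial>lborel)"
      by (simp only:)
    also have "\<dots> = (\<Sum>n. ?A n)" by (rule nn_integral_suminf) measurable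
    finally show ?thesis ..
  qed
  also have "ennreal pi * \<dots> = (\<integral>\<^sup>+z\<in>ball (0::complex) 1. K ((norm z)\<^sup>2) \<partial>lborel)"
    by (rule nn_integral_disc_radial[symmetric]) simp
  also have "\<dots> \<le> (\<integral>\<^sup>+z\<in>ball 0 1. (\<integral>\<^sup>+t\<in>{0..1}. ?q (cis (2 * pi * t) * z) \<partial>lborel) \<partial>lborel)"
  proof (rule nn_integral_mono)
    fix z :: complex
    show "K ((norm z)\<^sup>2) * indicator (ball 0 1) z \<le> (\<integral>\<^sup>+t\<in>{0..1}. ?q (cis (2 * pi * t) * z) \<partial>lborel) * indicator (ball 0 1) z"
    proof (cases "norm z < 1")
      case True
      have "K ((norm z)\<^sup>2) \<le> (\<integral>\<^sup>+t\<in>{0..1}. ?q (cis (2 * pi * t) * z) \<partial>lborel)"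
        unfolding circle_mean_weighted[OF True carl_circle_measurable[OF P geo True]] K_def
        by (intro mult_left_mono carl_circle_expansion[OF P f True]) auto
      then show ?thesis by (rule mult_right_mono) simp
    qed simp
  qed
  also have "\<dots> = (\<integral>\<^sup>+z\<in>ball 0 1. ?q z \<partial>lborel)"
    by (rule nn_integral_disc_circle_means[OF carl_measurable[OF P geo], symmetric])
  finally have A_le: "ennreal pi * (\<Sum>n. ?A n) \<le> (\<integral>\<^sup>+z\<in>ball 0 1. ?q z \<partial>lborel)" .
  have "(\<Sum>n. ennreal (((1 + real n) powr \<alpha> * norm (hank P f n))\<^sup>2)) \<le> (\<Sum>n. ennreal (hank_const \<alpha>) * ?A n)"
    by (intro suminf_le hank_le_moment[OF \<alpha> f]) auto
  also have "\<dots> = ennreal (hank_const \<alpha> / pi) * (ennreal pi * (\<Sum>n. ?A n))"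
  proof -
    have "ennreal (hank_const \<alpha>) = ennreal (hank_const \<alpha> / pi) * ennreal pi"
      using hank_const_pos[OF \<alpha>] by (simp add: ennreal_mult[symmetric])
    then show ?thesis unfolding ennreal_suminf_cmult by (simp only: mult.assoc)
  qed
  also have "\<dots> \<le> ennreal (hank_const \<alpha> / pi) * (\<integral>\<^sup>+z\<in>ball 0 1. ?q z \<partial>lborel)"
    by (intro mult_left_mono A_le) simp
  finally show ?thesis .
qed

section \<open>From sequences back to functions\<close>

lemma frac_deriv_eq_psum:
  "frac_deriv \<alpha> f = psum (\<lambda>n. (1 + real n) powr \<alpha> *\<^sub>R taylor_coeff f n)"
  by (simp add: frac_deriv_def psum_def scaleC_scaleR fun_eq_iff)

lemma hankel_eq_psum: "hankel \<phi> f = psum (hank (taylor_coeff \<phi>) (taylor_coeff f))"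
  by (simp add: hankel_def psum_def hank_def fun_eq_iff)

lemma ps_conv_powr: "ps_conv R a \<Longrightarrow> ps_conv R (\<lambda>n. (1 + real n) powr \<beta> *\<^sub>R a n)"
  by (erule ps_conv_weight[where \<beta> = \<beta>]) simp

lemma taylor_coeff_psum_unit:
  fixes a :: "nat \<Rightarrow> 'a::{complex_normed_vector,banach}"
  shows "ps_conv 1 a \<Longrightarrow> taylor_coeff (psum a) = a"
  by (rule ext, rule taylor_coeff_psum[where R = 1]) auto

lemma psum_in_Hol: "ps_conv 1 a \<Longrightarrow> psum a \<in> Hol"
  unfolding Hol_def by (auto intro: analytic_in_psum)

lemma Hol_ps_conv:
  fixes \<phi> :: "complex \<Rightarrow> ('h::complex_hilbert_space, 'h) cblinfun"
  shows "\<phi> \<in> Hol \<Longrightarrow> ps_conv 1 (taylor_coeff \<phi>)"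
  unfolding Hol_def using analytic_in_power_series(1)[OF separated_points_cblinfun] by blast

lemma Hol_ext_geo:
  fixes f :: "complex \<Rightarrow> 'h::complex_hilbert_space"
  assumes "f \<in> Hol_ext"
  shows "geo (taylor_coeff f)" and "norm z < 1 \<Longrightarrow> f z = psum (taylor_coeff f) z"
proof -
  obtain r g where r: "r > 1" and g: "analytic_in g (ball 0 r)" "\<And>z. z \<in> ball 0 1 \<Longrightarrow> g z = f z"
    using assms unfolding Hol_ext_def by auto
  note ps = analytic_in_power_series[OF separated_points_hilbert g(1)]
  have eq: "f z = psum (taylor_coeff g) z" if "norm z < 1" for z
    using ps(2)[of z] g(2)[of z] that r by simp
  have "taylor_coeff f = taylor_coeff g"
    by (rule ext, rule taylor_coeff_psum[where R = 1]) (use ps_conv_mono[OF ps(1)] r eq in auto)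
  then show "geo (taylor_coeff f)" "norm z < 1 \<Longrightarrow> f z = psum (taylor_coeff f) z"
    using ps(1) r eq by (auto simp: geo_def)
qed

lemma psum_in_Hol_ext:
  fixes a :: "nat \<Rightarrow> 'h::complex_hilbert_space"
  assumes "geo a" shows "psum a \<in> Hol_ext"
proof -
  obtain R where R: "R > 1" "ps_conv R a" using assms by (auto simp: geo_def)
  then have "analytic_in (psum a) (ball 0 R)" by (auto intro: analytic_in_psum)
  then show ?thesis using R psum_in_Hol[OF geo_ps_conv[OF assms]] unfolding Hol_ext_def by blast
qed

section \<open>Extended square roots and suprema over the unit sphere\<close>

lemma ennreal_sqrt_power2 [simp]: "(ennreal_sqrt x)\<^sup>2 = x"
proof (cases x)
  case (real r)
  then show ?thesis by (simp add: ennreal_sqrt_def ennreal_power)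
qed (simp add: ennreal_sqrt_def power2_eq_square ennreal_mult_top)

lemma ennreal_sqrt_of_power2: "ennreal_sqrt (x\<^sup>2) = x"
proof (cases x)
  case (real r)
  then show ?thesis by (simp add: ennreal_sqrt_def ennreal_power)
qed (simp add: ennreal_sqrt_def power2_eq_square ennreal_mult_top)

lemma ennreal_sqrt_mono: "x \<le> y \<Longrightarrow> ennreal_sqrt x \<le> ennreal_sqrt y"
proof (cases y)
  case (real r)
  moreover assume "x \<le> y"
  ultimately show ?thesis
    by (cases x) (auto simp: ennreal_sqrt_def ennreal_leI top_unique)
qed (simp add: ennreal_sqrt_def)

lemma ennreal_power2_le_imp_le: "x\<^sup>2 \<le> y\<^sup>2 \<Longrightarrow> x \<le> (y::ennreal)"
  using ennreal_sqrt_mono[of "x\<^sup>2" "y\<^sup>2"] by (simp only: ennreal_sqrt_of_power2)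

definition hank_energy :: "real \<Rightarrow> (nat \<Rightarrow> ('h::complex_hilbert_space, 'h) cblinfun) \<Rightarrow> (nat \<Rightarrow> 'h) \<Rightarrow> ennreal"
  where "hank_energy \<alpha> P a = (\<Sum>n. ennreal (((1 + real n) powr \<alpha> * norm (hank P a n))\<^sup>2))"

definition carl_energy :: "real \<Rightarrow> (nat \<Rightarrow> ('h::complex_hilbert_space, 'h) cblinfun) \<Rightarrow> (nat \<Rightarrow> 'h) \<Rightarrow> ennreal"
  where "carl_energy \<alpha> P a = (\<integral>\<^sup>+z\<in>ball 0 1.
    ennreal ((norm (carl \<alpha> P a z))\<^sup>2 * (1 - (norm z)\<^sup>2)) \<partial>lborel)"

definition unit_seq :: "(nat \<Rightarrow> 'h::complex_hilbert_space) set"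
  where "unit_seq = {a. geo a \<and> sq_sum a = 1}"

lemma H2_norm_eq: "H2_norm f = ennreal_sqrt (sq_sum (taylor_coeff f))"
  by (simp add: H2_norm_def)

text \<open>Functions are total with arbitrary values off the disc, so the map to coefficients need
  not be injective; a supremum of coefficient expressions depends on its image alone.\<close>

lemma taylor_coeff_Hol_ext1: "taylor_coeff ` Hol_ext1 = (unit_seq :: (nat \<Rightarrow> 'h::complex_hilbert_space) set)"
proof -
  have one: "ennreal_sqrt x = 1 \<longleftrightarrow> x = 1" for x
    by (metis ennreal_sqrt_power2 ennreal_sqrt_of_power2 power_one)
  show ?thesis
  proof (intro equalityI subsetI)
    fix a assume "a \<in> (unit_seq :: (nat \<Rightarrow> 'h) set)"
    then have a: "geo a" "sq_sum a = 1" by (auto simp: unit_seq_def)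
    have t: "taylor_coeff (psum a) = a" by (rule taylor_coeff_psum_unit[OF geo_ps_conv[OF a(1)]])
    then have "psum a \<in> Hol_ext1"
      using psum_in_Hol_ext[OF a(1)] a(2) by (simp add: Hol_ext1_def H2_norm_eq one)
    then show "a \<in> taylor_coeff ` Hol_ext1" using t by (metis imageI)
  qed (auto simp: unit_seq_def Hol_ext1_def H2_norm_eq one dest: Hol_ext_geo(1))
qed

lemma H2_norm_hankel:
  fixes \<phi> :: "complex \<Rightarrow> ('h::complex_hilbert_space, 'h) cblinfun"
  assumes \<phi>: "\<phi> \<in> Hol" and f: "f \<in> Hol_ext"
  shows "H2_norm (frac_deriv \<alpha> (hankel \<phi> f)) = ennreal_sqrt (hank_energy \<alpha> (taylor_coeff \<phi>) (taylor_coeff f))"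
proof -
  have pc: "ps_conv 1 (hank (taylor_coeff \<phi>) (taylor_coeff f))"
    by (rule ps_conv_hank[OF Hol_ps_conv[OF \<phi>] Hol_ext_geo(1)[OF f]])
  have "taylor_coeff (frac_deriv \<alpha> (hankel \<phi> f)) = (\<lambda>n. (1 + real n) powr \<alpha> *\<^sub>R hank (taylor_coeff \<phi>) (taylor_coeff f) n)"
    unfolding frac_deriv_eq_psum hankel_eq_psum taylor_coeff_psum_unit[OF pc]
    by (rule taylor_coeff_psum_unit[OF ps_conv_powr[OF pc]])
  then show ?thesis by (simp add: H2_norm_eq hank_energy_def)
qed

lemma frac_deriv_in_Hol:
  fixes \<phi> :: "complex \<Rightarrow> ('h::complex_hilbert_space, 'h) cblinfun"
  assumes "\<phi> \<in> Hol" shows "frac_deriv \<alpha> \<phi> \<in> Hol"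
  unfolding frac_deriv_eq_psum by (intro psum_in_Hol ps_conv_powr Hol_ps_conv assms)

lemma frac_deriv_frac_deriv:
  fixes \<phi> :: "complex \<Rightarrow> ('h::complex_hilbert_space, 'h) cblinfun"
  assumes "\<phi> \<in> Hol" shows "frac_deriv 1 (frac_deriv \<alpha> \<phi>) = frac_deriv (1 + \<alpha>) \<phi>"
proof -
  have "taylor_coeff (frac_deriv \<alpha> \<phi>) = (\<lambda>n. (1 + real n) powr \<alpha> *\<^sub>R taylor_coeff \<phi> n)"
    unfolding frac_deriv_eq_psum by (intro taylor_coeff_psum_unit ps_conv_powr Hol_ps_conv assms)
  then show ?thesis unfolding frac_deriv_eq_psum[of 1] frac_deriv_eq_psum[of "1 + \<alpha>"]
    by (simp add: powr_add)
qed

lemma carl_energy_eq: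
  fixes \<phi> :: "complex \<Rightarrow> ('h::complex_hilbert_space, 'h) cblinfun"
  assumes f: "f \<in> Hol_ext"
  shows "(\<integral>\<^sup>+z\<in>ball 0 1. ennreal ((norm (cblinfun_apply (frac_deriv (1 + \<alpha>) \<phi> z) (f (cnj z))))\<^sup>2 * (1 - (cmod z)\<^sup>2)) \<partial>lborel)
    = carl_energy \<alpha> (taylor_coeff \<phi>) (taylor_coeff f)"
  unfolding carl_energy_def
proof (rule nn_integral_cong)
  fix z :: complex
  show "ennreal ((norm (cblinfun_apply (frac_deriv (1 + \<alpha>) \<phi> z) (f (cnj z))))\<^sup>2 * (1 - (cmod z)\<^sup>2)) * indicator (ball 0 1) z
      = ennreal ((norm (carl \<alpha> (taylor_coeff \<phi>) (taylor_coeff f) z))\<^sup>2 * (1 - (cmod z)\<^sup>2)) * indicator (ball 0 1) z"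
  proof (cases "norm z < 1")
    case True
    then have "f (cnj z) = psum (taylor_coeff f) (cnj z)" by (intro Hol_ext_geo(2)[OF f]) simp
    then show ?thesis by (simp add: carl_def frac_deriv_eq_psum)
  qed simp
qed

lemma hank_scaleR:
  assumes "ps_conv 1 P" "geo a"
  shows "hank P (\<lambda>m. c *\<^sub>R a m) n = c *\<^sub>R hank P a n"
  unfolding hank_def cblinfun_apply_simps
  by (rule suminf_scaleR_right[symmetric]) (rule summable_norm_cancel[OF hank_summable[OF assms]])

lemma hank_energy_scaleR:
  assumes "ps_conv 1 P" "geo a"
  shows "hank_energy \<alpha> P (\<lambda>m. c *\<^sub>R a m) = ennreal (c\<^sup>2) * hank_energy \<alpha> P a"
  unfolding hank_energy_def hank_scaleR[OF assms] ennreal_suminf_cmult[symmetric]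
  by (intro suminf_cong) (simp add: power_mult_distrib ennreal_mult[symmetric] mult_ac)

lemma carl_scaleR:
  fixes a :: "nat \<Rightarrow> 'h::complex_hilbert_space"
  assumes "geo a" "norm z < 1"
  shows "carl \<alpha> P (\<lambda>m. c *\<^sub>R a m) z = c *\<^sub>R carl \<alpha> P a z"
proof -
  have "(\<lambda>m. c *\<^sub>R (cnj z ^ m *\<^sub>C a m)) sums (c *\<^sub>R psum a (cnj z))"
    by (intro sums_scaleR_right psum_sums[OF geo_ps_conv[OF assms(1)]]) (use assms(2) in simp)
  then have "psum (\<lambda>m. c *\<^sub>R a m) (cnj z) = c *\<^sub>R psum a (cnj z)"
    unfolding psum_def[of "\<lambda>m. c *\<^sub>R a m"] by (simp add: scaleC_scaleR sums_iff)
  then show ?thesis by (simp add: carl_def cblinfun_apply_simps)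
qed

lemma carl_energy_scaleR:
  fixes a :: "nat \<Rightarrow> 'h::complex_hilbert_space"
  assumes "ps_conv 1 P" "geo a"
  shows "carl_energy \<alpha> P (\<lambda>m. c *\<^sub>R a m) = ennreal (c\<^sup>2) * carl_energy \<alpha> P a"
proof -
  have "carl_energy \<alpha> P (\<lambda>m. c *\<^sub>R a m) = (\<integral>\<^sup>+z. ennreal (c\<^sup>2) * (ennreal ((norm (carl \<alpha> P a z))\<^sup>2 * (1 - (norm z)\<^sup>2)) * indicator (ball 0 1) z) \<partial>lborel)"
    unfolding carl_energy_def
  proof (rule nn_integral_cong)
    fix z :: complex
    show "ennreal ((norm (carl \<alpha> P (\<lambda>m. c *\<^sub>R a m) z))\<^sup>2 * (1 - (norm z)\<^sup>2)) * indicator (ball 0 1) z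
        = ennreal (c\<^sup>2) * (ennreal ((norm (carl \<alpha> P a z))\<^sup>2 * (1 - (norm z)\<^sup>2)) * indicator (ball 0 1) z)"
    proof (cases "norm z < 1")
      case True
      then show ?thesis
        by (simp add: carl_scaleR[OF assms(2)] power_mult_distrib ennreal_mult'[symmetric] mult.assoc)
    qed simp
  qed
  also have "\<dots> = ennreal (c\<^sup>2) * carl_energy \<alpha> P a"
    unfolding carl_energy_def by (rule nn_integral_cmult) (use carl_measurable[OF assms] in simp)
  finally show ?thesis .
qed

text \<open>Normalisation of \<open>b\<close>. The zero sequence cannot be normalised, but
  homogeneity with c = 0 gives \<open>Q b = 0\<close>; this also covers the zero space, where
  \<open>unit_seq\<close> is empty.\<close>

lemma le_SUP_unit_seq:
  fixes Q :: "(nat \<Rightarrow> 'h::complex_hilbert_space) \<Rightarrow> ennreal"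
  assumes Q: "\<And>c a. geo a \<Longrightarrow> Q (\<lambda>m. c *\<^sub>R a m) = ennreal (c\<^sup>2) * Q a" and b: "geo b"
  shows "Q b \<le> (SUP a\<in>unit_seq. Q a) * sq_sum b"
proof -
  obtain C q where C: "0 \<le> C" "0 < q" "q < 1" "\<And>m. norm (b m) \<le> C * q ^ m" using geo_bound[OF b] by blast
  have sm: "summable (\<lambda>m. (norm (b m))\<^sup>2)"
  proof (rule summable_comparison_test'[OF summable_mult[OF geo_summable_norm[OF b], of C]])
    fix m
    have "norm (b m) \<le> C" using C(4)[of m] mult_left_mono[OF power_le_one[of q m] C(1)] C(2,3) by simp
    then show "norm ((norm (b m))\<^sup>2) \<le> C * norm (b m)" by (simp add: power2_eq_square mult_right_mono)
  qed
  define s where "s = (\<Sum>m. (norm (b m))\<^sup>2)"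
  have s: "sq_sum b = ennreal s" "0 \<le> s"
    unfolding s_def by (simp_all add: suminf_ennreal2[OF _ sm] suminf_nonneg[OF sm])
  show ?thesis
  proof (cases "s = 0")
    case True
    then have "b m = 0" for m using suminf_eq_zero_iff[OF sm] by (simp add: s_def)
    then have "b = (\<lambda>m. 0 *\<^sub>R b m)" by auto
    then have "Q b = ennreal (0\<^sup>2) * Q b" using Q[OF b, of 0] by simp
    then show ?thesis by simp
  next
    case False
    then have s0: "s > 0" using s(2) by simp
    define c where "c = 1 / sqrt s"
    have c2: "c\<^sup>2 = 1 / s" using s0 by (simp add: c_def power_divide)
    have "sq_sum (\<lambda>m. c *\<^sub>R b m) = ennreal (c\<^sup>2) * sq_sum b"
      unfolding ennreal_suminf_cmult[symmetric]
      by (intro suminf_cong) (simp add: power_mult_distrib ennreal_mult)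
    also have "\<dots> = 1" using s0 by (simp add: s(1) c2 ennreal_mult[symmetric])
    finally have "(\<lambda>m. c *\<^sub>R b m) \<in> unit_seq"
      using geo_le[OF b, of "\<lambda>m. c *\<^sub>R b m" "\<bar>c\<bar>"] by (simp add: unit_seq_def)
    then have "ennreal (c\<^sup>2) * Q b \<le> (SUP a\<in>unit_seq. Q a)" unfolding Q[OF b, symmetric] by (rule SUP_upper)
    then have "ennreal s * (ennreal (c\<^sup>2) * Q b) \<le> ennreal s * (SUP a\<in>unit_seq. Q a)" by (rule mult_left_mono) simp
    moreover have "ennreal s * ennreal (c\<^sup>2) = 1" using s0 by (simp add: c2 ennreal_mult[symmetric])
    ultimately have "Q b \<le> ennreal s * (SUP a\<in>unit_seq. Q a)" by (simp only: mult.assoc[symmetric] mult_1)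
    then show ?thesis by (simp only: s(1) mult.commute)
  qed
qed

text \<open>The energy of a truncation is compared with the supremum and not with the Carleson
  energy of \<open>a\<close> itself, since truncation decreases the norm but need not decrease the
  Carleson energy. The limit is taken for finitely many rows \<open>n < L\<close> at a time, each
  row being a convergent series.\<close>

lemma hank_energy_le:
  fixes a :: "nat \<Rightarrow> 'h::complex_hilbert_space"
  assumes P: "ps_conv 1 P" and \<alpha>: "\<alpha> > 0" and a: "a \<in> unit_seq"
  shows "hank_energy \<alpha> P a \<le> ennreal (hank_const \<alpha> / pi) * (SUP a\<in>unit_seq. carl_energy \<alpha> P a)"
    (is "_ \<le> ?B")
proof -
  have geo: "geo a" and sq: "sq_sum a = 1" using a by (auto simp: unit_seq_def)
  define t where "t M m = (if m < M then a m else 0)" for M m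
  have geo_t: "geo (t M)" for M by (rule geo_finite[of M]) (simp add: t_def)
  have t_le: "hank_energy \<alpha> P (t M) \<le> ?B" for M
  proof -
    have "sq_sum (t M) \<le> sq_sum a" by (rule suminf_le) (auto simp: t_def)
    then have "carl_energy \<alpha> P (t M) \<le> (SUP a\<in>unit_seq. carl_energy \<alpha> P a) * 1"
      unfolding sq by (intro order_trans[OF le_SUP_unit_seq[OF carl_energy_scaleR[OF P] geo_t]] mult_left_mono) auto
    then have "ennreal (hank_const \<alpha> / pi) * carl_energy \<alpha> P (t M) \<le> ?B" by (intro mult_left_mono) auto
    moreover have "hank_energy \<alpha> P (t M) \<le> ennreal (hank_const \<alpha> / pi) * carl_energy \<alpha> P (t M)"
      unfolding hank_energy_def carl_energy_def by (rule hank_bound_poly[OF P _ \<alpha>, of M]) (simp add: t_def)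
    ultimately show ?thesis by (rule order_trans[rotated])
  qed
  have lim: "(\<lambda>M. hank P (t M) n) \<longlonglongrightarrow> hank P a n" for n
  proof -
    have "hank P (t M) n = (\<Sum>m<M. cblinfun_apply (P (m + n)) (a m))" for M
      by (subst hank_poly[of M]) (auto simp: t_def)
    then show ?thesis
      unfolding hank_def using summable_LIMSEQ[OF summable_norm_cancel[OF hank_summable[OF P geo]]] by simp
  qed
  have "(\<Sum>n<L. ennreal (((1 + real n) powr \<alpha> * norm (hank P a n))\<^sup>2)) \<le> ?B" for L
  proof (rule LIMSEQ_le_const2)
    show "(\<lambda>M. \<Sum>n<L. ennreal (((1 + real n) powr \<alpha> * norm (hank P (t M) n))\<^sup>2))
        \<longlonglongrightarrow> (\<Sum>n<L. ennreal (((1 + real n) powr \<alpha> * norm (hank P a n))\<^sup>2))"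
      by (intro tendsto_sum tendsto_ennrealI tendsto_intros lim)
    have "(\<Sum>n<L. ennreal (((1 + real n) powr \<alpha> * norm (hank P (t M) n))\<^sup>2)) \<le> hank_energy \<alpha> P (t M)" for M
      unfolding hank_energy_def by (rule sum_le_suminf) auto
    then show "\<exists>N. \<forall>M\<ge>N. (\<Sum>n<L. ennreal (((1 + real n) powr \<alpha> * norm (hank P (t M) n))\<^sup>2)) \<le> ?B"
      using t_le order_trans by blast
  qed
  then show ?thesis unfolding hank_energy_def by (intro suminf_le_const) auto
qed

section \<open>Comparison of the two norms\<close>

context
  fixes \<alpha> :: real and \<phi> :: "complex \<Rightarrow> ('h::complex_hilbert_space, 'h) cblinfun"
  assumes \<alpha>: "\<alpha> > 0" and \<phi>: "\<phi> \<in> Hol"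
begin

lemma H2_operator_norm_eq:
  "H2_operator_norm (\<lambda>f. frac_deriv \<alpha> (hankel \<phi> f)) = (SUP a\<in>unit_seq. ennreal_sqrt (hank_energy \<alpha> (taylor_coeff \<phi>) a))"
  unfolding H2_operator_norm_def taylor_coeff_Hol_ext1[symmetric] image_image
  by (intro SUP_cong refl H2_norm_hankel \<phi>) (simp add: Hol_ext1_def)

lemma carl_energy_SUP_eq:
  "(SUP f\<in>Hol_ext1. \<integral>\<^sup>+z\<in>ball 0 1.
      ennreal ((norm (cblinfun_apply (frac_deriv (1 + \<alpha>) \<phi> z) (f (cnj z))))\<^sup>2 * (1 - (cmod z)\<^sup>2)) \<partial>lborel)
    = (SUP a\<in>unit_seq. carl_energy \<alpha> (taylor_coeff \<phi>) a)"
  unfolding taylor_coeff_Hol_ext1[symmetric] image_image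
  by (intro SUP_cong refl carl_energy_eq) (simp add: Hol_ext1_def)

lemma BMOA_C_norm_power2:
  "(BMOA_C_norm (frac_deriv \<alpha> \<phi>))\<^sup>2 = (SUP f\<in>Hol_ext1. \<integral>\<^sup>+z\<in>ball 0 1.
      ennreal ((norm (cblinfun_apply (frac_deriv (1 + \<alpha>) \<phi> z) (f (cnj z))))\<^sup>2 * (1 - (cmod z)\<^sup>2)) \<partial>lborel)"
  by (simp only: BMOA_C_norm_def ennreal_sqrt_power2 frac_deriv_frac_deriv[OF \<phi>])

lemma H2_operator_norm_le:
  "H2_operator_norm (\<lambda>f. frac_deriv \<alpha> (hankel \<phi> f))
    \<le> ennreal (sqrt (hank_const \<alpha> / pi)) * BMOA_C_norm (frac_deriv \<alpha> \<phi>)"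
  unfolding H2_operator_norm_eq
proof (rule SUP_least, rule ennreal_power2_le_imp_le)
  fix a :: "nat \<Rightarrow> 'h" assume a: "a \<in> unit_seq"
  have "(ennreal (sqrt (hank_const \<alpha> / pi)))\<^sup>2 = ennreal (hank_const \<alpha> / pi)"
    using hank_const_pos[OF \<alpha>] by (simp add: ennreal_power)
  then show "(ennreal_sqrt (hank_energy \<alpha> (taylor_coeff \<phi>) a))\<^sup>2
      \<le> (ennreal (sqrt (hank_const \<alpha> / pi)) * BMOA_C_norm (frac_deriv \<alpha> \<phi>))\<^sup>2"
    unfolding power_mult_distrib BMOA_C_norm_power2 carl_energy_SUP_eq ennreal_sqrt_power2
    using hank_energy_le[OF Hol_ps_conv[OF \<phi>] \<alpha> a] by (simp only:)
qed

text \<open>\<open>hankel_bounded\<close> takes a real bound, so an infinite operator norm is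
  treated apart: positivity of \<open>carl_const\<close> then makes the right side
  \<open>top\<close>. Otherwise the bound is N = T^2, and the square root in the constant returns
  from energies to norms.\<close>

lemma BMOA_C_norm_le:
  "BMOA_C_norm (frac_deriv \<alpha> \<phi>)
    \<le> ennreal (sqrt (carl_const \<alpha>)) * H2_operator_norm (\<lambda>f. frac_deriv \<alpha> (hankel \<phi> f))"
    (is "_ \<le> _ * ?T")
proof (cases ?T)
  case top
  then show ?thesis using carl_const_pos[OF \<alpha>] by (simp add: ennreal_mult_top)
next
  case (real T)
  note P = Hol_ps_conv[OF \<phi>]
  have T2: "(SUP a\<in>unit_seq. hank_energy \<alpha> (taylor_coeff \<phi>) a) \<le> ennreal (T\<^sup>2)"
  proof (rule SUP_least)
    fix a :: "nat \<Rightarrow> 'h" assume "a \<in> unit_seq"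
    then have "ennreal_sqrt (hank_energy \<alpha> (taylor_coeff \<phi>) a) \<le> ennreal T"
      unfolding real(2)[symmetric] H2_operator_norm_eq by (rule SUP_upper)
    then have "(ennreal_sqrt (hank_energy \<alpha> (taylor_coeff \<phi>) a))\<^sup>2 \<le> (ennreal T)\<^sup>2" by (rule power_mono) simp
    then show "hank_energy \<alpha> (taylor_coeff \<phi>) a \<le> ennreal (T\<^sup>2)" using real(1) by (simp add: ennreal_power)
  qed
  have N: "hankel_bounded \<alpha> (taylor_coeff \<phi>) (T\<^sup>2) TYPE('h)"
    unfolding hankel_bounded_def
  proof (intro conjI allI impI)
    fix b :: "nat \<Rightarrow> 'h" assume b: "geo b"
    have "hank_energy \<alpha> (taylor_coeff \<phi>) b \<le> ennreal (T\<^sup>2) * sq_sum b"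
      by (rule order_trans[OF le_SUP_unit_seq[OF hank_energy_scaleR[OF P] b] mult_right_mono[OF T2]]) simp_all
    then show "(\<Sum>n. ennreal (((1 + real n) powr \<alpha> * norm (hank (taylor_coeff \<phi>) b n))\<^sup>2)) \<le> ennreal (T\<^sup>2) * sq_sum b"
      by (simp only: hank_energy_def)
  qed simp
  have "(SUP a\<in>unit_seq. carl_energy \<alpha> (taylor_coeff \<phi>) a) \<le> ennreal (carl_const \<alpha> * T\<^sup>2)"
  proof (rule SUP_least)
    fix a :: "nat \<Rightarrow> 'h" assume "a \<in> unit_seq"
    then have "geo a" "sq_sum a = 1" by (auto simp: unit_seq_def)
    then show "carl_energy \<alpha> (taylor_coeff \<phi>) a \<le> ennreal (carl_const \<alpha> * T\<^sup>2)"
      using carl_bound[OF P N _ \<alpha>, of a] by (simp add: carl_energy_def)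
  qed
  moreover have "ennreal (carl_const \<alpha> * T\<^sup>2) = (ennreal (sqrt (carl_const \<alpha>)) * ?T)\<^sup>2"
  proof -
    have "0 \<le> carl_const \<alpha>" using carl_const_pos[OF \<alpha>] by simp
    then have "(ennreal (sqrt (carl_const \<alpha>)) * ennreal T)\<^sup>2 = ennreal (carl_const \<alpha> * T\<^sup>2)"
      using real(1) by (simp add: ennreal_mult[symmetric] ennreal_power power_mult_distrib)
    then show ?thesis unfolding real(2) by (rule sym)
  qed
  ultimately show ?thesis
    by - (rule ennreal_power2_le_imp_le, simp only: BMOA_C_norm_power2 carl_energy_SUP_eq)
qed

lemma bounded_iff_BMOA_C:
  "H2_operator_norm (\<lambda>f. frac_deriv \<alpha> (hankel \<phi> f)) < \<infinity> \<longleftrightarrow> frac_deriv \<alpha> \<phi> \<in> BMOA_C"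
proof -
  have "ennreal C * x < top" if "x < top" for C x using that by (simp add: ennreal_mult_less_top)
  then show ?thesis
    using H2_operator_norm_le BMOA_C_norm_le frac_deriv_in_Hol[OF \<phi>, of \<alpha>]
    by (auto simp: BMOA_C_def intro: le_less_trans)
qed

end

theorem theorem1p4:
  fixes \<alpha> :: real
  assumes separable: "separable_space (euclidean :: 'h::complex_hilbert_space topology)"
    and alpha: "\<alpha> > 0"
  shows "(\<forall>\<phi> :: complex \<Rightarrow> ('h, 'h) cblinfun. \<phi> \<in> Hol \<longrightarrow>
           (H2_operator_norm (\<lambda>f. frac_deriv \<alpha> (hankel \<phi> f)) < \<infinity>
              \<longleftrightarrow> frac_deriv \<alpha> \<phi> \<in> BMOA_C) \<and>
           (BMOA_C_norm (frac_deriv \<alpha> \<phi>))\<^sup>2 =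
             (SUP f\<in>Hol_ext1. \<integral>\<^sup>+z\<in>ball 0 1.
               ennreal ((norm (cblinfun_apply (frac_deriv (1 + \<alpha>) \<phi> z) (f (cnj z))))\<^sup>2
                 * (1 - (cmod z)\<^sup>2)) \<partial>lborel)) \<and>
         (\<exists>c C :: real. c > 0 \<and> C > 0 \<and>
           (\<forall>\<phi> :: complex \<Rightarrow> ('h, 'h) cblinfun. \<phi> \<in> Hol \<longrightarrow>
              H2_operator_norm (\<lambda>f. frac_deriv \<alpha> (hankel \<phi> f))
                \<le> ennreal C * BMOA_C_norm (frac_deriv \<alpha> \<phi>) \<and>
              BMOA_C_norm (frac_deriv \<alpha> \<phi>)
                \<le> ennreal c * H2_operator_norm (\<lambda>f. frac_deriv \<alpha> (hankel \<phi> f))))"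
proof (intro conjI allI impI)
  fix \<phi> :: "complex \<Rightarrow> ('h, 'h) cblinfun" assume \<phi>: "\<phi> \<in> Hol"
  show "H2_operator_norm (\<lambda>f. frac_deriv \<alpha> (hankel \<phi> f)) < \<infinity> \<longleftrightarrow> frac_deriv \<alpha> \<phi> \<in> BMOA_C"
    by (rule bounded_iff_BMOA_C[OF alpha \<phi>])
  show "(BMOA_C_norm (frac_deriv \<alpha> \<phi>))\<^sup>2 =
      (SUP f\<in>Hol_ext1. \<integral>\<^sup>+z\<in>ball 0 1.
        ennreal ((norm (cblinfun_apply (frac_deriv (1 + \<alpha>) \<phi> z) (f (cnj z))))\<^sup>2
          * (1 - (cmod z)\<^sup>2)) \<partial>lborel)"
    by (rule BMOA_C_norm_power2[OF alpha \<phi>])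
next
  have "sqrt (carl_const \<alpha>) > 0" "sqrt (hank_const \<alpha> / pi) > 0"
    using carl_const_pos[OF alpha] hank_const_pos[OF alpha] by simp_all
  then show "\<exists>c C :: real. c > 0 \<and> C > 0 \<and>
      (\<forall>\<phi> :: complex \<Rightarrow> ('h, 'h) cblinfun. \<phi> \<in> Hol \<longrightarrow>
         H2_operator_norm (\<lambda>f. frac_deriv \<alpha> (hankel \<phi> f))
           \<le> ennreal C * BMOA_C_norm (frac_deriv \<alpha> \<phi>) \<and>
         BMOA_C_norm (frac_deriv \<alpha> \<phi>)
           \<le> ennreal c * H2_operator_norm (\<lambda>f. frac_deriv \<alpha> (hankel \<phi> f)))"
    using H2_operator_norm_le[OF alpha] BMOA_C_norm_le[OF alpha] by blast
qed

end
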